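(* Suppose the $A$-grading on $\Bbbk[Y/U]/I$ is admissible and that the composition $$U^*\xrightarrow{\ \alpha\ }\mathrm{Hom}_{\Bbbk[Y/U]}(I,\Bbbk[Y/U]/I)\to T^1(\Bbbk[Y/U]/I)$$ maps $U^*$ to a generating set of the $\Bbbk[Y/U]$-module $T^1(\Bbbk[Y/U]/I)$. Let $T$ be a finite-dimensional subspace of $\mathrm{Hom}_\Bbbk(Y,\Bbbk[Y/U])_0$ which maps surjectively onto $\mathrm{Hom}_\Bbbk(Y,\Bbbk[Y/U]/I)_0$. Let $f\in\Bbbk[T^*]$ with $f(0)\neq0$ be such that the localized family $\tilde J_f\subseteq\Bbbk[Y/U]\otimes_\Bbbk\Bbbk[T^*]_f$ is flat over $\Bbbk[T^*]_f$ with all graded pieces of the quotient locally free of rank $h(a)$, $a\in A$. Then the induced morphism $$\mathrm{Spec}\,\Bbbk[T^*]_f\to H^h_{\Bbbk[Y/U]}$$ is surjective on tangent spaces at the origin $0\in\mathrm{Spec}\,\Bbbk[T^*]_f$ (which maps to the point $I$).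
   Context: Setting. $\Bbbk$ is a field, $Y$ is a finite-dimensional $\Bbbk$-vector space graded by an abelian group $A$, $U\subseteq Y$ is a homogeneous subspace, $\Bbbk[Y]$ is the (symmetric algebra) polynomial ring on $Y$, and $J\subseteq\Bbbk[Y]$ is an $A$-homogeneous ideal such that $\Bbbk[Y]/J$ is flat over $\Bbbk[U]$. $I\subseteq\Bbbk[Y/U]$ is the image of $J$, i.e. $\Bbbk[Y/U]/I=(\Bbbk[Y]/J)\otimes_{\Bbbk[Y]}\Bbbk[Y/U]$. The grading on $\Bbbk[Y/U]/I$ is admissible if each graded piece $(\Bbbk[Y/U]/I)_a$ is finite-dimensional; then $h(a)=\dim_\Bbbk(\Bbbk[Y/U]/I)_a$. The subscript $0$ on Hom-spaces means degree-preserving maps. $T^1(\Bbbk[X]/I)$ (with $X=Y/U$) is the cokernel of $\mathrm{Der}_\Bbbk(\Bbbk[X])\to\mathrm{Hom}_{\Bbbk[X]}(I,\Bbbk[X]/I)$, $\partial\mapsto(f\mapsto\partial f+I)$. The map $\alpha$: base change to $\Bbbk[U]/(U)^2$ gives a flat first-order deformation of $I$ over $\Bbbk[U]/(U)^2$ and hence a linear map $\alpha$. Explicitly, fix a homogeneous splitting $Y=X\oplus U$ and a basis $u_i$ of $U$ with dual basis $u_i^*$; writing $g\in J$ as $g=g_0+\sum_iu_ig_i+(\text{terms of degree}\ge2\text{ in the }u_i)$ with $g_0\in I$, $g_i\in\Bbbk[X]$, $\alpha(u_i^* )$ is the homomorphism $g_0\mapsto g_i+I$. The family $\tilde J$: let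 $t_1,\dots,t_n$ be a basis of $T$ with dual basis $t_i^*$ of $T^*$; $\Bbbk[T^*]$ is the coordinate ring of $T$, with $T^*$ placed in degree $0$. Let $\tau:\Bbbk[Y]\to\Bbbk[Y/U]\otimes_\Bbbk\Bbbk[T^*]$ be the algebra map with $y\mapsto\bar y\otimes1+\sum_it_i(y)\otimes t_i^*$ for $y\in Y$ ($\bar y$ the class in $Y/U$), and let $\tilde J$ be the ideal generated by $\tau(J)$ ("generic coordinate change of $J$, restricted to $\Bbbk[Y/U]$"). Its fiber over $0$ is $I$. $H^h_{\Bbbk[X]}$ is the multigraded Hilbert scheme of Haiman–Sturmfels: the $\Bbbk$-scheme representing the functor sending a $\Bbbk$-algebra $R$ to the set of homogeneous ideals $K\subseteq R[X]$ such that $(R[X]/K)_a$ is a locally free $R$-module of rank $h(a)$ for all $a\in A$. *)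

theory Defs
  imports
    Complex_Main
    "HOL-Algebra.Ideal"
    "HOL-Algebra.Module"
    "HOL-Library.Poly_Mapping"
    "HOL-Computational_Algebra.Fraction_Field"
begin

section \<open>Polynomials in finitely many variables over a subring\<close>

type_synonym ('v, 'r) mpoly = "('v \<Rightarrow>\<^sub>0 nat) \<Rightarrow>\<^sub>0 'r"

abbreviation Const :: "'r::zero \<Rightarrow> ('v, 'r) mpoly" where
  "Const c \<equiv> Poly_Mapping.single 0 c"

abbreviation Var :: "'v \<Rightarrow> ('v, 'r::zero_neq_one) mpoly" where
  "Var v \<equiv> Poly_Mapping.single (Poly_Mapping.single v 1) 1"

text \<open>The ring \<open>R[V]\<close>. Coefficient rings and sets of variables are subsets of types, so that
  localizations can be used as coefficient rings and \<open>V\<close> may be empty.\<close>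

definition polys :: "'r::comm_ring_1 set \<Rightarrow> 'v set \<Rightarrow> ('v, 'r) mpoly set" where
  "polys R V = {p. (\<forall>m. Poly_Mapping.lookup p m \<in> R)
                 \<and> (\<forall>m\<in>Poly_Mapping.keys p. Poly_Mapping.keys m \<subseteq> V)}"

definition ring_on :: "'r::comm_ring_1 set \<Rightarrow> 'r ring" where
  "ring_on S = \<lparr>carrier = S, mult = (*), one = 1, zero = 0, add = (+)\<rparr>"

definition module_on :: "('r \<Rightarrow> 'm \<Rightarrow> 'm) \<Rightarrow> 'm::comm_ring_1 set \<Rightarrow> ('r, 'm) module" where
  "module_on sm S =
     \<lparr>carrier = S, mult = (*), one = 1, zero = 0, add = (+), smult = sm\<rparr>"

text \<open>\<open>R[V]\<close> as an \<open>R\<close>-module.\<close>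

definition poly_module :: "'r::comm_ring_1 set \<Rightarrow> 'v set \<Rightarrow> ('r, ('v, 'r) mpoly) module" where
  "poly_module R V = module_on (\<lambda>r p. Const r * p) (polys R V)"

definition subst_poly ::
  "('k::comm_ring_1 \<Rightarrow> 'r::comm_ring_1) \<Rightarrow> ('v \<Rightarrow> ('w, 'r) mpoly) \<Rightarrow> ('v, 'k) mpoly \<Rightarrow> ('w, 'r) mpoly"
where
  "subst_poly c \<theta> p =
     (\<Sum>m\<in>Poly_Mapping.keys p. Const (c (Poly_Mapping.lookup p m)) *
        (\<Prod>v\<in>Poly_Mapping.keys m. \<theta> v ^ Poly_Mapping.lookup m v))"

text \<open>The ideal of \<open>S[V]\<close> generated by the image of \<open>K \<subseteq> R[V]\<close> under a ring map \<open>\<phi>: R \<rightarrow> S\<close>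
  (applied to the coefficients), i.e. the pullback of the family \<open>K\<close> along \<open>Spec S \<rightarrow> Spec R\<close>.\<close>

definition base_change ::
  "'s::comm_ring_1 set \<Rightarrow> 'v set \<Rightarrow> ('r::comm_ring_1 \<Rightarrow> 's) \<Rightarrow> ('v, 'r) mpoly set \<Rightarrow> ('v, 's) mpoly set"
where
  "base_change S V \<phi> K = Idl\<^bsub>ring_on (polys S V)\<^esub> (Poly_Mapping.map \<phi> ` K)"

section \<open>Gradings\<close>

definition graded_space :: "('k::field \<Rightarrow> 'y \<Rightarrow> 'y::ab_group_add) \<Rightarrow> ('a \<Rightarrow> 'y set) \<Rightarrow> bool" where
  "graded_space scale Yg \<longleftrightarrow>
     (\<forall>a. module.subspace scale (Yg a)) \<and>
     (\<forall>y. \<exists>!c. finite {a. c a \<noteq> 0} \<and> (\<forall>a. c a \<in> Yg a) \<and> y = (\<Sum>a | c a \<noteq> 0. c a))"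

definition homogeneous_subspace ::
  "('k::field \<Rightarrow> 'y \<Rightarrow> 'y::ab_group_add) \<Rightarrow> ('a \<Rightarrow> 'y set) \<Rightarrow> 'y set \<Rightarrow> bool"
where
  "homogeneous_subspace scale Yg U \<longleftrightarrow>
     module.subspace scale U \<and> U = module.span scale (\<Union>a. U \<inter> Yg a)"

text \<open>Meant for nonzero homogeneous \<open>y\<close>.\<close>

definition degree_of :: "('a \<Rightarrow> 'y set) \<Rightarrow> 'y \<Rightarrow> 'a" where
  "degree_of Yg y = (THE a. y \<in> Yg a)"

text \<open>The degree of a monomial whose variables \<open>v\<close> have degrees \<open>d v\<close>; the inner sum is the
  multiple \<open>m\<^sub>v \<cdot> d v\<close> in the grading group.\<close>

definition mdeg :: "('v \<Rightarrow> 'a::ab_group_add) \<Rightarrow> ('v \<Rightarrow>\<^sub>0 nat) \<Rightarrow> 'a" where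
  "mdeg d m = (\<Sum>v\<in>Poly_Mapping.keys m. \<Sum>j<Poly_Mapping.lookup m v. d v)"

definition poly_piece ::
  "'r::comm_ring_1 set \<Rightarrow> 'v set \<Rightarrow> ('v \<Rightarrow> 'a::ab_group_add) \<Rightarrow> 'a \<Rightarrow> ('v, 'r) mpoly set"
where
  "poly_piece R V d a = {p \<in> polys R V. \<forall>m\<in>Poly_Mapping.keys p. mdeg d m = a}"

definition component :: "('v \<Rightarrow> 'a::ab_group_add) \<Rightarrow> 'a \<Rightarrow> ('v, 'r::comm_ring_1) mpoly \<Rightarrow> ('v, 'r) mpoly" where
  "component d a p =
     (\<Sum>m\<in>{m\<in>Poly_Mapping.keys p. mdeg d m = a}. Poly_Mapping.single m (Poly_Mapping.lookup p m))"

definition homogeneous_ideal ::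
  "'r::comm_ring_1 set \<Rightarrow> 'v set \<Rightarrow> ('v \<Rightarrow> 'a::ab_group_add) \<Rightarrow> ('v, 'r) mpoly set \<Rightarrow> bool"
where
  "homogeneous_ideal R V d K \<longleftrightarrow>
     ideal K (ring_on (polys R V)) \<and> (\<forall>p\<in>K. \<forall>a. component d a p \<in> K)"

section \<open>Modules\<close>

text \<open>Only the module structure of the following records is meaningful; their multiplicative
  fields are left unspecified.\<close>

definition quot_module :: "('r, 'm) module \<Rightarrow> 'm set \<Rightarrow> ('r, 'm set) module" where
  "quot_module M N =
     \<lparr>carrier = a_rcosets\<^bsub>M\<^esub> N, mult = undefined, one = undefined, zero = N, add = set_add M,
      smult = (\<lambda>r C. \<Union>x\<in>C. N +>\<^bsub>M\<^esub> (r \<odot>\<^bsub>M\<^esub> x))\<rparr>"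

definition module_homs :: "'r ring \<Rightarrow> ('r, 'm) module \<Rightarrow> ('r, 'n) module \<Rightarrow> ('m \<Rightarrow> 'n) set" where
  "module_homs R M N =
     {\<phi> \<in> carrier M \<rightarrow>\<^sub>E carrier N.
        (\<forall>x\<in>carrier M. \<forall>y\<in>carrier M. \<phi> (x \<oplus>\<^bsub>M\<^esub> y) = \<phi> x \<oplus>\<^bsub>N\<^esub> \<phi> y) \<and>
        (\<forall>r\<in>carrier R. \<forall>x\<in>carrier M. \<phi> (r \<odot>\<^bsub>M\<^esub> x) = r \<odot>\<^bsub>N\<^esub> \<phi> x)}"

definition Hom_module :: "'r ring \<Rightarrow> ('r, 'm) module \<Rightarrow> ('r, 'n) module \<Rightarrow> ('r, 'm \<Rightarrow> 'n) module" where
  "Hom_module R M N =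
     \<lparr>carrier = module_homs R M N, mult = undefined, one = undefined,
      zero = (\<lambda>x\<in>carrier M. \<zero>\<^bsub>N\<^esub>),
      add = (\<lambda>\<phi> \<psi>. \<lambda>x\<in>carrier M. \<phi> x \<oplus>\<^bsub>N\<^esub> \<psi> x),
      smult = (\<lambda>r \<phi>. \<lambda>x\<in>carrier M. r \<odot>\<^bsub>N\<^esub> \<phi> x)\<rparr>"

definition generates :: "'r ring \<Rightarrow> ('r, 'm) module \<Rightarrow> 'm set \<Rightarrow> bool" where
  "generates R M S \<longleftrightarrow> S \<subseteq> carrier M \<and> (\<forall>N. submodule N R M \<and> S \<subseteq> N \<longrightarrow> N = carrier M)"

definition free_of_rank :: "'r ring \<Rightarrow> ('r, 'm) module \<Rightarrow> nat \<Rightarrow> bool" where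
  "free_of_rank R M n \<longleftrightarrow>
     (\<exists>b. (\<forall>i<n. b i \<in> carrier M) \<and>
          (\<forall>x\<in>carrier M. \<exists>c\<in>{..<n} \<rightarrow> carrier R. x = (\<Oplus>\<^bsub>M\<^esub>i\<in>{..<n}. c i \<odot>\<^bsub>M\<^esub> b i)) \<and>
          (\<forall>c\<in>{..<n} \<rightarrow> carrier R. (\<Oplus>\<^bsub>M\<^esub>i\<in>{..<n}. c i \<odot>\<^bsub>M\<^esub> b i) = \<zero>\<^bsub>M\<^esub> \<longrightarrow>
             (\<forall>i<n. c i = \<zero>\<^bsub>R\<^esub>)))"

text \<open>\<open>M\<^sub>g\<close> is a free \<open>R\<^sub>g\<close>-module of rank \<open>n\<close>. As \<open>g\<close> is a unit in \<open>R\<^sub>g\<close>, a basis can be chosen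
  in the image of \<open>M\<close>; that the images of \<open>b\<^sub>i \<in> M\<close> span \<open>M\<^sub>g\<close> and are independent over \<open>R\<^sub>g\<close> is
  spelled out without fractions.\<close>

definition free_on_basic_open :: "'r ring \<Rightarrow> ('r, 'm) module \<Rightarrow> 'r \<Rightarrow> nat \<Rightarrow> bool" where
  "free_on_basic_open R M g n \<longleftrightarrow>
     (\<exists>b. (\<forall>i<n. b i \<in> carrier M) \<and>
          (\<forall>x\<in>carrier M. \<exists>N::nat. \<exists>c\<in>{..<n} \<rightarrow> carrier R.
             (g [^]\<^bsub>R\<^esub> N) \<odot>\<^bsub>M\<^esub> x = (\<Oplus>\<^bsub>M\<^esub>i\<in>{..<n}. c i \<odot>\<^bsub>M\<^esub> b i)) \<and>
          (\<forall>c\<in>{..<n} \<rightarrow> carrier R. (\<Oplus>\<^bsub>M\<^esub>i\<in>{..<n}. c i \<odot>\<^bsub>M\<^esub> b i) = \<zero>\<^bsub>M\<^esub> \<longrightarrow>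
             (\<exists>N::nat. \<forall>i<n. (g [^]\<^bsub>R\<^esub> N) \<otimes>\<^bsub>R\<^esub> c i = \<zero>\<^bsub>R\<^esub>)))"

definition locally_free_of_rank :: "'r ring \<Rightarrow> ('r, 'm) module \<Rightarrow> nat \<Rightarrow> bool" where
  "locally_free_of_rank R M n \<longleftrightarrow>
     (\<exists>G. finite G \<and> G \<subseteq> carrier R \<and> Idl\<^bsub>R\<^esub> G = carrier R \<and> (\<forall>g\<in>G. free_on_basic_open R M g n))"

text \<open>\<open>N \<otimes>\<^sub>R M\<close> is the free abelian group on \<open>N \<times> M\<close> modulo the subgroup generated by the
  bilinearity relations.\<close>

inductive_set tensor_relations ::
  "'r ring \<Rightarrow> ('r, 'n) module \<Rightarrow> ('r, 'm) module \<Rightarrow> (('n \<times> 'm) \<Rightarrow>\<^sub>0 int) set"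
  for R N M where
  zero: "0 \<in> tensor_relations R N M"
| diff: "z \<in> tensor_relations R N M \<Longrightarrow> w \<in> tensor_relations R N M \<Longrightarrow>
         z - w \<in> tensor_relations R N M"
| add_left: "x \<in> carrier N \<Longrightarrow> x' \<in> carrier N \<Longrightarrow> y \<in> carrier M \<Longrightarrow>
         frag_of (x \<oplus>\<^bsub>N\<^esub> x', y) - frag_of (x, y) - frag_of (x', y) \<in> tensor_relations R N M"
| add_right: "x \<in> carrier N \<Longrightarrow> y \<in> carrier M \<Longrightarrow> y' \<in> carrier M \<Longrightarrow>
         frag_of (x, y \<oplus>\<^bsub>M\<^esub> y') - frag_of (x, y) - frag_of (x, y') \<in> tensor_relations R N M"
| smult: "r \<in> carrier R \<Longrightarrow> x \<in> carrier N \<Longrightarrow> y \<in> carrier M \<Longrightarrow>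
         frag_of (r \<odot>\<^bsub>N\<^esub> x, y) - frag_of (x, r \<odot>\<^bsub>M\<^esub> y) \<in> tensor_relations R N M"

text \<open>\<open>_ \<otimes>\<^sub>R M\<close> preserves injectivity of maps \<open>i: N' \<rightarrow> N\<close>. A definition cannot quantify over all
  types, so \<open>N\<close> and \<open>N'\<close> are carried by the type of \<open>R\<close>; this loses nothing, because inclusions
  of ideals into \<open>R\<close> already suffice to detect flatness.\<close>

definition flat :: "'r ring \<Rightarrow> ('r, 'm) module \<Rightarrow> bool" where
  "flat R M \<longleftrightarrow>
     (\<forall>(N::('r, 'r) module) (N'::('r, 'r) module) i.
        Module.module R N \<and> Module.module R N' \<and> i \<in> module_homs R N' N \<and> inj_on i (carrier N') \<longrightarrow>
        (\<forall>z. Poly_Mapping.keys z \<subseteq> carrier N' \<times> carrier M \<and>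
             frag_extend (\<lambda>(x, y). frag_of (i x, y)) z \<in> tensor_relations R N M \<longrightarrow>
             z \<in> tensor_relations R N' M))"

section \<open>Restriction to \<open>\<k>[Y/U]\<close>\<close>

text \<open>\<open>BX \<union> BU\<close> is a homogeneous basis of \<open>Y\<close> with \<open>BU\<close> a basis of \<open>U\<close>. Its elements serve as the
  variables: \<open>\<k>[Y] = polys UNIV (BX \<union> BU)\<close>, \<open>\<k>[U] = polys UNIV BU\<close> and
  \<open>\<k>[Y/U] = \<k>[X] = polys UNIV BX\<close>, where \<open>X\<close> is the span of \<open>BX\<close>.\<close>

definition bar :: "'y set \<Rightarrow> 'y \<Rightarrow> ('y, 'r::comm_ring_1) mpoly" where
  "bar BX v = (if v \<in> BX then Var v else 0)"

definition restrict_poly :: "'y set \<Rightarrow> ('y, 'k::comm_ring_1) mpoly \<Rightarrow> ('y, 'k) mpoly" where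
  "restrict_poly BX = subst_poly (\<lambda>c. c) (bar BX)"

definition coset :: "'r::comm_ring_1 set \<Rightarrow> 'r set \<Rightarrow> 'r \<Rightarrow> 'r set" where
  "coset P K p = K +>\<^bsub>ring_on P\<^esub> p"

text \<open>The degree \<open>a\<close> part \<open>(R[V]/K)\<^sub>a\<close> as an \<open>R\<close>-module.\<close>

definition graded_quot ::
  "'r::comm_ring_1 set \<Rightarrow> 'v set \<Rightarrow> ('v \<Rightarrow> 'a::ab_group_add) \<Rightarrow> ('v, 'r) mpoly set \<Rightarrow> 'a \<Rightarrow>
   ('r, ('v, 'r) mpoly set) module"
where
  "graded_quot R V d K a =
     (quot_module (poly_module R V) K)\<lparr>carrier := coset (polys R V) K ` poly_piece R V d a\<rparr>"

text \<open>Degree-preserving \<open>\<k>\<close>-linear maps from \<open>Y\<close> to a \<open>\<k>\<close>-module \<open>M\<close> with graded pieces \<open>Mg\<close>.\<close>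

definition graded_homs ::
  "('k \<Rightarrow> 'y \<Rightarrow> 'y::ab_group_add) \<Rightarrow> ('a \<Rightarrow> 'y set) \<Rightarrow> ('k, 'm) module \<Rightarrow> ('a \<Rightarrow> 'm set) \<Rightarrow> ('y \<Rightarrow> 'm) set"
where
  "graded_homs scale Yg M Mg =
     {\<phi>. (\<forall>y. \<phi> y \<in> carrier M) \<and> (\<forall>y z. \<phi> (y + z) = \<phi> y \<oplus>\<^bsub>M\<^esub> \<phi> z) \<and>
         (\<forall>c y. \<phi> (scale c y) = c \<odot>\<^bsub>M\<^esub> \<phi> y) \<and> (\<forall>a. \<phi> ` Yg a \<subseteq> Mg a)}"

section \<open>\<open>T\<^sup>1\<close> and the map \<open>\<alpha>\<close>\<close>

definition derivations :: "'v set \<Rightarrow> (('v, 'k::field) mpoly \<Rightarrow> ('v, 'k) mpoly) set" where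
  "derivations V =
     {D. (\<forall>p\<in>polys UNIV V. D p \<in> polys UNIV V) \<and>
         (\<forall>p\<in>polys UNIV V. \<forall>q\<in>polys UNIV V. D (p + q) = D p + D q \<and> D (p * q) = p * D q + q * D p) \<and>
         (\<forall>c. D (Const c) = 0)}"

text \<open>\<open>Hom(I, \<k>[X]/I)\<close> as a \<open>\<k>[X]\<close>-module.\<close>

definition normal_module ::
  "'v set \<Rightarrow> ('v, 'k::field) mpoly set \<Rightarrow>
   (('v, 'k) mpoly, ('v, 'k) mpoly \<Rightarrow> ('v, 'k) mpoly set) module"
where
  "normal_module V I =
     Hom_module (ring_on (polys UNIV V)) (module_on (*) I)
       (quot_module (module_on (*) (polys UNIV V)) I)"

definition trivial_deformations ::
  "'v set \<Rightarrow> ('v, 'k::field) mpoly set \<Rightarrow> (('v, 'k) mpoly \<Rightarrow> ('v, 'k) mpoly set) set"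
where
  "trivial_deformations V I = (\<lambda>D. \<lambda>p\<in>I. coset (polys UNIV V) I (D p)) ` derivations V"

definition T1 ::
  "'v set \<Rightarrow> ('v, 'k::field) mpoly set \<Rightarrow>
   (('v, 'k) mpoly, (('v, 'k) mpoly \<Rightarrow> ('v, 'k) mpoly set) set) module"
where
  "T1 V I = quot_module (normal_module V I) (trivial_deformations V I)"

definition T1_class ::
  "'v set \<Rightarrow> ('v, 'k::field) mpoly set \<Rightarrow> (('v, 'k) mpoly \<Rightarrow> ('v, 'k) mpoly set) \<Rightarrow>
   (('v, 'k) mpoly \<Rightarrow> ('v, 'k) mpoly set) set"
where
  "T1_class V I \<phi> = trivial_deformations V I +>\<^bsub>normal_module V I\<^esub> \<phi>"

text \<open>For \<open>g = g\<^sub>0 + \<Sum> u\<^sub>i g\<^sub>i + \<dots>\<close> with \<open>g\<^sub>0, g\<^sub>i \<in> \<k>[X]\<close> and the dots of degree at least two in the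
  variables \<open>u\<^sub>i \<in> BU\<close>, this is the coefficient \<open>g\<^sub>i\<close> of the variable \<open>u = u\<^sub>i\<close>.\<close>

definition u_coeff :: "'y set \<Rightarrow> 'y \<Rightarrow> ('y, 'k::field) mpoly \<Rightarrow> ('y, 'k) mpoly" where
  "u_coeff BU u g =
     (\<Sum>m\<in>{m\<in>Poly_Mapping.keys g. Poly_Mapping.keys m \<inter> BU = {u} \<and> Poly_Mapping.lookup m u = 1}.
        Poly_Mapping.single (m - Poly_Mapping.single u 1) (Poly_Mapping.lookup g m))"

definition dual_space :: "('k::field \<Rightarrow> 'y \<Rightarrow> 'y::ab_group_add) \<Rightarrow> 'y set \<Rightarrow> ('y \<Rightarrow> 'k) set" where
  "dual_space scale U =
     {\<xi>. (\<forall>x\<in>U. \<forall>y\<in>U. \<xi> (x + y) = \<xi> x + \<xi> y) \<and> (\<forall>c. \<forall>x\<in>U. \<xi> (scale c x) = c * \<xi> x)}"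

text \<open>\<open>\<alpha>(\<xi>)\<close> for \<open>\<xi> = \<Sum> \<xi>(u\<^sub>i) u\<^sub>i\<^sup>* \<in> U\<^sup>*\<close>, with \<open>\<alpha>(u\<^sub>i\<^sup>*)\<close> sending \<open>g\<^sub>0\<close> to \<open>g\<^sub>i + I\<close>. The value does not
  depend on the lift \<open>g \<in> J\<close> of \<open>g\<^sub>0 = p\<close> when \<open>\<k>[Y]/J\<close> is flat over \<open>\<k>[U]\<close>.\<close>

definition alpha ::
  "'y set \<Rightarrow> 'y set \<Rightarrow> ('y, 'k::field) mpoly set \<Rightarrow> ('y \<Rightarrow> 'k) \<Rightarrow> ('y, 'k) mpoly \<Rightarrow> ('y, 'k) mpoly set"
where
  "alpha BX BU J \<xi> =
     (\<lambda>p\<in>restrict_poly BX ` J.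
        (THE C. \<exists>g\<in>J. restrict_poly BX g = p \<and>
           C = coset (polys UNIV BX) (restrict_poly BX ` J)
                 (\<Sum>u\<in>BU. Const (\<xi> u) * u_coeff BU u g)))"

section \<open>The family over \<open>\<k>[T\<^sup>*]\<close>\<close>

text \<open>\<open>t 0, \<dots>, t (n - 1)\<close> is a basis of the space \<open>T\<close> of maps \<open>Y \<rightarrow> \<k>[X]\<close>.\<close>

definition basis_of_maps :: "('y \<Rightarrow> ('v, 'k::field) mpoly) set \<Rightarrow> nat \<Rightarrow> (nat \<Rightarrow> 'y \<Rightarrow> ('v, 'k) mpoly) \<Rightarrow> bool" where
  "basis_of_maps T n t \<longleftrightarrow>
     T = range (\<lambda>c y. \<Sum>i<n. Const (c i) * t i y) \<and>
     (\<forall>c. (\<forall>y. (\<Sum>i<n. Const (c i) * t i y) = 0) \<longrightarrow> (\<forall>i<n. c i = 0))"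

text \<open>\<open>\<k>[T\<^sup>*] = polys UNIV {..<n}\<close>, the \<open>i\<close>-th variable being \<open>t\<^sub>i\<^sup>*\<close>, and \<open>\<k>[X] \<otimes> \<k>[T\<^sup>*]\<close> is viewed as
  the polynomial ring over \<open>\<k>[T\<^sup>*]\<close> in the variables \<open>BX\<close>. An algebra map on \<open>\<k>[Y]\<close> is determined
  by its values on the variables; on them \<open>tau\<close> takes the values \<open>y \<mapsto> bar y + \<Sum> t\<^sub>i(y) t\<^sub>i\<^sup>*\<close>, which
  then hold for all linear forms \<open>y\<close>.\<close>

definition tau ::
  "'y set \<Rightarrow> nat \<Rightarrow> (nat \<Rightarrow> 'y \<Rightarrow> ('y, 'k::field) mpoly) \<Rightarrow> ('y, 'k) mpoly \<Rightarrow> ('y, (nat, 'k) mpoly) mpoly"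
where
  "tau BX n t =
     subst_poly Const (\<lambda>v. bar BX v + (\<Sum>i<n. Poly_Mapping.map Const (t i v) * Const (Var i)))"

definition J_tilde ::
  "'y set \<Rightarrow> nat \<Rightarrow> (nat \<Rightarrow> 'y \<Rightarrow> ('y, 'k::field) mpoly) \<Rightarrow> ('y, 'k) mpoly set \<Rightarrow>
   ('y, (nat, 'k) mpoly) mpoly set"
where
  "J_tilde BX n t J = Idl\<^bsub>ring_on (polys (polys UNIV {..<n}) BX)\<^esub> (tau BX n t ` J)"

text \<open>\<open>\<k>[T\<^sup>*]\<^sub>f\<close> for \<open>f \<noteq> 0\<close>, inside the field of fractions.\<close>

definition localized :: "nat \<Rightarrow> (nat, 'k::field) mpoly \<Rightarrow> (nat, 'k) mpoly fract set" where
  "localized n f = {Fract p (f ^ m) | p m. p \<in> polys UNIV {..<n}}"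

definition J_tilde_loc ::
  "'y set \<Rightarrow> nat \<Rightarrow> (nat \<Rightarrow> 'y \<Rightarrow> ('y, 'k::field) mpoly) \<Rightarrow> (nat, 'k) mpoly \<Rightarrow> ('y, 'k) mpoly set \<Rightarrow>
   ('y, (nat, 'k) mpoly fract) mpoly set"
where
  "J_tilde_loc BX n t f J = base_change (localized n f) BX (\<lambda>p. Fract p 1) (J_tilde BX n t J)"

text \<open>The origin of \<open>Spec \<k>[T\<^sup>*]\<^sub>f\<close> as the \<open>\<k>\<close>-point \<open>p/f\<^sup>m \<mapsto> p(0)/f(0)\<^sup>m\<close>.\<close>

definition origin :: "nat \<Rightarrow> (nat, 'k::field) mpoly \<Rightarrow> (nat, 'k) mpoly fract \<Rightarrow> 'k" where
  "origin n f q =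
     (THE c. \<exists>p m. p \<in> polys UNIV {..<n} \<and> q = Fract p (f ^ m) \<and>
        c = Poly_Mapping.lookup p 0 / Poly_Mapping.lookup f 0 ^ m)"

section \<open>Dual numbers and tangent spaces\<close>

text \<open>\<open>\<k>[\<epsilon>]/(\<epsilon>\<^sup>2)\<close>; \<open>Dual a b\<close> is \<open>a + b\<epsilon>\<close>.\<close>

datatype 'k dual_number = Dual (std: 'k) (eps: 'k)

instantiation dual_number :: (comm_ring_1) comm_ring_1
begin

definition "0 = Dual 0 0"
definition "1 = Dual 1 0"
definition "x + y = Dual (std x + std y) (eps x + eps y)"
definition "x - y = Dual (std x - std y) (eps x - eps y)"
definition "- x = Dual (- std x) (- eps x)"
definition "x * y = Dual (std x * std y) (std x * eps y + eps x * std y)"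

instance
  by standard
    (auto simp: zero_dual_number_def one_dual_number_def plus_dual_number_def minus_dual_number_def
      uminus_dual_number_def times_dual_number_def algebra_simps)

end

text \<open>The value at a \<open>\<k>\<close>-algebra \<open>R\<close> of the functor represented by the multigraded Hilbert scheme
  \<open>H\<^sup>h\<close>. A morphism \<open>Spec R \<rightarrow> H\<^sup>h\<close> is an element of \<open>hilb R V d h\<close>, and composition with
  \<open>Spec S \<rightarrow> Spec R\<close> is \<^const>\<open>base_change\<close>.\<close>

definition hilb ::
  "'r::comm_ring_1 set \<Rightarrow> 'v set \<Rightarrow> ('v \<Rightarrow> 'a::ab_group_add) \<Rightarrow> ('a \<Rightarrow> nat) \<Rightarrow> ('v, 'r) mpoly set set"
where
  "hilb R V d h =
     {K. homogeneous_ideal R V d K \<and>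
         (\<forall>a. locally_free_of_rank (ring_on R) (graded_quot R V d K a) (h a))}"

text \<open>The tangent space at a \<open>\<k>\<close>-point consists of the \<open>\<k>[\<epsilon>]\<close>-points that restrict to it along
  \<open>\<epsilon> \<mapsto> 0\<close>.\<close>

definition tangent_space_hilb ::
  "'v set \<Rightarrow> ('v \<Rightarrow> 'a::ab_group_add) \<Rightarrow> ('a \<Rightarrow> nat) \<Rightarrow> ('v, 'k::field) mpoly set \<Rightarrow>
   ('v, 'k dual_number) mpoly set set"
where
  "tangent_space_hilb V d h I = {K \<in> hilb UNIV V d h. base_change UNIV V std K = I}"

definition tangent_space_origin ::
  "nat \<Rightarrow> (nat, 'k::field) mpoly \<Rightarrow> ((nat, 'k) mpoly fract \<Rightarrow> 'k dual_number) set"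
where
  "tangent_space_origin n f =
     {\<phi> \<in> ring_hom (ring_on (localized n f)) (ring_on UNIV).
        (\<forall>c. \<phi> (Fract (Const c) 1) = Dual c 0) \<and> (\<forall>q\<in>localized n f. std (\<phi> q) = origin n f q)}"

text \<open>The map on tangent spaces induced by a morphism \<open>Spec \<k>[T\<^sup>*]\<^sub>f \<rightarrow> H\<^sup>h\<close> given by the family \<open>K\<close>.\<close>

definition tangent_map ::
  "'v set \<Rightarrow> ('v, (nat, 'k::field) mpoly fract) mpoly set \<Rightarrow> ((nat, 'k) mpoly fract \<Rightarrow> 'k dual_number) \<Rightarrow>
   ('v, 'k dual_number) mpoly set"
where
  "tangent_map V K \<phi> = base_change UNIV V \<phi> K"

end

theory Submission
  imports Defs
begin

text \<open>
  A tangent vector of the Hilbert scheme at \<open>I\<close> is a homogeneous ideal \<open>K\<close> of \<open>\<k>[\<epsilon>][X]\<close> whose graded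
  quotients are free over \<open>\<k>[\<epsilon>]\<close> and which reduces to \<open>I\<close>. Freeness forces \<open>K \<inter> \<epsilon>\<k>[X] = \<epsilon>I\<close>
  (\<open>hilb_dual_eps\<close>), so \<open>K\<close> is the graph of a homomorphism \<open>\<psi>: I \<rightarrow> \<k>[X]/I\<close>: a polynomial
  \<open>x + \<epsilon>q\<close> lies in \<open>K\<close> exactly if \<open>q\<close> represents \<open>\<psi>(x)\<close> (\<open>tangent_vector_normal\<close>).
  As the classes of the \<open>\<alpha>(\<xi>)\<close> generate \<open>T\<^sup>1\<close>, there are a derivation \<open>\<partial>\<close> of \<open>\<k>[X]\<close> and
  polynomials \<open>p\<^sub>u\<close> with \<open>\<psi> = \<partial> + \<Sum> p\<^sub>u \<alpha>(u\<^sup>*)\<close> (\<open>T1_generated_decomposition\<close>).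

  On the other hand, consider the substitution \<open>v \<mapsto> bar v + \<epsilon> w(v)\<close> for a choice of \<open>w(v) \<in> \<k>[X]\<close>
  for all variables \<open>v\<close> of \<open>\<k>[Y]\<close>. By Taylor expansion it takes
  \<open>g = g\<^sub>0 + \<Sum> u g\<^sub>u + \<dots>\<close> to \<open>g\<^sub>0 + \<epsilon>(\<Sum>\<^sub>x w(x) \<partial>g\<^sub>0/\<partial>x + \<Sum>\<^sub>u w(u) g\<^sub>u)\<close>.
  For \<open>w(x) = \<partial>x\<close> and \<open>w(u) = p\<^sub>u\<close> the coefficient of \<open>\<epsilon>\<close> represents \<open>\<psi>(g\<^sub>0)\<close>
  (\<open>shift_der_decomposition\<close>), so the substitution maps \<open>J\<close> into \<open>K\<close>, and its image generates \<open>K\<close>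
  (\<open>Idl_shift_hom_eq\<close>): the coordinate change turns \<open>J\<close> into the given deformation. Since \<open>J\<close> and \<open>K\<close>
  are homogeneous, only the degree-preserving part of \<open>w\<close> matters (\<open>component_shift_der\<close>), and since
  \<open>\<epsilon>I \<subseteq> K\<close>, only its values modulo \<open>I\<close> do (\<open>shift_hom_congruent\<close>). Hence \<open>w\<close> can be
  taken from \<open>T\<close>, say \<open>w = \<Sum> c\<^sub>i t\<^sub>i\<close>, and the generic coordinate change specializes to this
  substitution under \<open>t\<^sub>i\<^sup>* \<mapsto> c\<^sub>i \<epsilon>\<close>, which is a tangent vector at the origin.

  Two points need separate arguments. That \<open>\<alpha>\<close> is well defined is where flatness of \<open>\<k>[Y]/J\<close> over
  \<open>\<k>[U]\<close> enters (\<open>flat_u_coeff\<close>). That the family really induces a map into the tangent space needs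
  local freeness to be preserved under base change to \<open>\<k>[\<epsilon>]\<close> (\<open>base_change_free\<close>). Ideals are pulled back
  along compositions of ring homomorphisms by \<open>base_change_Idl\<close>: the pullback of a generated ideal is
  generated by the images of the generators.

  Derivatives enter only as the \<open>\<epsilon>\<close>-coefficients of ring homomorphisms, which are determined by their
  values on constants and variables; this replaces all computations with partial derivatives.
\<close>

section \<open>Subrings, homomorphisms and ideals\<close>

text \<open>Otherwise the simplifier rewrites the exponent of a variable to \<open>Suc 0\<close>, and facts about
  \<^const>\<open>Poly_Mapping.single\<close> with exponent 1 no longer match.\<close>

declare One_nat_def [simp del]

abbreviation (input) "lk \<equiv> Poly_Mapping.lookup"
abbreviation (input) "ks \<equiv> Poly_Mapping.keys"
abbreviation (input) "mterm \<equiv> Poly_Mapping.single"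
abbreviation (input) "cmap \<equiv> Poly_Mapping.map"

definition subring_on :: "'r::comm_ring_1 set \<Rightarrow> bool" where
  "subring_on R \<longleftrightarrow> 0 \<in> R \<and> 1 \<in> R \<and> (\<forall>x\<in>R. - x \<in> R) \<and> (\<forall>x\<in>R. \<forall>y\<in>R. x + y \<in> R \<and> x * y \<in> R)"

text \<open>The condition at 0 makes coefficientwise application of \<open>\<phi>\<close> commute with taking coefficients, as
  \<^const>\<open>Poly_Mapping.map\<close> always keeps zero coefficients.\<close>

definition hom_on :: "'r::comm_ring_1 set \<Rightarrow> ('r \<Rightarrow> 's::comm_ring_1) \<Rightarrow> bool" where
  "hom_on R \<phi> \<longleftrightarrow> \<phi> 0 = 0 \<and> \<phi> 1 = 1 \<and>
     (\<forall>x\<in>R. \<forall>y\<in>R. \<phi> (x + y) = \<phi> x + \<phi> y \<and> \<phi> (x * y) = \<phi> x * \<phi> y)"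

definition ideal_on :: "'r::comm_ring_1 set \<Rightarrow> 'r set \<Rightarrow> bool" where
  "ideal_on R K \<longleftrightarrow> K \<subseteq> R \<and> 0 \<in> K \<and> (\<forall>x\<in>K. \<forall>y\<in>K. x + y \<in> K) \<and> (\<forall>r\<in>R. \<forall>x\<in>K. r * x \<in> K)"

lemma subring_on_UNIV [simp]: "subring_on UNIV"
  by (simp add: subring_on_def)

lemma subring_onD:
  assumes "subring_on R"
  shows "0 \<in> R" "1 \<in> R" "x \<in> R \<Longrightarrow> - x \<in> R" "x \<in> R \<Longrightarrow> y \<in> R \<Longrightarrow> x + y \<in> R"
    "x \<in> R \<Longrightarrow> y \<in> R \<Longrightarrow> x * y \<in> R" "x \<in> R \<Longrightarrow> y \<in> R \<Longrightarrow> x - y \<in> R" "x \<in> R \<Longrightarrow> x ^ n \<in> R"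
proof -
  show d: "x \<in> R \<Longrightarrow> y \<in> R \<Longrightarrow> x - y \<in> R"
    using assms unfolding subring_on_def by (metis diff_conv_add_uminus)
  show "x \<in> R \<Longrightarrow> x ^ n \<in> R"
    using assms unfolding subring_on_def by (induction n) auto
qed (use assms in \<open>auto simp: subring_on_def\<close>)

lemma subring_on_sum: "subring_on R \<Longrightarrow> (\<And>i. i \<in> A \<Longrightarrow> f i \<in> R) \<Longrightarrow> sum f A \<in> R"
  by (induction A rule: infinite_finite_induct) (auto simp: subring_onD)

lemma hom_onD:
  assumes "hom_on R \<phi>"
  shows "\<phi> 0 = 0" "\<phi> 1 = 1" "x \<in> R \<Longrightarrow> y \<in> R \<Longrightarrow> \<phi> (x + y) = \<phi> x + \<phi> y"
    "x \<in> R \<Longrightarrow> y \<in> R \<Longrightarrow> \<phi> (x * y) = \<phi> x * \<phi> y"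
  using assms by (auto simp: hom_on_def)

lemma hom_on_minus:
  assumes "hom_on R \<phi>" "subring_on R" "x \<in> R"
  shows "\<phi> (- x) = - \<phi> x"
proof -
  have "\<phi> (- x) + \<phi> x = 0"
    using hom_onD(3)[OF assms(1), of "- x" x] assms by (simp add: subring_onD hom_onD(1))
  then show ?thesis by (simp add: eq_neg_iff_add_eq_0)
qed

lemma hom_on_diff:
  assumes "hom_on R \<phi>" "subring_on R" "x \<in> R" "y \<in> R"
  shows "\<phi> (x - y) = \<phi> x - \<phi> y"
  using hom_onD(3)[OF assms(1), of x "- y"] hom_on_minus[OF assms(1,2,4)] assms
  by (simp add: subring_onD)

lemma hom_on_sum:
  assumes "hom_on R \<phi>" "subring_on R" "\<And>i. i \<in> A \<Longrightarrow> f i \<in> R"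
  shows "\<phi> (sum f A) = (\<Sum>i\<in>A. \<phi> (f i))"
  using assms(3)
  by (induction A rule: infinite_finite_induct)
    (auto simp: hom_onD[OF assms(1)] subring_on_sum[OF assms(2)])

lemma hom_on_power:
  assumes "hom_on R \<phi>" "subring_on R" "x \<in> R"
  shows "\<phi> (x ^ n) = \<phi> x ^ n"
  by (induction n) (auto simp: hom_onD[OF assms(1)] subring_onD[OF assms(2)] assms(3))

lemma hom_on_comp:
  "hom_on R \<phi> \<Longrightarrow> hom_on S \<psi> \<Longrightarrow> \<phi> ` R \<subseteq> S \<Longrightarrow> hom_on R (\<lambda>x. \<psi> (\<phi> x))"
  unfolding hom_on_def by (simp add: image_subset_iff)

lemma hom_on_subset: "hom_on R \<phi> \<Longrightarrow> S \<subseteq> R \<Longrightarrow> hom_on S \<phi>"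
  unfolding hom_on_def by blast

lemma ideal_onD:
  assumes "ideal_on R K"
  shows "x \<in> K \<Longrightarrow> x \<in> R" "0 \<in> K" "x \<in> K \<Longrightarrow> y \<in> K \<Longrightarrow> x + y \<in> K" "r \<in> R \<Longrightarrow> x \<in> K \<Longrightarrow> r * x \<in> K"
  using assms by (auto simp: ideal_on_def)

lemma ideal_on_minus:
  assumes "ideal_on R K" "subring_on R" "x \<in> K"
  shows "- x \<in> K"
  using ideal_onD(4)[OF assms(1), of "- 1" x] assms by (simp add: subring_onD)

lemma ideal_on_diff:
  assumes "ideal_on R K" "subring_on R" "x \<in> K" "y \<in> K"
  shows "x - y \<in> K"
  using ideal_onD(3)[OF assms(1), of x "- y"] ideal_on_minus[OF assms(1,2,4)] assms by simp

lemma ideal_on_sum: "ideal_on R K \<Longrightarrow> (\<And>i. i \<in> A \<Longrightarrow> f i \<in> K) \<Longrightarrow> sum f A \<in> K"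
  by (induction A rule: infinite_finite_induct) (auto simp: ideal_onD)

lemma ideal_on_UNIV: "subring_on R \<Longrightarrow> ideal_on R R"
  by (auto simp: ideal_on_def subring_onD)

lemma hom_on_vimage_ideal:
  assumes "hom_on R \<phi>" "subring_on R" "ideal_on S L" "\<phi> ` R \<subseteq> S"
  shows "ideal_on R {x \<in> R. \<phi> x \<in> L}"
  using assms by (auto simp: ideal_on_def subring_on_def hom_on_def)

lemma ring_on_simps [simp]:
  "carrier (ring_on S) = S" "mult (ring_on S) = (*)" "one (ring_on S) = 1"
  "zero (ring_on S) = 0" "add (ring_on S) = (+)"
  by (simp_all add: ring_on_def)

lemma cring_ring_on: "subring_on R \<Longrightarrow> cring (ring_on R)"
proof (rule cringI)
  assume R: "subring_on R"
  show "abelian_group (ring_on R)"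
    by (rule abelian_groupI)
      (use subring_onD[OF R] in \<open>auto simp: algebra_simps intro: bexI[of _ "- x" for x]\<close>)
  show "Group.comm_monoid (ring_on R)"
    by (rule comm_monoidI) (use subring_onD[OF R] in \<open>auto simp: algebra_simps\<close>)
qed (simp add: distrib_right)

lemma pow_ring_on [simp]: "x [^]\<^bsub>ring_on R\<^esub> (n::nat) = x ^ n"
  by (induction n) (simp_all add: nat_pow_def mult.commute)

lemma abelian_subgroup_intro:
  fixes G (structure)
  assumes G: "abelian_group G" and "H \<subseteq> carrier G" "\<zero> \<in> H"
    and "\<And>x y. x \<in> H \<Longrightarrow> y \<in> H \<Longrightarrow> x \<oplus> y \<in> H" "\<And>x. x \<in> H \<Longrightarrow> \<exists>y\<in>H. y \<oplus> x = \<zero>"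
  shows "abelian_subgroup H G"
proof (rule abelian_subgroupI3[OF additive_subgroup.intro G], rule subgroup.intro)
  fix x assume "x \<in> H"
  then obtain y where "y \<in> H" "y \<oplus> x = \<zero>" using assms(5) by blast
  then have "\<ominus> x = y" using abelian_group.minus_equality[OF G \<open>y \<oplus> x = \<zero>\<close>] \<open>x \<in> H\<close> assms(2) by blast
  then show "inv\<^bsub>add_monoid G\<^esub> x \<in> H" using \<open>y \<in> H\<close> by (simp add: a_inv_def)
qed (use assms in auto)

lemma ideal_iff_ideal_on:
  assumes R: "subring_on R"
  shows "ideal K (ring_on R) \<longleftrightarrow> ideal_on R K"
proof
  assume "ideal K (ring_on R)"
  then interpret ideal K "ring_on R" .
  show "ideal_on R K"
    using a_subset additive_subgroup.a_closed[OF is_additive_subgroup] I_l_closed additive_subgroup.zero_closed[OF is_additive_subgroup]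
    by (auto simp: ideal_on_def)
next
  assume K: "ideal_on R K"
  interpret cring "ring_on R" by (rule cring_ring_on[OF R])
  have "abelian_subgroup K (ring_on R)"
  proof (rule abelian_subgroup_intro)
    fix x assume "x \<in> K"
    then show "\<exists>y\<in>K. y \<oplus>\<^bsub>ring_on R\<^esub> x = \<zero>\<^bsub>ring_on R\<^esub>"
      using ideal_on_minus[OF K R] by (intro bexI[of _ "- x"]) auto
  qed (use K abelian_group_axioms in \<open>auto simp: ideal_on_def\<close>)
  then interpret abelian_subgroup K "ring_on R" .
  show "ideal K (ring_on R)"
  proof (rule idealI[OF ring_axioms a_subgroup])
    fix a x assume "a \<in> K" "x \<in> carrier (ring_on R)"
    then have "x * a \<in> K" using ideal_onD(4)[OF K] by simp
    then show "x \<otimes>\<^bsub>ring_on R\<^esub> a \<in> K" "a \<otimes>\<^bsub>ring_on R\<^esub> x \<in> K" by (simp_all add: mult.commute)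
  qed
qed

lemma Idl_facts:
  assumes "subring_on R" "S \<subseteq> R"
  shows "ideal_on R (Idl\<^bsub>ring_on R\<^esub> S)" "S \<subseteq> Idl\<^bsub>ring_on R\<^esub> S"
    "ideal_on R K \<Longrightarrow> S \<subseteq> K \<Longrightarrow> Idl\<^bsub>ring_on R\<^esub> S \<subseteq> K"
proof -
  interpret cring "ring_on R" by (rule cring_ring_on[OF assms(1)])
  show "ideal_on R (Idl\<^bsub>ring_on R\<^esub> S)"
    using genideal_ideal[of S] assms by (simp add: ideal_iff_ideal_on)
  show "S \<subseteq> Idl\<^bsub>ring_on R\<^esub> S" using genideal_self[of S] assms by simp
  show "ideal_on R K \<Longrightarrow> S \<subseteq> K \<Longrightarrow> Idl\<^bsub>ring_on R\<^esub> S \<subseteq> K"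
    using genideal_minimal[of K S] assms by (simp add: ideal_iff_ideal_on)
qed

section \<open>Polynomials\<close>

lemma keys_add_nat: "ks (m + m') = ks m \<union> ks (m' :: 'v \<Rightarrow>\<^sub>0 nat)"
  by (auto simp: in_keys_iff lookup_add)

lemma polys_iff: "p \<in> polys R V \<longleftrightarrow> (\<forall>m. lk p m \<in> R) \<and> (\<forall>m\<in>ks p. ks m \<subseteq> V)"
  by (simp add: polys_def)

lemma Const_mult: "Const (a * b) = Const a * (Const b :: ('v, 'r::comm_ring_1) mpoly)"
  by (simp add: mult_single)

lemma polys_sum_single: "p = (\<Sum>m\<in>ks p. mterm m (lk p m))"
  by (rule poly_mapping_eqI) (auto simp: lookup_sum lookup_single when_def in_keys_iff)

lemma single_in_polys: "subring_on R \<Longrightarrow> c \<in> R \<Longrightarrow> ks m \<subseteq> V \<Longrightarrow> mterm m c \<in> polys R V"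
  by (auto simp: polys_iff lookup_single when_def subring_onD)

lemma polys_add: "subring_on R \<Longrightarrow> p \<in> polys R V \<Longrightarrow> q \<in> polys R V \<Longrightarrow> p + q \<in> polys R V"
  using keys_add[of p q] by (fastforce simp: polys_iff lookup_add subring_onD)

lemma polys_zero: "subring_on R \<Longrightarrow> 0 \<in> polys R V"
  by (simp add: polys_iff subring_onD)

lemma polys_induct [consumes 2, case_names zero single add]:
  assumes R: "subring_on R" and p: "p \<in> polys R V"
    and "P 0" "\<And>m c. c \<in> R \<Longrightarrow> ks m \<subseteq> V \<Longrightarrow> P (mterm m c)"
    and add: "\<And>p q. p \<in> polys R V \<Longrightarrow> q \<in> polys R V \<Longrightarrow> P p \<Longrightarrow> P q \<Longrightarrow> P (p + q)"
  shows "P p"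
proof -
  have "(\<Sum>m\<in>A. mterm m (lk p m)) \<in> polys R V
        \<and> P (\<Sum>m\<in>A. mterm m (lk p m))" if "A \<subseteq> ks p" for A
    using finite_subset[OF that finite_keys] that
  proof (induction A rule: finite_induct)
    case empty
    then show ?case using assms by (simp add: polys_zero)
  next
    case (insert m A)
    have "lk p m \<in> R" "ks m \<subseteq> V" using insert.prems p by (auto simp: polys_iff)
    then have "mterm m (lk p m) \<in> polys R V" "P (mterm m (lk p m))"
      using single_in_polys[OF R] assms(4) by blast+
    then show ?case using insert R add by (simp add: polys_add)
  qed
  from this[of "ks p"] show ?thesis using polys_sum_single[of p] by simp
qed

lemma polys_mult:
  assumes R: "subring_on R" and p: "p \<in> polys R V" and q: "q \<in> polys R V"
  shows "p * q \<in> polys R V"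
  using R p
proof (induction rule: polys_induct)
  case (single m c)
  from R q show ?case
  proof (induction rule: polys_induct)
    case s: (single m' c')
    then show ?case using single R
      by (simp add: mult_single single_in_polys subring_onD keys_add_nat)
  qed (use R in \<open>simp_all add: polys_zero polys_add distrib_left\<close>)
qed (use R in \<open>simp_all add: polys_zero polys_add distrib_right\<close>)

lemma subring_polys: "subring_on R \<Longrightarrow> subring_on (polys R V)"
  unfolding subring_on_def[of "polys R V"]
  by (auto simp: polys_zero polys_add polys_mult)
    (auto simp: polys_iff lookup_one when_def subring_onD)

lemma Const_in_polys: "subring_on R \<Longrightarrow> c \<in> R \<Longrightarrow> Const c \<in> polys R V"
  by (simp add: single_in_polys)

lemma Var_in_polys: "subring_on R \<Longrightarrow> v \<in> V \<Longrightarrow> Var v \<in> polys R V"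
  by (simp add: single_in_polys subring_onD)

lemma polys_mono: "R \<subseteq> R' \<Longrightarrow> V \<subseteq> V' \<Longrightarrow> polys R V \<subseteq> polys R' V'"
  unfolding polys_def by blast

text \<open>A monomial is built up by multiplying with one variable at a time; the total degree decreases when
  a variable is split off.\<close>

lemma monomial_induct [consumes 1, case_names zero add]:
  fixes m :: "'v \<Rightarrow>\<^sub>0 nat"
  assumes "ks m \<subseteq> V" "P 0"
    and "\<And>m v. ks m \<subseteq> V \<Longrightarrow> v \<in> V \<Longrightarrow> P m \<Longrightarrow> P (m + mterm v 1)"
  shows "P m"
  using assms(1)
proof (induction "\<Sum>v\<in>ks m. lk m v" arbitrary: m rule: less_induct)
  case less
  show ?case
  proof (cases "m = 0")
    case False
    then obtain v where v: "v \<in> ks m" by (metis keys_eq_empty ex_in_conv)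
    define m' where "m' = m - mterm v 1"
    have m: "m = m' + mterm v 1"
      unfolding m'_def using v
      by (intro poly_mapping_eqI)
        (auto simp: lookup_add lookup_minus lookup_single when_def in_keys_iff)
    have ks: "ks m' \<subseteq> ks m" by (subst m) (auto simp: keys_add_nat)
    have "(\<Sum>v\<in>ks m'. lk m' v) = (\<Sum>v\<in>ks m. lk m' v)"
      using ks by (intro sum.mono_neutral_left) (auto simp: in_keys_iff)
    also have "\<dots> < (\<Sum>v\<in>ks m. lk m v)"
      by (rule sum_strict_mono_ex1)
        (use v in \<open>auto simp: m'_def lookup_minus lookup_single when_def in_keys_iff intro!: bexI[of _ v]\<close>)
    finally have "P m'" using less ks by blast
    then show ?thesis using assms(3)[of m' v] m ks v less.prems by auto
  qed (use assms(2) in simp)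
qed

text \<open>The universal property of the polynomial ring in the form of an induction principle: whatever holds
  for constants and variables and is closed under the ring operations holds for all polynomials.\<close>

lemma polys_ring_induct [consumes 2, case_names Const Var add mult]:
  assumes R: "subring_on R" and p: "p \<in> polys R V"
    and C: "\<And>c. c \<in> R \<Longrightarrow> P (Const c)" and V: "\<And>v. v \<in> V \<Longrightarrow> P (Var v)"
    and add: "\<And>p q. p \<in> polys R V \<Longrightarrow> q \<in> polys R V \<Longrightarrow> P p \<Longrightarrow> P q \<Longrightarrow> P (p + q)"
    and mult: "\<And>p q. p \<in> polys R V \<Longrightarrow> q \<in> polys R V \<Longrightarrow> P p \<Longrightarrow> P q \<Longrightarrow> P (p * q)"
  shows "P p"
  using R p
proof (induction rule: polys_induct)
  case zero
  then show ?case using C[of 0] R by (simp add: subring_onD)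
next
  case (single m c)
  from single(2) show ?case
  proof (induction m rule: monomial_induct)
    case zero
    then show ?case using C single by simp
  next
    case (add m v)
    have "mterm (m + mterm v 1) c = mterm m c * Var v"
      by (simp add: mult_single)
    then show ?case using mult[of "mterm m c" "Var v"] add V single R
      by (simp add: single_in_polys subring_onD)
  qed
next
  case (add p q)
  then show ?case using assms(5) by blast
qed

lemma hom_on_polys_unique:
  assumes "subring_on R" "hom_on (polys R V) F" "hom_on (polys R V) G"
    and "\<And>c. c \<in> R \<Longrightarrow> F (Const c) = G (Const c)" "\<And>v. v \<in> V \<Longrightarrow> F (Var v) = G (Var v)"
    and "p \<in> polys R V"
  shows "F p = G p"
  using assms(1,6)
proof (induction rule: polys_ring_induct)
  case (add p q)
  then show ?case using hom_onD(3)[OF assms(2)] hom_onD(3)[OF assms(3)] by metis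
next
  case (mult p q)
  then show ?case using hom_onD(4)[OF assms(2)] hom_onD(4)[OF assms(3)] by metis
qed (use assms in auto)

subsection \<open>Changing coefficients\<close>

lemma lookup_map: "\<phi> 0 = 0 \<Longrightarrow> lk (cmap \<phi> p) m = \<phi> (lk p m)"
  by (simp add: Poly_Mapping.map.rep_eq when_def)

lemma keys_map: "ks (cmap \<phi> p) \<subseteq> ks p"
  by (auto simp: in_keys_iff Poly_Mapping.map.rep_eq when_def)

lemma map_in_polys:
  assumes "\<phi> ` R \<subseteq> S" "\<phi> 0 = 0" "p \<in> polys R V"
  shows "cmap \<phi> p \<in> polys S V"
  using assms keys_map[of \<phi> p] by (auto simp: polys_iff lookup_map)

lemma map_cong_polys:
  assumes "\<And>x. x \<in> R \<Longrightarrow> \<phi> x = \<psi> x" "p \<in> polys R V"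
  shows "cmap \<phi> p = cmap \<psi> p"
  using assms by (intro poly_mapping_eqI) (auto simp: Poly_Mapping.map.rep_eq polys_iff when_def)

lemma map_map_poly:
  assumes "\<phi> 0 = 0" "\<psi> 0 = 0"
  shows "cmap \<psi> (cmap \<phi> p) = cmap (\<lambda>x. \<psi> (\<phi> x)) p"
  using assms by (intro poly_mapping_eqI) (simp add: lookup_map)

lemma map_zero: "cmap \<phi> 0 = 0"
  by (rule poly_mapping_eqI) (simp add: Poly_Mapping.map.rep_eq)

lemma hom_on_map:
  assumes R: "subring_on R" and h: "hom_on R \<phi>"
  shows "hom_on (polys R V) (cmap \<phi>)"
proof -
  note h0 = hom_onD(1)[OF h]
  have add: "cmap \<phi> (p + q) = cmap \<phi> p + cmap \<phi> q"
    if "p \<in> polys R V" "q \<in> polys R V" for p q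
    using that hom_onD(3)[OF h] h0
    by (intro poly_mapping_eqI) (simp add: lookup_map lookup_add polys_iff)
  have "cmap \<phi> (p * q) = cmap \<phi> p * cmap \<phi> q"
    if p: "p \<in> polys R V" and q: "q \<in> polys R V" for p q
    using R p
  proof (induction rule: polys_induct)
    case zero
    then show ?case by (simp add: map_zero)
  next
    case (add p1 p2)
    then show ?case using q R \<open>\<And>q p. p \<in> polys R V \<Longrightarrow> q \<in> polys R V \<Longrightarrow> _\<close>
      by (simp add: distrib_right polys_mult)
  next
    case (single m c)
    from R q show ?case
    proof (induction rule: polys_induct)
      case zero
      then show ?case by (simp add: map_zero)
    next
      case s: (single m' c')
      then show ?case using single hom_onD(4)[OF h] h0 by (simp add: mult_single)
    next
      case s: (add p1 p2)
      then show ?case using single R \<open>\<And>q p. p \<in> polys R V \<Longrightarrow> q \<in> polys R V \<Longrightarrow> _\<close>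
        by (simp add: distrib_left polys_mult single_in_polys)
    qed
  qed
  moreover have "cmap \<phi> 1 = 1"
    by (rule poly_mapping_eqI) (simp add: lookup_map h0 lookup_one when_def hom_onD(2)[OF h])
  ultimately show ?thesis using add by (simp add: hom_on_def map_zero)
qed

subsection \<open>Substitution\<close>

definition monom_value :: "('v \<Rightarrow> 'b::comm_ring_1) \<Rightarrow> ('v \<Rightarrow>\<^sub>0 nat) \<Rightarrow> 'b" where
  "monom_value \<theta> m = (\<Prod>v\<in>ks m. \<theta> v ^ lk m v)"

lemma monom_value_superset:
  "finite A \<Longrightarrow> ks m \<subseteq> A \<Longrightarrow> monom_value \<theta> m = (\<Prod>v\<in>A. \<theta> v ^ lk m v)"
  unfolding monom_value_def by (rule prod.mono_neutral_left) (auto simp: in_keys_iff)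

lemma monom_value_add: "monom_value \<theta> (m + m') = monom_value \<theta> m * monom_value \<theta> m'"
  by (simp add: monom_value_superset[of "ks m \<union> ks m'"] keys_add_nat lookup_add power_add prod.distrib)

lemma subst_poly_superset:
  assumes "c 0 = 0" "finite A" "ks p \<subseteq> A"
  shows "subst_poly c \<theta> p = (\<Sum>m\<in>A. Const (c (lk p m)) * monom_value \<theta> m)"
  unfolding subst_poly_def monom_value_def[symmetric]
  using assms by (intro sum.mono_neutral_left) (auto simp: in_keys_iff)

lemma subst_poly_single:
  "c 0 = 0 \<Longrightarrow> subst_poly c \<theta> (mterm m a) = Const (c a) * monom_value \<theta> m"
  by (subst subst_poly_superset[of _ "{m}"]) auto

lemma subst_poly_Const: "c 0 = 0 \<Longrightarrow> subst_poly c \<theta> (Const a) = Const (c a)"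
  by (simp add: subst_poly_single monom_value_def)

lemma subst_poly_Var: "hom_on UNIV c \<Longrightarrow> subst_poly c \<theta> (Var v) = \<theta> v"
  by (simp add: subst_poly_single hom_onD(1,2) monom_value_def)

lemma hom_on_subst_poly:
  assumes c: "hom_on UNIV c"
  shows "hom_on UNIV (subst_poly c \<theta>)"
proof -
  note c0 = hom_onD(1)[OF c]
  have add: "subst_poly c \<theta> (p + q) = subst_poly c \<theta> p + subst_poly c \<theta> q" for p q
    using hom_onD(3)[OF c] keys_add[of p q]
    by (simp add: subst_poly_superset[where A="ks p \<union> ks q"] c0 lookup_add single_add
        distrib_right sum.distrib)
  have z: "subst_poly c \<theta> 0 = 0" by (simp add: subst_poly_def)
  have "subst_poly c \<theta> (p * q) = subst_poly c \<theta> p * subst_poly c \<theta> q" for p q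
  proof -
    have "p \<in> polys UNIV UNIV" by (simp add: polys_iff)
    with subring_on_UNIV show ?thesis
    proof (induction rule: polys_induct)
      case (single m a)
      have "q \<in> polys UNIV UNIV" by (simp add: polys_iff)
      with subring_on_UNIV show ?case
      proof (induction rule: polys_induct)
        case (single m' a')
        then show ?case
          using Const_mult[of "c a" "c a'"] hom_onD(4)[OF c, of a a']
          by (simp add: mult_single subst_poly_single c0 monom_value_add mult_ac)
      qed (simp_all add: z add distrib_left)
    qed (simp_all add: z add distrib_right)
  qed
  moreover have "subst_poly c \<theta> 1 = 1"
    using subst_poly_Const[where c=c and \<theta>=\<theta> and a=1] c0 hom_onD(2)[OF c] by simp
  ultimately show ?thesis using add z by (simp add: hom_on_def)
qed

lemma subst_poly_in_polys:
  assumes R: "subring_on R" and c: "hom_on UNIV c" "range c \<subseteq> R"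
    and \<theta>: "\<And>v. v \<in> V \<Longrightarrow> \<theta> v \<in> polys R W" and p: "p \<in> polys UNIV V"
  shows "subst_poly c \<theta> p \<in> polys R W"
  using subring_on_UNIV p
proof (induction rule: polys_ring_induct)
  case (Const a)
  then show ?case using c R by (auto simp: subst_poly_Const hom_onD(1) intro!: Const_in_polys)
next
  case (Var v)
  then show ?case using c \<theta> by (simp add: subst_poly_Var)
next
  case (add p q)
  then show ?case using R by (simp add: polys_add hom_onD(3)[OF hom_on_subst_poly[OF c(1)]])
next
  case (mult p q)
  then show ?case using R by (simp add: polys_mult hom_onD(4)[OF hom_on_subst_poly[OF c(1)]])
qed

lemma map_subst_poly:
  assumes R: "subring_on R" and \<phi>: "hom_on R \<phi>" and c: "hom_on UNIV c" "range c \<subseteq> R"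
    and \<theta>: "\<And>v. v \<in> V \<Longrightarrow> \<theta> v \<in> polys R W" and p: "p \<in> polys UNIV V"
  shows "cmap \<phi> (subst_poly c \<theta> p)
         = subst_poly (\<lambda>x. \<phi> (c x)) (\<lambda>v. cmap \<phi> (\<theta> v)) p"
proof -
  have \<phi>c: "hom_on UNIV (\<lambda>x. \<phi> (c x))" using hom_on_comp[OF c(1) \<phi>] c(2) by simp
  note s = hom_on_subset[OF hom_on_subst_poly subset_UNIV]
  show ?thesis
  proof (rule hom_on_polys_unique[OF subring_on_UNIV _ s[OF \<phi>c] _ _ p])
    show "hom_on (polys UNIV V) (\<lambda>x. cmap \<phi> (subst_poly c \<theta> x))"
      by (rule hom_on_comp[OF s[OF c(1)] hom_on_map[OF R \<phi>, of W]])
        (use subst_poly_in_polys[OF R c \<theta>] in auto)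
  next
    fix a
    have "\<phi> (c 0) = 0" using hom_onD(1)[OF \<phi>c] .
    then show "cmap \<phi> (subst_poly c \<theta> (Const a)) =
       subst_poly (\<lambda>x. \<phi> (c x)) (\<lambda>v. cmap \<phi> (\<theta> v)) (Const a)"
      using hom_onD(1)[OF c(1)] hom_onD(1)[OF \<phi>] by (simp add: subst_poly_Const)
  next
    fix v assume "v \<in> V"
    then show "cmap \<phi> (subst_poly c \<theta> (Var v)) =
       subst_poly (\<lambda>x. \<phi> (c x)) (\<lambda>v. cmap \<phi> (\<theta> v)) (Var v)"
      by (simp only: subst_poly_Var[OF c(1)] subst_poly_Var[OF \<phi>c])
  qed
qed

subsection \<open>Gradings\<close>

definition homog :: "('v \<Rightarrow> 'a::ab_group_add) \<Rightarrow> 'a \<Rightarrow> ('v, 'r::comm_ring_1) mpoly \<Rightarrow> bool" where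
  "homog d a p \<longleftrightarrow> (\<forall>m\<in>ks p. mdeg d m = a)"

lemma poly_piece_iff: "p \<in> poly_piece R V d a \<longleftrightarrow> p \<in> polys R V \<and> homog d a p"
  by (simp add: poly_piece_def homog_def)

lemma mdeg_superset:
  "finite A \<Longrightarrow> ks m \<subseteq> A \<Longrightarrow> mdeg d m = (\<Sum>v\<in>A. \<Sum>j<lk m v. d v)"
  unfolding mdeg_def by (rule sum.mono_neutral_left) (auto simp: in_keys_iff)

lemma sum_lessThan_add_const: "(\<Sum>j<a + b. x) = (\<Sum>j<a. x) + (\<Sum>j<b. (x::'a::comm_monoid_add))" for a b :: nat
  by (induction b) (auto simp: add.assoc)

lemma mdeg_add: "mdeg d (m + m') = mdeg d m + mdeg d m'"
  by (simp add: mdeg_superset[of "ks m \<union> ks m'"] keys_add_nat lookup_add sum_lessThan_add_const sum.distrib)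

lemma mdeg_zero [simp]: "mdeg d 0 = 0"
  by (simp add: mdeg_def)

lemma mdeg_single [simp]: "mdeg d (mterm v 1) = d v"
  by (simp add: mdeg_def One_nat_def)

lemma lookup_component: "lk (component d a p) m = (if mdeg d m = a then lk p m else 0)"
  by (auto simp: component_def lookup_sum lookup_single when_def in_keys_iff)

lemma component_add: "component d a (p + q) = component d a p + component d a q"
  by (rule poly_mapping_eqI) (simp add: lookup_component lookup_add)

lemma component_zero [simp]: "component d a 0 = 0"
  by (rule poly_mapping_eqI) (simp add: lookup_component)

lemma component_diff: "component d a (p - q) = component d a p - component d a q"
  by (rule poly_mapping_eqI) (simp add: lookup_component lookup_minus)

lemma component_sum: "component d a (sum f A) = (\<Sum>i\<in>A. component d a (f i))"
  by (induction A rule: infinite_finite_induct) (simp_all add: component_add)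

lemma homog_component: "homog d a (component d a p)"
  by (auto simp: homog_def in_keys_iff lookup_component split: if_splits)

lemma component_homog: "homog d b p \<Longrightarrow> component d a p = (if a = b then p else 0)"
  by (rule poly_mapping_eqI) (auto simp: lookup_component homog_def in_keys_iff)

lemma homog_zero [simp]: "homog d a 0"
  by (simp add: homog_def)

lemma homog_add: "homog d a p \<Longrightarrow> homog d a q \<Longrightarrow> homog d a (p + q)"
  using keys_add[of p q] by (auto simp: homog_def)

lemma homog_sum: "(\<And>i. i \<in> A \<Longrightarrow> homog d a (f i)) \<Longrightarrow> homog d a (sum f A)"
  by (induction A rule: infinite_finite_induct) (simp_all add: homog_add)

lemma homog_mult: "homog d a p \<Longrightarrow> homog d b q \<Longrightarrow> homog d (a + b) (p * q)"
  using keys_mult[of p q] by (fastforce simp: homog_def mdeg_add)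

lemma homog_single: "homog d (mdeg d m) (mterm m c)"
  by (simp add: homog_def)

lemma homog_Const [simp]: "homog d 0 (Const c)"
  by (simp add: homog_def)

lemma homog_Var [simp]: "homog d (d v) (Var v)"
  by (simp add: homog_def)

lemma homog_Const_mult: "homog d a p \<Longrightarrow> homog d a (Const c * p)"
  using homog_mult[OF homog_Const, of d a p c] by simp

lemma homog_map: "homog d a p \<Longrightarrow> homog d a (cmap \<phi> p)"
  using keys_map[of \<phi> p] by (auto simp: homog_def)

lemma component_map: "\<phi> 0 = 0 \<Longrightarrow> component d a (cmap \<phi> p) = cmap \<phi> (component d a p)"
  by (rule poly_mapping_eqI) (simp add: lookup_component lookup_map)

lemma component_in_polys: "subring_on R \<Longrightarrow> p \<in> polys R V \<Longrightarrow> component d a p \<in> polys R V"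
  by (auto simp: polys_def lookup_component in_keys_iff subring_onD split: if_splits)

lemma component_sum_eq: "p = (\<Sum>a\<in>mdeg d ` ks p. component d a p)"
proof (rule poly_mapping_eqI)
  fix m
  have "(\<Sum>a\<in>mdeg d ` ks p. lk (component d a p) m) = (if mdeg d m \<in> mdeg d ` ks p then lk p m else 0)"
    by (simp add: lookup_component)
  then show "lk p m = lk (\<Sum>a\<in>mdeg d ` ks p. component d a p) m"
    by (auto simp: lookup_sum in_keys_iff)
qed

text \<open>Multiplication by a homogeneous polynomial shifts degrees.\<close>

lemma component_homog_mult:
  assumes "homog d b p"
  shows "component d a (p * q) = p * component d (a - b) q"
proof -
  have "q \<in> polys UNIV UNIV" by (simp add: polys_iff)
  with subring_on_UNIV show ?thesis
  proof (induction rule: polys_induct)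
    case (single m c)
    have "homog d (b + mdeg d m) (p * mterm m c)"
      by (rule homog_mult[OF assms homog_single])
    then show ?case
      by (simp add: component_homog[OF homog_single] component_homog) (auto simp: algebra_simps)
  qed (simp_all add: component_add distrib_left)
qed

lemma homog_subst_poly:
  assumes c: "hom_on UNIV c" and \<theta>: "\<And>v. v \<in> V \<Longrightarrow> homog d (d v) (\<theta> v)" and m: "ks m \<subseteq> V"
  shows "homog d (mdeg d m) (subst_poly c \<theta> (mterm m a))"
proof -
  have "homog d (mdeg d m) (monom_value \<theta> m)" using m
  proof (induction m rule: monomial_induct)
    case zero
    then show ?case by (simp add: monom_value_def homog_def)
  next
    case (add m v)
    have "monom_value \<theta> (mterm v 1) = \<theta> v" by (simp add: monom_value_def)
    then show ?case using homog_mult[OF add(3) \<theta>[OF add(2)]] by (simp add: mdeg_add monom_value_add)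
  qed
  then show ?thesis by (simp add: subst_poly_single hom_onD(1)[OF c] homog_Const_mult)
qed

text \<open>A substitution of homogeneous polynomials of the right degrees preserves the grading: it takes
  a monomial of degree \<open>a\<close> to a homogeneous polynomial of degree \<open>a\<close>.\<close>

lemma component_subst_poly:
  assumes c: "hom_on UNIV c" and \<theta>: "\<And>v. v \<in> V \<Longrightarrow> homog d (d v) (\<theta> v)" and p: "p \<in> polys UNIV V"
  shows "component d a (subst_poly c \<theta> p) = subst_poly c \<theta> (component d a p)"
proof -
  have s0: "subst_poly c \<theta> 0 = 0" by (simp add: subst_poly_def)
  show ?thesis
    using subring_on_UNIV p
  proof (induction rule: polys_induct)
    case (single m b)
    then show ?case
      using homog_subst_poly[OF c \<theta>, of V m b]
      by (simp add: component_homog[OF homog_single] component_homog s0)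
  qed (simp_all add: s0 component_add hom_onD(3)[OF hom_on_subst_poly[OF c]])
qed

section \<open>Base change of ideals\<close>

text \<open>The polynomials whose image lies in the ideal generated by the images of \<open>X\<close> form an ideal containing
  \<open>X\<close>; so the whole ideal generated by \<open>X\<close> is mapped into it.\<close>

lemma base_change_Idl:
  assumes R: "subring_on R" and S: "subring_on S" and \<phi>: "hom_on R \<phi>" "\<phi> ` R \<subseteq> S"
    and X: "X \<subseteq> polys R V"
  shows "base_change S V \<phi> (Idl\<^bsub>ring_on (polys R V)\<^esub> X)
         = Idl\<^bsub>ring_on (polys S V)\<^esub> (cmap \<phi> ` X)"
    (is "_ = ?I")
proof -
  note PR = subring_polys[OF R, of V] and PS = subring_polys[OF S, of V]
  have m: "cmap \<phi> ` polys R V \<subseteq> polys S V"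
    using map_in_polys[OF \<phi>(2) hom_onD(1)[OF \<phi>(1)]] by blast
  have sub: "cmap \<phi> ` X \<subseteq> polys S V" using m X by blast
  have "Idl\<^bsub>ring_on (polys R V)\<^esub> X \<subseteq> {p \<in> polys R V. cmap \<phi> p \<in> ?I}"
    by (rule Idl_facts(3)[OF PR X hom_on_vimage_ideal[OF hom_on_map[OF R \<phi>(1)] PR _ m]])
      (use Idl_facts(1,2)[OF PS sub] X in auto)
  then have 1: "cmap \<phi> ` (Idl\<^bsub>ring_on (polys R V)\<^esub> X) \<subseteq> ?I" by blast
  have 2: "cmap \<phi> ` (Idl\<^bsub>ring_on (polys R V)\<^esub> X) \<subseteq> polys S V"
    using ideal_onD(1)[OF Idl_facts(1)[OF PS sub]] 1 by blast
  show ?thesis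
    unfolding base_change_def
  proof (rule subset_antisym)
    show "Idl\<^bsub>ring_on (polys S V)\<^esub> (cmap \<phi> ` (Idl\<^bsub>ring_on (polys R V)\<^esub> X)) \<subseteq> ?I"
      by (rule Idl_facts(3)[OF PS 2 Idl_facts(1)[OF PS sub] 1])
    show "?I \<subseteq> Idl\<^bsub>ring_on (polys S V)\<^esub> (cmap \<phi> ` (Idl\<^bsub>ring_on (polys R V)\<^esub> X))"
      by (rule Idl_facts(3)[OF PS sub Idl_facts(1)[OF PS 2]])
        (use Idl_facts(2)[OF PS 2] Idl_facts(2)[OF PR X] in blast)
  qed
qed

lemma Idl_ideal_eq: "subring_on R \<Longrightarrow> ideal_on R K \<Longrightarrow> Idl\<^bsub>ring_on R\<^esub> K = K"
  using Idl_facts(2,3)[of R K] by (auto simp: ideal_on_def)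

lemma base_change_base_change:
  assumes "subring_on R" "subring_on S" "subring_on Q" "hom_on R \<phi>" "\<phi> ` R \<subseteq> S"
    "hom_on S \<psi>" "\<psi> ` S \<subseteq> Q" "K \<subseteq> polys R V"
  shows "base_change Q V \<psi> (base_change S V \<phi> K) = base_change Q V (\<lambda>x. \<psi> (\<phi> x)) K"
proof -
  have "cmap \<phi> ` K \<subseteq> polys S V"
    using map_in_polys[OF assms(5) hom_onD(1)[OF assms(4)]] assms(8) by blast
  then have "base_change Q V \<psi> (base_change S V \<phi> K)
      = Idl\<^bsub>ring_on (polys Q V)\<^esub> (cmap \<psi> ` cmap \<phi> ` K)"
    unfolding base_change_def[of S] using base_change_Idl[OF assms(2,3,6,7)] by blast
  then show ?thesis
    by (simp add: base_change_def image_image map_map_poly hom_onD(1)[OF assms(4)] hom_onD(1)[OF assms(6)])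
qed

lemma base_change_cong:
  assumes "\<And>x. x \<in> R \<Longrightarrow> \<phi> x = \<psi> x" "K \<subseteq> polys R V"
  shows "base_change S V \<phi> K = base_change S V \<psi> K"
proof -
  have "cmap \<phi> ` K = cmap \<psi> ` K"
    using assms by (intro image_cong refl map_cong_polys[where R=R and V=V]) auto
  then show ?thesis by (simp add: base_change_def)
qed

lemma component_mult:
  "component d a (p * q) = (\<Sum>b\<in>mdeg d ` ks p. component d b p * component d (a - b) q)"
proof -
  have "p * q = (\<Sum>b\<in>mdeg d ` ks p. component d b p * q)"
    by (subst component_sum_eq[of p d]) (simp add: sum_distrib_right)
  then show ?thesis
    by (simp add: component_sum component_homog_mult[OF homog_component])
qed

lemma homogeneous_idealD:
  assumes "subring_on R" "homogeneous_ideal R V d K"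
  shows "ideal_on (polys R V) K" "p \<in> K \<Longrightarrow> component d a p \<in> K"
  using assms by (auto simp: homogeneous_ideal_def ideal_iff_ideal_on subring_polys)

text \<open>By \<open>component_mult\<close>, the elements of the ideal all of whose components lie in the ideal again form an
  ideal.\<close>

lemma homogeneous_ideal_Idl:
  assumes R: "subring_on R" and X: "X \<subseteq> polys R V" "\<And>x a. x \<in> X \<Longrightarrow> component d a x \<in> X"
  shows "homogeneous_ideal R V d (Idl\<^bsub>ring_on (polys R V)\<^esub> X)" (is "homogeneous_ideal _ _ _ ?I")
proof -
  note P = subring_polys[OF R, of V]
  note I = Idl_facts[OF P X(1)]
  have "ideal_on (polys R V) {p \<in> ?I. \<forall>a. component d a p \<in> ?I}"
    unfolding ideal_on_def
  proof (intro conjI ballI)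
    fix r x assume r: "r \<in> polys R V" and x: "x \<in> {p \<in> ?I. \<forall>a. component d a p \<in> ?I}"
    have "component d a (r * x) \<in> ?I" for a
      unfolding component_mult
      using x r by (auto intro!: ideal_on_sum[OF I(1)] ideal_onD(4)[OF I(1)] component_in_polys[OF R])
    then show "r * x \<in> {p \<in> ?I. \<forall>a. component d a p \<in> ?I}"
      using r x ideal_onD(4)[OF I(1)] by auto
  qed (use ideal_onD[OF I(1)] in \<open>auto simp: component_add\<close>)
  then have "?I \<subseteq> {p \<in> ?I. \<forall>a. component d a p \<in> ?I}"
    by (rule I(3)) (use I(2) X(2) in blast)
  then show ?thesis
    using I(1) by (auto simp: homogeneous_ideal_def ideal_iff_ideal_on[OF P])
qed

lemma homogeneous_ideal_base_change:
  assumes R: "subring_on R" and S: "subring_on S" and \<phi>: "hom_on R \<phi>" "\<phi> ` R \<subseteq> S"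
    and K: "homogeneous_ideal R V d K"
  shows "homogeneous_ideal S V d (base_change S V \<phi> K)"
  unfolding base_change_def
proof (rule homogeneous_ideal_Idl[OF S])
  note KD = homogeneous_idealD[OF R K]
  show "cmap \<phi> ` K \<subseteq> polys S V"
    using map_in_polys[OF \<phi>(2) hom_onD(1)[OF \<phi>(1)]] ideal_onD(1)[OF KD(1)] by blast
  show "component d a x \<in> cmap \<phi> ` K" if "x \<in> cmap \<phi> ` K" for x a
    using that KD(2) component_map[of \<phi> d a] hom_onD(1)[OF \<phi>(1)] by fastforce
qed

section \<open>Quotients by homogeneous ideals\<close>

lemma coset_eq: "coset P K p = (\<lambda>k. k + p) ` K"
  by (auto simp: coset_def a_r_coset_def')

lemma module_on_simps [simp]:
  "carrier (module_on sm S) = S" "mult (module_on sm S) = (*)" "one (module_on sm S) = 1"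
  "zero (module_on sm S) = 0" "add (module_on sm S) = (+)" "smult (module_on sm S) = sm"
  by (simp_all add: module_on_def)

lemma module_on_coset: "K +>\<^bsub>module_on sm P\<^esub> p = coset P K p"
  by (auto simp: coset_eq a_r_coset_def')

definition additive_closed :: "'r::comm_ring_1 set \<Rightarrow> bool" where
  "additive_closed K \<longleftrightarrow> 0 \<in> K \<and> (\<forall>x\<in>K. \<forall>y\<in>K. x + y \<in> K) \<and> (\<forall>x\<in>K. - x \<in> K)"

lemma ideal_on_additive: "ideal_on P K \<Longrightarrow> subring_on P \<Longrightarrow> additive_closed K"
  by (auto simp: additive_closed_def ideal_onD ideal_on_minus)

lemma additive_closedD:
  assumes "additive_closed K"
  shows "0 \<in> K" "x \<in> K \<Longrightarrow> y \<in> K \<Longrightarrow> x + y \<in> K" "x \<in> K \<Longrightarrow> - x \<in> K" "x \<in> K \<Longrightarrow> y \<in> K \<Longrightarrow> x - y \<in> K"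
  using assms unfolding additive_closed_def by (auto, metis diff_conv_add_uminus)

lemma coset_eq_iff:
  assumes K: "additive_closed K"
  shows "coset P K p = coset P K q \<longleftrightarrow> p - q \<in> K"
proof
  assume "coset P K p = coset P K q"
  moreover have "p \<in> coset P K p" using additive_closedD(1)[OF K] by (force simp: coset_eq)
  ultimately show "p - q \<in> K" by (auto simp: coset_eq)
next
  assume pq: "p - q \<in> K"
  have "k + p \<in> (\<lambda>k. k + q) ` K" if "k \<in> K" for k
    using additive_closedD(2)[OF K that pq] by (intro image_eqI[of _ _ "k + (p - q)"]) auto
  moreover have "k + q \<in> (\<lambda>k. k + p) ` K" if "k \<in> K" for k
    using additive_closedD(4)[OF K that pq] by (intro image_eqI[of _ _ "k - (p - q)"]) auto
  ultimately show "coset P K p = coset P K q" by (auto simp: coset_eq)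
qed

lemma coset_zero: "coset P K 0 = K"
  by (simp add: coset_eq)

lemma coset_self: "additive_closed K \<Longrightarrow> p \<in> coset P K p"
  using additive_closedD(1) by (force simp: coset_eq)

lemma quot_module_simps:
  "carrier (quot_module (module_on sm S) K) = coset S K ` S"
  "zero (quot_module (module_on sm S) K) = K"
  by (auto simp: quot_module_def A_RCOSETS_def' module_on_coset)

lemma quot_module_add:
  assumes K: "additive_closed K"
  shows "add (quot_module (module_on sm S) K) (coset P K p) (coset P K q) = coset P K (p + q)"
proof -
  have "(\<Union>h\<in>coset P K p. \<Union>k\<in>coset P K q. {h + k}) = coset P K (p + q)"
  proof (intro equalityI subsetI)
    fix x assume "x \<in> (\<Union>h\<in>coset P K p. \<Union>k\<in>coset P K q. {h + k})"
    then obtain h k where hk: "h \<in> K" "k \<in> K" "x = (h + p) + (k + q)" by (auto simp: coset_eq)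
    then have "x = (h + k) + (p + q)" by (simp add: algebra_simps)
    then show "x \<in> coset P K (p + q)" using additive_closedD(2)[OF K hk(1,2)] unfolding coset_eq by blast
  next
    fix x assume "x \<in> coset P K (p + q)"
    then obtain k where k: "k \<in> K" "x = k + (p + q)" by (auto simp: coset_eq)
    then have "x = (k + p) + (0 + q)" by (simp add: algebra_simps)
    moreover have "k + p \<in> coset P K p" "0 + q \<in> coset P K q"
      unfolding coset_eq using k(1) additive_closedD(1)[OF K] by blast+
    ultimately show "x \<in> (\<Union>h\<in>coset P K p. \<Union>k\<in>coset P K q. {h + k})" by blast
  qed
  then show ?thesis by (simp add: quot_module_def set_add_def')
qed

lemma quot_module_smult:
  assumes K: "additive_closed K" and sm: "\<And>x. sm r x = e * x" and e: "\<And>k. k \<in> K \<Longrightarrow> e * k \<in> K"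
  shows "smult (quot_module (module_on sm S) K) r (coset P K p) = coset P K (e * p)"
proof -
  have 1: "coset S K (e * (k + p)) = coset P K (e * p)" if "k \<in> K" for k
  proof -
    have "e * (k + p) - e * p \<in> K" using e[OF that] by (simp only: distrib_left add_diff_cancel_right')
    then have "coset P K (e * (k + p)) = coset P K (e * p)" by (simp only: coset_eq_iff[OF K])
    then show ?thesis by (simp only: coset_eq)
  qed
  have "smult (quot_module (module_on sm S) K) r (coset P K p) = (\<Union>k\<in>K. coset S K (e * (k + p)))"
    by (simp add: quot_module_def module_on_coset sm coset_eq[of P K p])
  also have "\<dots> = (\<Union>k\<in>K. coset P K (e * p))" using 1 by blast
  also have "\<dots> = coset P K (e * p)" using additive_closedD(1)[OF K] by blast
  finally show ?thesis .
qed

text \<open>Calculations in a graded piece of a quotient are calculations with representatives.\<close>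

lemma graded_quot_simps:
  assumes R: "subring_on R" and K: "ideal_on (polys R V) K"
  shows "carrier (graded_quot R V d K a) = coset (polys R V) K ` poly_piece R V d a"
    "zero (graded_quot R V d K a) = K"
    "add (graded_quot R V d K a) (coset (polys R V) K p) (coset (polys R V) K q) = coset (polys R V) K (p + q)"
    "r \<in> R \<Longrightarrow> smult (graded_quot R V d K a) r (coset (polys R V) K p) = coset (polys R V) K (Const r * p)"
proof -
  note A = ideal_on_additive[OF K subring_polys[OF R]]
  show "carrier (graded_quot R V d K a) = coset (polys R V) K ` poly_piece R V d a"
    "zero (graded_quot R V d K a) = K"
    by (simp_all add: graded_quot_def poly_module_def quot_module_simps)
  show "add (graded_quot R V d K a) (coset (polys R V) K p) (coset (polys R V) K q) = coset (polys R V) K (p + q)"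
    using quot_module_add[OF A] by (simp add: graded_quot_def poly_module_def)
  show "smult (graded_quot R V d K a) r (coset (polys R V) K p) = coset (polys R V) K (Const r * p)" if "r \<in> R"
    using quot_module_smult[OF A, of "\<lambda>r p. Const r * p" r "Const r" "polys R V" "polys R V" p]
      ideal_onD(4)[OF K Const_in_polys[OF R that]]
    by (simp add: graded_quot_def poly_module_def)
qed

lemma poly_piece_closed:
  assumes R: "subring_on R"
  shows "0 \<in> poly_piece R V d a"
    "p \<in> poly_piece R V d a \<Longrightarrow> q \<in> poly_piece R V d a \<Longrightarrow> p + q \<in> poly_piece R V d a"
    "r \<in> R \<Longrightarrow> p \<in> poly_piece R V d a \<Longrightarrow> Const r * p \<in> poly_piece R V d a"
  using R by (auto simp: poly_piece_iff homog_add homog_Const_mult polys_zero polys_add polys_mult Const_in_polys)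

lemma poly_piece_sum:
  assumes R: "subring_on R" and "\<And>i. i \<in> A \<Longrightarrow> f i \<in> poly_piece R V d a"
  shows "sum f A \<in> poly_piece R V d a"
  using assms(2) by (induction A rule: infinite_finite_induct) (auto simp: poly_piece_closed[OF R])

lemma abelian_monoid_graded_quot:
  assumes R: "subring_on R" and K: "ideal_on (polys R V) K"
  shows "abelian_monoid (graded_quot R V d K a)"
proof (rule abelian_monoidI)
  let ?M = "graded_quot R V d K a" and ?C = "coset (polys R V) K"
  note s = graded_quot_simps[OF R K]
  show "\<zero>\<^bsub>?M\<^esub> \<in> carrier (?M)"
    using poly_piece_closed(1)[OF R] coset_zero[of "polys R V" K] by (force simp: s(1,2))
  show "\<zero>\<^bsub>?M\<^esub> \<oplus>\<^bsub>?M\<^esub> x = x" if "x \<in> carrier (?M)" for x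
    using that s(3)[of d a 0] by (auto simp: s(1,2) coset_zero)
  fix x y assume "x \<in> carrier (?M)" "y \<in> carrier (?M)"
  then obtain p q where p: "p \<in> poly_piece R V d a" "x = ?C p"
    and q: "q \<in> poly_piece R V d a" "y = ?C q" by (auto simp: s(1))
  show "x \<oplus>\<^bsub>?M\<^esub> y \<in> carrier (?M)"
    using poly_piece_closed(2)[OF R p(1) q(1)] by (simp only: p q s(1,3) imageI)
  show "x \<oplus>\<^bsub>?M\<^esub> y = y \<oplus>\<^bsub>?M\<^esub> x"
    by (simp only: p q s(3) add.commute)
  fix z assume "z \<in> carrier (?M)"
  then obtain r where r: "z = ?C r" by (auto simp: s(1))
  show "x \<oplus>\<^bsub>?M\<^esub> y \<oplus>\<^bsub>?M\<^esub> z
      = x \<oplus>\<^bsub>?M\<^esub> (y \<oplus>\<^bsub>?M\<^esub> z)"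
    by (simp only: p q r s(3) add.assoc)
qed

lemma graded_quot_finsum:
  fixes n :: nat
  assumes R: "subring_on R" and K: "ideal_on (polys R V) K"
    and b: "\<And>i. i < n \<Longrightarrow> b i \<in> poly_piece R V d a" and c: "c \<in> {..<n} \<rightarrow> R"
  shows "(\<Oplus>\<^bsub>graded_quot R V d K a\<^esub>i\<in>{..<n}. c i \<odot>\<^bsub>graded_quot R V d K a\<^esub> coset (polys R V) K (b i))
         = coset (polys R V) K (\<Sum>i<n. Const (c i) * b i)"
proof -
  let ?M = "graded_quot R V d K a" and ?C = "coset (polys R V) K"
  interpret abelian_monoid "?M" by (rule abelian_monoid_graded_quot[OF R K])
  note s = graded_quot_simps[OF R K]
  show ?thesis using b c
  proof (induction n)
    case 0
    then show ?case by (simp add: s coset_zero)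
  next
    case (Suc n)
    have c: "c \<in> {..<n} \<rightarrow> R" "c n \<in> R" "\<And>i. i < n \<Longrightarrow> c i \<in> R" using Suc.prems(2) by auto
    have cl: "c i \<odot>\<^bsub>?M\<^esub> ?C (b i) \<in> carrier (?M)"
      if "i < Suc n" "c i \<in> R" for i
      using poly_piece_closed(3)[OF R that(2) Suc.prems(1)[OF that(1)]] by (simp only: s(1) s(4)[OF that(2)] imageI)
    have "(\<Oplus>\<^bsub>?M\<^esub>i\<in>{..<Suc n}. c i \<odot>\<^bsub>?M\<^esub> ?C (b i))
       = (c n \<odot>\<^bsub>?M\<^esub> ?C (b n)) \<oplus>\<^bsub>?M\<^esub>
         (\<Oplus>\<^bsub>?M\<^esub>i\<in>{..<n}. c i \<odot>\<^bsub>?M\<^esub> ?C (b i))"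
      unfolding lessThan_Suc by (rule finsum_insert) (use c cl in auto)
    also have "\<dots> = ?C (Const (c n) * b n + (\<Sum>i<n. Const (c i) * b i))"
      using Suc.IH[OF Suc.prems(1) c(1)] by (simp only: s(3) s(4)[OF c(2)] less_SucI)
    finally show ?case by (simp only: sum.lessThan_Suc add.commute)
  qed
qed

definition lincomb ::
  "(nat \<Rightarrow> 'r::comm_ring_1) \<Rightarrow> (nat \<Rightarrow> ('v, 'r) mpoly) \<Rightarrow> nat \<Rightarrow> ('v, 'r) mpoly" where
  "lincomb c b n = (\<Sum>i<n. Const (c i) * b i)"

text \<open>Freeness of a graded piece over a basic open set, expressed by representatives: the coset of a linear
  combination is the linear combination of cosets, and a coset is zero if the representative lies in \<open>K\<close>.\<close>

lemma free_on_basic_open_iff: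
  assumes R: "subring_on R" and K: "ideal_on (polys R V) K" and g: "g \<in> R"
  shows "free_on_basic_open (ring_on R) (graded_quot R V d K a) g n \<longleftrightarrow>
    (\<exists>b. (\<forall>i<n. b i \<in> poly_piece R V d a) \<and>
         (\<forall>x\<in>poly_piece R V d a. \<exists>N. \<exists>c\<in>{..<n} \<rightarrow> R. Const (g ^ N) * x - lincomb c b n \<in> K) \<and>
         (\<forall>c\<in>{..<n} \<rightarrow> R. lincomb c b n \<in> K \<longrightarrow> (\<exists>N. \<forall>i<n. g ^ N * c i = 0)))"
    (is "_ = (\<exists>b. ?B b)")
proof -
  note s = graded_quot_simps[OF R K]
  note A = ideal_on_additive[OF K subring_polys[OF R]]
  let ?M = "graded_quot R V d K a" and ?C = "coset (polys R V) K"
  have 1: "(\<Oplus>\<^bsub>?M\<^esub>i\<in>{..<n}. c i \<odot>\<^bsub>?M\<^esub> ?C (b i)) = ?C (lincomb c b n)"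
    if "c \<in> {..<n} \<rightarrow> R" "\<forall>i<n. b i \<in> poly_piece R V d a" for b c
    using graded_quot_finsum[OF R K _ that(1), of b d a] that(2) by (simp add: lincomb_def)
  have 2: "?C p = K \<longleftrightarrow> p \<in> K" for p
    using coset_eq_iff[OF A, of "polys R V" p 0] by (simp add: coset_zero)
  have 3: "(g ^ N) \<odot>\<^bsub>?M\<^esub> ?C x = ?C (Const (g ^ N) * x)" for N x
    by (rule s(4)[OF subring_onD(7)[OF R g]])
  show ?thesis
  proof
    assume "free_on_basic_open (ring_on R) ?M g n"
    then obtain b where b: "\<forall>i<n. b i \<in> carrier ?M"
      "\<forall>x\<in>carrier ?M. \<exists>N::nat. \<exists>c\<in>{..<n} \<rightarrow> R. (g ^ N) \<odot>\<^bsub>?M\<^esub> x = (\<Oplus>\<^bsub>?M\<^esub>i\<in>{..<n}. c i \<odot>\<^bsub>?M\<^esub> b i)"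
      "\<forall>c\<in>{..<n} \<rightarrow> R. (\<Oplus>\<^bsub>?M\<^esub>i\<in>{..<n}. c i \<odot>\<^bsub>?M\<^esub> b i) = \<zero>\<^bsub>?M\<^esub> \<longrightarrow> (\<exists>N::nat. \<forall>i<n. g ^ N * c i = 0)"
      by (auto simp: free_on_basic_open_def)
    from b(1) have "\<forall>i. \<exists>p. i < n \<longrightarrow> p \<in> poly_piece R V d a \<and> b i = ?C p" by (auto simp: s)
    then obtain b' where b': "\<And>i. i < n \<Longrightarrow> b' i \<in> poly_piece R V d a \<and> b i = ?C (b' i)" by metis
    interpret abelian_monoid ?M by (rule abelian_monoid_graded_quot[OF R K])
    have 4: "(\<Oplus>\<^bsub>?M\<^esub>i\<in>{..<n}. c i \<odot>\<^bsub>?M\<^esub> b i) = ?C (lincomb c b' n)" if "c \<in> {..<n} \<rightarrow> R" for c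
    proof -
      have "(\<Oplus>\<^bsub>?M\<^esub>i\<in>{..<n}. c i \<odot>\<^bsub>?M\<^esub> b i) = (\<Oplus>\<^bsub>?M\<^esub>i\<in>{..<n}. c i \<odot>\<^bsub>?M\<^esub> ?C (b' i))"
        by (rule finsum_cong') (use b' that in \<open>auto simp: s Pi_iff poly_piece_closed[OF R]\<close>)
      then show ?thesis using 1[OF that] b' by simp
    qed
    have "?B b'"
    proof (intro conjI allI impI ballI)
      fix x assume "x \<in> poly_piece R V d a"
      then have "?C x \<in> carrier ?M" by (simp add: s)
      then obtain N c where c: "c \<in> {..<n} \<rightarrow> R" "(g ^ N) \<odot>\<^bsub>?M\<^esub> ?C x = (\<Oplus>\<^bsub>?M\<^esub>i\<in>{..<n}. c i \<odot>\<^bsub>?M\<^esub> b i)"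
        using b(2) by blast
      then have "Const (g ^ N) * x - lincomb c b' n \<in> K"
        by (simp only: 3 4[OF c(1)] coset_eq_iff[OF A])
      then show "\<exists>N. \<exists>c\<in>{..<n} \<rightarrow> R. Const (g ^ N) * x - lincomb c b' n \<in> K" using c(1) by blast
    next
      fix c assume c: "c \<in> {..<n} \<rightarrow> R" "lincomb c b' n \<in> K"
      then have "(\<Oplus>\<^bsub>?M\<^esub>i\<in>{..<n}. c i \<odot>\<^bsub>?M\<^esub> b i) = \<zero>\<^bsub>?M\<^esub>" by (simp only: 4[OF c(1)] 2 s(2))
      then show "\<exists>N. \<forall>i<n. g ^ N * c i = 0" using b(3) c(1) by blast
    qed (use b' in auto)
    then show "\<exists>b. ?B b" by blast
  next
    assume "\<exists>b. ?B b"
    then obtain b where b: "?B b" by blast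
    then have bp: "\<forall>i<n. b i \<in> poly_piece R V d a" by blast
    show "free_on_basic_open (ring_on R) ?M g n"
      unfolding free_on_basic_open_def
    proof (rule exI[of _ "\<lambda>i. ?C (b i)"], intro conjI allI impI ballI)
      fix x assume "x \<in> carrier ?M"
      then obtain p where p: "p \<in> poly_piece R V d a" "x = ?C p" by (auto simp: s)
      then obtain N c where c: "c \<in> {..<n} \<rightarrow> R" "Const (g ^ N) * p - lincomb c b n \<in> K"
        using b by blast
      have "(g ^ N) \<odot>\<^bsub>?M\<^esub> x = (\<Oplus>\<^bsub>?M\<^esub>i\<in>{..<n}. c i \<odot>\<^bsub>?M\<^esub> ?C (b i))"
        using c(2) by (simp only: p(2) 3 1[OF c(1) bp] coset_eq_iff[OF A])
      then show "\<exists>N. \<exists>c\<in>{..<n} \<rightarrow> carrier (ring_on R).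
          (g [^]\<^bsub>ring_on R\<^esub> (N::nat)) \<odot>\<^bsub>?M\<^esub> x = (\<Oplus>\<^bsub>?M\<^esub>i\<in>{..<n}. c i \<odot>\<^bsub>?M\<^esub> ?C (b i))"
        using c(1) by (intro exI[of _ N] bexI[of _ c]) simp_all
    next
      fix c assume c: "c \<in> {..<n} \<rightarrow> carrier (ring_on R)"
        "(\<Oplus>\<^bsub>?M\<^esub>i\<in>{..<n}. c i \<odot>\<^bsub>?M\<^esub> ?C (b i)) = \<zero>\<^bsub>?M\<^esub>"
      then have "c \<in> {..<n} \<rightarrow> R" by simp
      moreover from this have "lincomb c b n \<in> K" using c(2) bp by (simp add: 1 2 s(2))
      ultimately show "\<exists>N::nat. \<forall>i<n. (g [^]\<^bsub>ring_on R\<^esub> N) \<otimes>\<^bsub>ring_on R\<^esub> c i = \<zero>\<^bsub>ring_on R\<^esub>"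
        using b by simp
    qed (use bp in \<open>simp add: s(1)\<close>)
  qed
qed

section \<open>Local freeness under base change\<close>

lemma lincomb_linear:
  "Const r * lincomb c b n = lincomb (\<lambda>i. r * c i) b n"
  "lincomb c b n + lincomb c' b n = lincomb (\<lambda>i. c i + c' i) b n"
  "lincomb c b n - lincomb c' b n = lincomb (\<lambda>i. c i - c' i) b n"
  by (simp_all add: lincomb_def sum_distrib_left Const_mult mult.assoc single_add distrib_right
      sum.distrib single_diff left_diff_distrib sum_subtractf)

lemma lincomb_0: "lincomb (\<lambda>i. 0) b n = 0"
  by (simp add: lincomb_def)

lemma lincomb_delta: "j < n \<Longrightarrow> lincomb (\<lambda>i. if i = j then 1 else 0) b n = b j"
proof -
  assume j: "j < n"
  have "lincomb (\<lambda>i. if i = j then 1 else 0) b n = (\<Sum>i<n. if i = j then b i else 0)"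
    unfolding lincomb_def by (rule sum.cong) auto
  then show ?thesis using j by simp
qed

lemma map_lincomb:
  assumes R: "subring_on R" and h: "hom_on R \<phi>" and c: "\<And>i. i < n \<Longrightarrow> c i \<in> R"
    and b: "\<And>i. i < n \<Longrightarrow> b i \<in> polys R V"
  shows "cmap \<phi> (lincomb c b n) = lincomb (\<lambda>i. \<phi> (c i)) (\<lambda>i. cmap \<phi> (b i)) n"
proof -
  note P = subring_polys[OF R, of V] and hm = hom_on_map[OF R h, of V]
  have "cmap \<phi> (lincomb c b n) = (\<Sum>i<n. cmap \<phi> (Const (c i) * b i))"
    unfolding lincomb_def
    by (rule hom_on_sum[OF hm P]) (use b c in \<open>auto intro!: polys_mult[OF R] Const_in_polys[OF R]\<close>)
  also have "\<dots> = (\<Sum>i<n. Const (\<phi> (c i)) * cmap \<phi> (b i))"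
    by (rule sum.cong)
      (use b c hom_onD(1)[OF h] in \<open>auto simp: hom_onD(4)[OF hm] Const_in_polys[OF R]\<close>)
  finally show ?thesis by (simp add: lincomb_def)
qed

definition monomial_extension ::
  "(('v \<Rightarrow>\<^sub>0 nat) \<Rightarrow> 's) \<Rightarrow> ('v, 's::comm_ring_1) mpoly \<Rightarrow> 's" where
  "monomial_extension l p = (\<Sum>m\<in>ks p. lk p m * l m)"

lemma monomial_extension_superset:
  "finite A \<Longrightarrow> ks p \<subseteq> A \<Longrightarrow> monomial_extension l p = (\<Sum>m\<in>A. lk p m * l m)"
  unfolding monomial_extension_def by (rule sum.mono_neutral_left) (auto simp: in_keys_iff)

lemma monomial_extension_add:
  "monomial_extension l (p + q) = monomial_extension l p + monomial_extension l q"
  using keys_add[of p q]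
  by (simp add: monomial_extension_superset[where A="ks p \<union> ks q"] lookup_add distrib_right sum.distrib)

lemma monomial_extension_zero [simp]: "monomial_extension l 0 = 0"
  by (simp add: monomial_extension_def)

lemma monomial_extension_single: "monomial_extension l (mterm m s) = s * l m"
  by (subst monomial_extension_superset[of "{m}"]) auto

lemma monomial_extension_Const_mult:
  "monomial_extension l (Const s * p) = s * monomial_extension l p"
proof -
  have "p \<in> polys UNIV UNIV" by (simp add: polys_iff)
  with subring_on_UNIV show ?thesis
    by (induction rule: polys_induct)
      (simp_all add: distrib_left monomial_extension_add mult_single monomial_extension_single mult.assoc)
qed

lemma monomial_extension_sum:
  "monomial_extension l (sum f A) = (\<Sum>i\<in>A. monomial_extension l (f i))"
  by (induction A rule: infinite_finite_induct) (simp_all add: monomial_extension_add)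

text \<open>Suppose that \<open>\<phi>\<close> makes \<open>g\<close> invertible with inverse \<open>e\<close>. If the \<open>b\<^sub>i\<close> are a basis over the basic open
  set of \<open>g\<close>, their images are a basis after base change along \<open>\<phi>\<close>. Spanning is inherited monomial by
  monomial. For independence, the coordinates \<open>c\<^sub>i/g\<^sup>N\<close> of a polynomial of degree \<open>a\<close>, pushed forward
  to \<open>e\<^sup>N \<phi>(c\<^sub>i)\<close>, are well defined by independence of the \<open>b\<^sub>i\<close>. Prescribing these values on the
  monomials of degree \<open>a\<close> (and 0 on all others) gives linear functionals on the polynomials over the new ring
  which vanish on the base change of \<open>K\<close> and take the values \<open>\<delta>\<^sub>i\<^sub>j\<close> on the images of the \<open>b\<^sub>j\<close>.\<close>

lemma base_change_free:
  fixes \<phi> :: "'r::comm_ring_1 \<Rightarrow> 's::comm_ring_1" and K :: "('v, 'r) mpoly set" and n :: nat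
  assumes R: "subring_on R" and h: "hom_on R \<phi>" and K: "homogeneous_ideal R V d K"
    and g: "g \<in> R" "\<phi> g * e = 1"
    and free: "free_on_basic_open (ring_on R) (graded_quot R V d K a) g n"
  defines "K' \<equiv> base_change UNIV V \<phi> K"
  shows "\<exists>b. (\<forall>i<n. b i \<in> poly_piece UNIV V d a) \<and>
             (\<forall>y\<in>poly_piece UNIV V d a. \<exists>c. y - lincomb c b n \<in> K') \<and>
             (\<forall>c. lincomb c b n \<in> K' \<longrightarrow> (\<forall>i<n. c i = 0))"
proof -
  note KD = homogeneous_idealD[OF R K]
  note P = subring_polys[OF R, of V] and S = subring_on_UNIV[where 'a='s]
  note PS = subring_polys[OF S, of V] and hm = hom_on_map[OF R h, of V]
  let ?m = "cmap \<phi>"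
  have mK: "?m ` K \<subseteq> polys UNIV V"
    using map_in_polys[where \<phi>=\<phi> and R=R and S=UNIV and V=V, OF subset_UNIV hom_onD(1)[OF h]] ideal_onD(1)[OF KD(1)] by blast
  note K' = Idl_facts[OF PS mK, folded base_change_def, folded K'_def]
  have mKK': "?m x \<in> K'" if "x \<in> K" for x using K'(2) that by blast
  have eN: "e ^ N * \<phi> (g ^ N) = 1" for N
  proof -
    have "e ^ N * \<phi> (g ^ N) = (\<phi> g * e) ^ N"
      by (simp only: hom_on_power[OF h R g(1)] power_mult_distrib mult.commute)
    then show ?thesis by (simp add: g(2))
  qed
  from free obtain b where b: "\<And>i. i < n \<Longrightarrow> b i \<in> poly_piece R V d a"
    and sp: "\<And>x. x \<in> poly_piece R V d a \<Longrightarrow> \<exists>N. \<exists>c\<in>{..<n} \<rightarrow> R. Const (g ^ N) * x - lincomb c b n \<in> K"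
    and ind: "\<And>c. c \<in> {..<n} \<rightarrow> R \<Longrightarrow> lincomb c b n \<in> K \<Longrightarrow> \<exists>N. \<forall>i<n. g ^ N * c i = 0"
    unfolding free_on_basic_open_iff[OF R KD(1) g(1)] by blast
  have bP: "b i \<in> polys R V" if "i < n" for i using b[OF that] by (simp add: poly_piece_iff)
  have zero_if: "\<phi> (c i) = 0" if c: "c \<in> {..<n} \<rightarrow> R" "lincomb c b n \<in> K" "i < n" for c i
  proof -
    obtain N where "g ^ N * c i = 0" using ind[OF c(1,2)] c(3) by blast
    then have "\<phi> (g ^ N) * \<phi> (c i) = 0"
      using hom_onD(1,4)[OF h] subring_onD(7)[OF R g(1)] c by (metis PiE lessThan_iff)
    then have "e ^ N * (\<phi> (g ^ N) * \<phi> (c i)) = 0" by simp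
    then show ?thesis using eN[of N] by (simp add: mult.assoc[symmetric])
  qed
  define rel where "rel x N c \<longleftrightarrow> c \<in> {..<n} \<rightarrow> R \<and> Const (g ^ N) * x - lincomb c b n \<in> K" for x N c
  have gR: "g ^ N \<in> R" for N by (rule subring_onD(7)[OF R g(1)])
  have uniq: "e ^ N * \<phi> (c i) = e ^ N' * \<phi> (c' i)" if 1: "rel x N c" and 2: "rel x N' c'" and i: "i < n" for x N N' c c' i
  proof -
    have c: "c j \<in> R" "c' j \<in> R" if "j < n" for j using 1 2 that by (auto simp: rel_def)
    have "Const (g ^ N') * (Const (g ^ N) * x - lincomb c b n) \<in> K"
      "Const (g ^ N) * (Const (g ^ N') * x - lincomb c' b n) \<in> K"
      using 1 2 ideal_onD(4)[OF KD(1) Const_in_polys[OF R gR]] by (simp_all only: rel_def)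
    then have "Const (g ^ N) * (Const (g ^ N') * x - lincomb c' b n)
        - Const (g ^ N') * (Const (g ^ N) * x - lincomb c b n) \<in> K"
      by (rule ideal_on_diff[OF KD(1) P, rotated])
    also have "Const (g ^ N) * (Const (g ^ N') * x - lincomb c' b n)
        - Const (g ^ N') * (Const (g ^ N) * x - lincomb c b n)
        = lincomb (\<lambda>i. g ^ N' * c i - g ^ N * c' i) b n"
      unfolding lincomb_linear(3)[symmetric] lincomb_linear(1)[symmetric]
      by (simp add: algebra_simps)
    finally have "\<phi> (g ^ N' * c i - g ^ N * c' i) = 0"
      by (intro zero_if[OF _ _ i]) (use c gR in \<open>auto intro!: subring_onD(5,6)[OF R]\<close>)
    then have eq: "\<phi> (g ^ N') * \<phi> (c i) = \<phi> (g ^ N) * \<phi> (c' i)"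
      using c[OF i] gR by (simp add: hom_on_diff[OF h R] hom_onD(4)[OF h] subring_onD(5)[OF R])
    have "e ^ N * \<phi> (c i) = e ^ N * (e ^ N' * \<phi> (g ^ N')) * \<phi> (c i)" by (simp add: eN)
    also have "\<dots> = e ^ N * e ^ N' * (\<phi> (g ^ N') * \<phi> (c i))" by (simp only: mult_ac)
    also have "\<dots> = e ^ N * e ^ N' * (\<phi> (g ^ N) * \<phi> (c' i))" by (simp only: eq)
    also have "\<dots> = (e ^ N * \<phi> (g ^ N)) * (e ^ N' * \<phi> (c' i))" by (simp only: mult_ac)
    finally show ?thesis by (simp add: eN)
  qed
  \<comment> \<open>The pushed forward coordinates of a polynomial of degree \<open>a\<close>, and their linear extension
    from monomials.\<close>
  define lam where "lam x i = (SOME v. \<exists>N c. rel x N c \<and> v = e ^ N * \<phi> (c i))" for x i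
  have lam: "lam x i = e ^ N * \<phi> (c i)" if "rel x N c" "i < n" for x N c i
  proof -
    have "\<exists>N c. rel x N c \<and> lam x i = e ^ N * \<phi> (c i)"
      unfolding lam_def by (rule someI_ex) (use that in blast)
    then obtain N' c' where "rel x N' c'" "lam x i = e ^ N' * \<phi> (c' i)" by blast
    then show ?thesis using uniq[OF _ that] by simp
  qed
  define l where "l i m = (if ks m \<subseteq> V \<and> mdeg d m = a then lam (mterm m 1) i else 0)" for i m
  define Lam where "Lam i = monomial_extension (l i)" for i
  have Lam_map: "Lam i (?m x) = e ^ N * \<phi> (c i)"
    if "x \<in> poly_piece R V d a" and rel: "rel x N c" and i: "i < n" for x N c i
  proof -
    have "\<exists>N c. rel (\<Sum>m\<in>A. mterm m (lk x m)) N c \<and>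
        Lam i (?m (\<Sum>m\<in>A. mterm m (lk x m))) = e ^ N * \<phi> (c i)"
      if "finite A" "A \<subseteq> ks x" for A
      using that
    proof (induction A rule: finite_induct)
      case empty
      have "rel 0 0 (\<lambda>i. 0)"
        using subring_onD(1)[OF R] ideal_onD(2)[OF KD(1)] by (simp add: rel_def lincomb_0)
      then show ?case
        by (intro exI[of _ 0] exI[of _ "\<lambda>i. 0"]) (simp add: Lam_def map_zero hom_onD(1)[OF h])
    next
      case (insert m A)
      let ?s = "\<Sum>m\<in>A. mterm m (lk x m)" and ?r = "lk x m"
      have m: "?r \<in> R" "ks m \<subseteq> V" "mdeg d m = a" "mterm m 1 \<in> poly_piece R V d a"
        using \<open>x \<in> poly_piece R V d a\<close> insert.prems subring_onD(2)[OF R]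
        by (auto simp: poly_piece_iff polys_iff homog_def lookup_single when_def subring_onD(1)[OF R])
      obtain N c where 1: "rel ?s N c" "Lam i (?m ?s) = e ^ N * \<phi> (c i)" using insert by blast
      obtain N' c' where 2: "rel (mterm m 1) N' c'"
        using sp[OF m(4)] by (auto simp: rel_def)
      have c: "c j \<in> R" "c' j \<in> R" if "j < n" for j using 1 2 that by (auto simp: rel_def)
      define c'' where "c'' j = g ^ N' * c j + g ^ N * ?r * c' j" for j
      have c'': "c'' j \<in> R" if "j < n" for j
        using c[OF that] gR m(1) by (auto simp: c''_def intro!: subring_onD(4,5)[OF R])
      have sing: "mterm m ?r = Const ?r * mterm m 1"
        by (simp add: mult_single)
      have "Const (g ^ N') * (Const (g ^ N) * ?s - lincomb c b n)
          + Const (g ^ N * ?r) * (Const (g ^ N') * mterm m 1 - lincomb c' b n) \<in> K"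
        using 1 2 gR m(1)
        by (intro ideal_onD(3,4)[OF KD(1)] Const_in_polys[OF R] subring_onD(5)[OF R]) (auto simp: rel_def)
      also have "Const (g ^ N') * (Const (g ^ N) * ?s - lincomb c b n)
          + Const (g ^ N * ?r) * (Const (g ^ N') * mterm m 1 - lincomb c' b n)
        = Const (g ^ (N + N')) * (mterm m ?r + ?s) - lincomb c'' b n"
        unfolding sing c''_def lincomb_linear(2)[symmetric] lincomb_linear(1)[symmetric]
          power_add Const_mult
        by (simp only: algebra_simps)
      finally have rel'': "rel (mterm m ?r + ?s) (N + N') c''"
        using c'' by (auto simp: rel_def)
      have inP: "mterm m ?r \<in> polys R V" "?s \<in> polys R V"
        using m single_in_polys[OF R] insert.prems \<open>x \<in> poly_piece R V d a\<close>
        by (auto simp: poly_piece_iff polys_iff[of x] intro!: subring_on_sum[OF P] single_in_polys[OF R])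
      have "Lam i (?m (mterm m ?r + ?s)) = Lam i (?m (mterm m ?r)) + Lam i (?m ?s)"
        by (simp only: hom_onD(3)[OF hm inP] Lam_def monomial_extension_add)
      also have "Lam i (?m (mterm m ?r)) = \<phi> ?r * (e ^ N' * \<phi> (c' i))"
        using m(2,3) lam[OF 2 i] hom_onD(1)[OF h]
        by (simp add: Lam_def monomial_extension_single l_def)
      also have "\<phi> ?r * (e ^ N' * \<phi> (c' i)) + Lam i (?m ?s) = e ^ (N + N') * \<phi> (c'' i)"
      proof -
        have "\<phi> (c'' i) = \<phi> (g ^ N') * \<phi> (c i) + \<phi> (g ^ N) * \<phi> ?r * \<phi> (c' i)"
          using c[OF i] gR m(1)
          by (simp add: c''_def hom_onD(3,4)[OF h] subring_onD(5)[OF R])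
        then have "e ^ (N + N') * \<phi> (c'' i) = e ^ N * (e ^ N' * \<phi> (g ^ N')) * \<phi> (c i)
           + (e ^ N * \<phi> (g ^ N)) * e ^ N' * \<phi> ?r * \<phi> (c' i)"
          by (simp add: power_add algebra_simps)
        then show ?thesis by (simp add: eN 1(2) algebra_simps)
      qed
      finally show ?case
        using rel'' insert.hyps by (intro exI[of _ "N + N'"] exI[of _ c'']) simp
    qed
    from this[of "ks x"] polys_sum_single[of x] obtain N' c'
      where "rel x N' c'" "Lam i (?m x) = e ^ N' * \<phi> (c' i)" by auto
    then show ?thesis using uniq[OF _ rel i] by metis
  qed
  have Lam_component: "Lam i p = Lam i (component d a p)" if "p \<in> polys UNIV V" for i p
    using S that
    by (induction rule: polys_induct)
      (auto simp: Lam_def component_add monomial_extension_add monomial_extension_single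
        component_homog[OF homog_single] l_def)
  have Lam_K: "Lam i (?m k) = 0" if k: "k \<in> K" and i: "i < n" for k i
  proof -
    have kP: "k \<in> polys R V" using ideal_onD(1)[OF KD(1) k] .
    have k': "component d a k \<in> K" "component d a k \<in> poly_piece R V d a"
      using KD(2)[OF k] component_in_polys[OF R kP] homog_component by (auto simp: poly_piece_iff)
    have "rel (component d a k) 0 (\<lambda>i. 0)"
      using k' subring_onD(1)[OF R] by (simp add: rel_def lincomb_0)
    from Lam_map[OF k'(2) this i] have "Lam i (?m (component d a k)) = 0"
      by (simp add: hom_onD(1)[OF h])
    then show ?thesis
      using Lam_component[of "?m k" i] mK k by (auto simp: component_map hom_onD(1)[OF h])
  qed
  \<comment> \<open>Quantifying over the multiples makes the right-hand side an ideal, so that only the generators of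
    the base change have to be checked.\<close>
  have "K' \<subseteq> {q \<in> polys UNIV V. \<forall>r\<in>polys UNIV V. \<forall>i<n. Lam i (r * q) = 0}" (is "_ \<subseteq> ?L")
  proof (rule K'(3))
    show "ideal_on (polys UNIV V) ?L"
      unfolding ideal_on_def
    proof (intro conjI ballI)
      fix r x :: "('v, 's) mpoly" assume r: "r \<in> polys UNIV V" and x: "x \<in> ?L"
      have "Lam i (s * (r * x)) = 0" if "s \<in> polys UNIV V" "i < n" for s :: "('v, 's) mpoly" and i
        using x polys_mult[OF S that(1) r] that by (simp add: mult.assoc[symmetric])
      then show "r * x \<in> ?L" using x polys_mult[OF S r] by simp
    qed (auto simp: Lam_def distrib_left monomial_extension_add polys_zero polys_add)
    show "?m ` K \<subseteq> ?L"
    proof (intro image_subsetI CollectI conjI ballI allI impI)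
      fix k assume k: "k \<in> K"
      then show "?m k \<in> polys UNIV V" using mK by blast
      have kP: "k \<in> polys R V" using ideal_onD(1)[OF KD(1) k] .
      fix r :: "('v, 's) mpoly" and i assume r: "r \<in> polys UNIV V" and i: "i < n"
      from S r show "Lam i (r * ?m k) = 0"
      proof (induction rule: polys_induct)
        case (single m s)
        have m1: "mterm m 1 \<in> polys R V"
          using single subring_onD(2)[OF R] by (rule_tac single_in_polys[OF R])
        have "mterm m s * ?m k = Const s * (mterm m 1 * ?m k)"
          by (simp add: mult.assoc[symmetric] mult_single)
        also have "mterm m 1 * ?m k = ?m (mterm m 1 * k)"
          using hom_onD(4)[OF hm m1 kP] hom_onD(1,2)[OF h] by simp
        finally show ?case
          using Lam_K[OF ideal_onD(4)[OF KD(1) m1 k] i]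
          by (simp add: Lam_def monomial_extension_Const_mult)
      qed (simp_all add: Lam_def distrib_right monomial_extension_add)
    qed
  qed
  then have Lam_K': "Lam i q = 0" if "q \<in> K'" "i < n" for q i
    using that subring_onD(2)[OF PS] by fastforce
  have mb: "?m (b i) \<in> poly_piece UNIV V d a" if "i < n" for i
    using b[OF that] map_in_polys[where \<phi>=\<phi> and R=R and S=UNIV and V=V, OF subset_UNIV hom_onD(1)[OF h]]
    by (auto simp: poly_piece_iff homog_map)
  have Lam_b: "Lam j (?m (b i)) = (if j = i then 1 else 0)" if "i < n" "j < n" for i j
  proof -
    have "rel (b i) 0 (\<lambda>j. if j = i then 1 else 0)"
      using subring_onD(1,2)[OF R] ideal_onD(2)[OF KD(1)] by (auto simp: rel_def lincomb_delta[OF that(1)])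
    from Lam_map[OF b[OF that(1)] this that(2)] show ?thesis by (simp add: hom_onD(1,2)[OF h])
  qed
  have span: "\<exists>c. y - lincomb c (\<lambda>i. ?m (b i)) n \<in> K'" if y: "y \<in> poly_piece UNIV V d a" for y
  proof -
    have "\<exists>c. (\<Sum>m\<in>A. mterm m (lk y m)) - lincomb c (\<lambda>i. ?m (b i)) n \<in> K'"
      if "finite A" "A \<subseteq> ks y" for A
      using that
    proof (induction A rule: finite_induct)
      case empty
      then show ?case using ideal_onD(2)[OF K'(1)] by (intro exI[of _ "\<lambda>i. 0"]) (simp add: lincomb_0)
    next
      case (insert m A)
      then obtain c where c: "(\<Sum>m\<in>A. mterm m (lk y m)) - lincomb c (\<lambda>i. ?m (b i)) n \<in> K'" by blast
      have m: "mterm m 1 \<in> poly_piece R V d a"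
        using y insert.prems subring_onD(2)[OF R]
        by (auto simp: poly_piece_iff polys_iff homog_def lookup_single when_def subring_onD(1)[OF R])
      obtain N c' where 2: "rel (mterm m 1) N c'"
        using sp[OF m] by (auto simp: rel_def)
      have c': "c' j \<in> R" if "j < n" for j using 2 that by (auto simp: rel_def)
      let ?x = "Const (g ^ N) * mterm m (1::'r)"
      have x: "?x \<in> polys R V" using poly_piece_closed(3)[OF R gR m] by (auto simp: poly_piece_iff)
      have sP: "lincomb c' b n \<in> polys R V" unfolding lincomb_def
        by (rule subring_on_sum[OF P]) (use c' bP in \<open>auto intro!: polys_mult[OF R] Const_in_polys[OF R]\<close>)
      have "?m (?x - lincomb c' b n) \<in> K'" using 2 mKK' by (auto simp: rel_def)
      moreover have "?m (?x - lincomb c' b n) = Const (\<phi> (g ^ N)) * mterm m 1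
          - lincomb (\<lambda>i. \<phi> (c' i)) (\<lambda>i. ?m (b i)) n"
      proof -
        have "?m ?x = Const (\<phi> (g ^ N)) * mterm m 1"
          using hom_onD(1)[OF h] by (simp add: mult_single)
        then show ?thesis by (simp only: hom_on_diff[OF hm P x sP] map_lincomb[OF R h c' bP])
      qed
      ultimately have "Const (lk y m * e ^ N) * (Const (\<phi> (g ^ N)) * mterm m 1
          - lincomb (\<lambda>i. \<phi> (c' i)) (\<lambda>i. ?m (b i)) n) \<in> K'"
        by (metis ideal_onD(4)[OF K'(1)] Const_in_polys[OF S] UNIV_I)
      from ideal_onD(3)[OF K'(1) this c]
      have "Const (lk y m * e ^ N) * (Const (\<phi> (g ^ N)) * mterm m 1
          - lincomb (\<lambda>i. \<phi> (c' i)) (\<lambda>i. ?m (b i)) n)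
          + ((\<Sum>m\<in>A. mterm m (lk y m)) - lincomb c (\<lambda>i. ?m (b i)) n) \<in> K'" .
      also have "Const (lk y m * e ^ N) * (Const (\<phi> (g ^ N)) * mterm m 1
          - lincomb (\<lambda>i. \<phi> (c' i)) (\<lambda>i. ?m (b i)) n)
          + ((\<Sum>m\<in>A. mterm m (lk y m)) - lincomb c (\<lambda>i. ?m (b i)) n)
        = Const (lk y m * e ^ N * \<phi> (g ^ N)) * mterm m 1
          + (\<Sum>m\<in>A. mterm m (lk y m))
          - lincomb (\<lambda>i. lk y m * e ^ N * \<phi> (c' i) + c i) (\<lambda>i. ?m (b i)) n"
        unfolding lincomb_linear(2)[symmetric] lincomb_linear(1)[symmetric]
          Const_mult
        by (simp only: algebra_simps)
      also have "Const (lk y m * e ^ N * \<phi> (g ^ N)) * mterm m 1 = mterm m (lk y m)"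
        by (simp add: mult.assoc eN mult_single)
      finally show ?case
        using insert.hyps by (intro exI[of _ "\<lambda>i. lk y m * e ^ N * \<phi> (c' i) + c i"]) simp
    qed
    from this[of "ks y"] polys_sum_single[of y] show ?thesis by simp
  qed
  have "c j = 0" if "lincomb c (\<lambda>i. ?m (b i)) n \<in> K'" "j < n" for c j
  proof -
    have "0 = Lam j (lincomb c (\<lambda>i. ?m (b i)) n)" using Lam_K'[OF that] by simp
    also have "\<dots> = (\<Sum>i<n. c i * Lam j (?m (b i)))"
      by (simp add: Lam_def lincomb_def monomial_extension_sum monomial_extension_Const_mult)
    also have "\<dots> = (\<Sum>i<n. if i = j then c i else 0)"
      by (rule sum.cong) (use Lam_b that in auto)
    finally show ?thesis using that by simp
  qed
  then show ?thesis using mb span by (intro exI[of _ "\<lambda>i. ?m (b i)"]) blast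
qed

lemma locally_free_of_free:
  fixes K :: "('v, 's::comm_ring_1) mpoly set"
  assumes K: "ideal_on (polys UNIV V) K"
    and b: "\<forall>i<n. b i \<in> poly_piece UNIV V d a"
      "\<forall>y\<in>poly_piece UNIV V d a. \<exists>c. y - lincomb c b n \<in> K"
      "\<forall>c. lincomb c b n \<in> K \<longrightarrow> (\<forall>i<n. c i = 0)"
  shows "locally_free_of_rank (ring_on UNIV) (graded_quot UNIV V d K a) n"
proof -
  note S = subring_on_UNIV[where 'a='s]
  interpret cring "ring_on (UNIV :: 's set)" by (rule cring_ring_on[OF S])
  have "Idl\<^bsub>ring_on (UNIV :: 's set)\<^esub> {1} = UNIV" using genideal_one by simp
  moreover have "free_on_basic_open (ring_on UNIV) (graded_quot UNIV V d K a) 1 n"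
    unfolding free_on_basic_open_iff[OF S K UNIV_I]
    by (rule exI[of _ b]) (use b in auto)
  ultimately show ?thesis
    unfolding locally_free_of_rank_def by (intro exI[of _ "{1}"]) simp
qed

text \<open>Otherwise the preimage of \<open>L\<close> would be a proper ideal containing \<open>G\<close>. For local rings and their
  maximal ideal \<open>L\<close>, some element of \<open>G\<close> becomes invertible.\<close>

lemma exists_unit_generator:
  assumes R: "subring_on R" and h: "hom_on R \<phi>" and L: "ideal_on UNIV L" "1 \<notin> L"
    and G: "G \<subseteq> R" "Idl\<^bsub>ring_on R\<^esub> G = R"
  shows "\<exists>g\<in>G. \<phi> g \<notin> L"
proof (rule ccontr)
  assume "\<not> ?thesis"
  then have "R \<subseteq> {x \<in> R. \<phi> x \<in> L}"
    using Idl_facts(3)[OF R G(1) hom_on_vimage_ideal[OF h R L(1) subset_UNIV]] G by auto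
  then show False using subring_onD(2)[OF R] hom_onD(2)[OF h] L(2) by auto
qed

section \<open>Coefficients of degree at most one\<close>

lemma single_one_iff:
  "mterm x (1::nat) = mterm u 1 \<longleftrightarrow> x = u"
  "mterm x (1::nat) \<noteq> 0"
proof -
  have k: "ks (mterm x (1::nat)) = {x}" for x :: 'a by simp
  show "mterm x (1::nat) = mterm u 1 \<longleftrightarrow> x = u"
    using k[of x] k[of u] by (metis singleton_insert_inj_eq)
  show "mterm x (1::nat) \<noteq> 0"
    using k[of x] by (metis keys_zero insert_not_empty)
qed

lemma monomial_add_eq_single:
  fixes m m' :: "'v \<Rightarrow>\<^sub>0 nat"
  shows "m + m' = mterm u 1 \<longleftrightarrow>
    m = 0 \<and> m' = mterm u 1 \<or> m = mterm u 1 \<and> m' = 0"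
proof
  assume eq: "m + m' = mterm u 1"
  have v: "lk m v + lk m' v = (if v = u then 1 else 0)" for v
    using arg_cong[OF eq, of "\<lambda>x. lk x v"] by (auto simp: lookup_add lookup_single when_def)
  show "m = 0 \<and> m' = mterm u 1 \<or> m = mterm u 1 \<and> m' = 0"
  proof (cases "lk m u = 0")
    case True
    then have "m = 0" using v by (intro poly_mapping_eqI) (metis add_is_0 lookup_zero)
    then show ?thesis using eq by simp
  next
    case False
    then have "m' = 0" using v by (intro poly_mapping_eqI) (metis add_is_0 add_is_1 lookup_zero One_nat_def)
    then show ?thesis using eq by simp
  qed
qed auto

lemma monomial_add_eq_zero: "m + m' = (0 :: 'v \<Rightarrow>\<^sub>0 nat) \<longleftrightarrow> m = 0 \<and> m' = 0"
  by (metis add.right_neutral add_is_0 lookup_add lookup_zero poly_mapping_eqI)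

text \<open>The truncation of a polynomial to first order in one variable is multiplicative.\<close>

lemma lookup_mult_zero_single:
  fixes p q :: "('v, 'r::comm_ring_1) mpoly"
  shows "lk (p * q) 0 = lk p 0 * lk q 0"
    "lk (p * q) (mterm u 1) = lk p 0 * lk q (mterm u 1) + lk p (mterm u 1) * lk q 0"
proof -
  have "lk (p * q) 0 = lk p 0 * lk q 0 \<and>
    lk (p * q) (mterm u 1) = lk p 0 * lk q (mterm u 1) + lk p (mterm u 1) * lk q 0"
  proof -
    have "p \<in> polys UNIV UNIV" by (simp add: polys_iff)
    with subring_on_UNIV show ?thesis
    proof (induction rule: polys_induct)
      case (single m a)
      have "q \<in> polys UNIV UNIV" by (simp add: polys_iff)
      with subring_on_UNIV show ?case
      proof (induction rule: polys_induct)
        case (single m' a')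
        show ?case
          by (auto simp: single_one_iff mult_single lookup_single when_def monomial_add_eq_single monomial_add_eq_zero)
      qed (simp_all add: lookup_add distrib_left)
    qed (simp_all add: lookup_add distrib_right)
  qed
  then show "lk (p * q) 0 = lk p 0 * lk q 0"
    "lk (p * q) (mterm u 1) = lk p 0 * lk q (mterm u 1) + lk p (mterm u 1) * lk q 0"
    by auto
qed

section \<open>Restriction to \<open>\<k>[X]\<close> and the coefficients \<open>g\<^sub>u\<close>\<close>

lemma hom_on_id: "hom_on R (\<lambda>c. c)"
  by (simp add: hom_on_def)

lemma hom_on_restrict_poly: "hom_on UNIV (restrict_poly BX)"
  unfolding restrict_poly_def by (rule hom_on_subst_poly[OF hom_on_id])

lemmas restrict_poly_simps = hom_onD(1)[OF hom_on_restrict_poly] hom_onD(2)[OF hom_on_restrict_poly]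
  hom_onD(3)[OF hom_on_restrict_poly UNIV_I UNIV_I] hom_onD(4)[OF hom_on_restrict_poly UNIV_I UNIV_I]
  hom_on_diff[OF hom_on_restrict_poly subring_on_UNIV UNIV_I UNIV_I]

lemma restrict_poly_Var: "restrict_poly BX (Var v) = bar BX v"
  by (simp add: restrict_poly_def subst_poly_Var hom_on_id)

lemma bar_in_polys: "subring_on R \<Longrightarrow> bar BX v \<in> polys R BX"
  by (simp add: bar_def Var_in_polys polys_zero)

lemma restrict_poly_in_polys: "p \<in> polys UNIV V \<Longrightarrow> restrict_poly BX p \<in> polys UNIV BX"
  unfolding restrict_poly_def
  by (rule subst_poly_in_polys[OF subring_on_UNIV hom_on_id]) (auto intro: bar_in_polys)

lemma restrict_poly_single:
  "restrict_poly BX (mterm m c) = (if ks m \<subseteq> BX then mterm m c else 0)"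
proof -
  have "monom_value (bar BX) m = (if ks m \<subseteq> BX then mterm m 1 else (0 :: ('a, 'b) mpoly))"
    using subset_UNIV
  proof (induction m rule: monomial_induct)
    case (add m v)
    have "monom_value (bar BX) (mterm v 1) = (bar BX v :: ('a, 'b) mpoly)"
      by (simp add: monom_value_def)
    then have eq: "monom_value (bar BX) (m + mterm v 1)
        = (if ks m \<subseteq> BX then mterm m 1 else 0) * (bar BX v :: ('a, 'b) mpoly)"
      by (simp only: monom_value_add add.IH)
    show ?case unfolding eq by (simp add: keys_add_nat bar_def mult_single)
  qed (simp add: monom_value_def)
  then show ?thesis by (simp add: restrict_poly_def subst_poly_single mult_single)
qed

lemma restrict_poly_id: "p \<in> polys UNIV BX \<Longrightarrow> restrict_poly BX p = p"
  using subring_on_UNIV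
proof (induction rule: polys_induct)
  case (add p q)
  then show ?case by (simp add: restrict_poly_simps)
qed (auto simp: restrict_poly_single restrict_poly_simps)

lemma ideal_on_restrict_image:
  fixes J :: "('y, 'k::comm_ring_1) mpoly set"
  assumes J: "ideal_on (polys UNIV (BX \<union> BU)) J"
  shows "ideal_on (polys UNIV BX) (restrict_poly BX ` J)"
  unfolding ideal_on_def
proof (intro conjI ballI)
  show "restrict_poly BX ` J \<subseteq> polys UNIV BX"
    using ideal_onD(1)[OF J] restrict_poly_in_polys by blast
  show "0 \<in> restrict_poly BX ` J"
    using ideal_onD(2)[OF J] restrict_poly_simps(1)[symmetric] by (rule image_eqI[rotated])
next
  fix x y assume "x \<in> restrict_poly BX ` J" "y \<in> restrict_poly BX ` J"
  then obtain p q where "p \<in> J" "q \<in> J" "x = restrict_poly BX p" "y = restrict_poly BX q" by blast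
  then show "x + y \<in> restrict_poly BX ` J"
    using ideal_onD(3)[OF J, of p q] by (metis image_eqI restrict_poly_simps(3))
next
  fix r x :: "('y, 'k) mpoly" assume r: "r \<in> polys UNIV BX" and "x \<in> restrict_poly BX ` J"
  then obtain p where p: "p \<in> J" "x = restrict_poly BX p" by blast
  have "r \<in> polys UNIV (BX \<union> BU)" using r polys_mono[OF order_refl Un_upper1] by blast
  then have "r * p \<in> J" using ideal_onD(4)[OF J] p by blast
  moreover have "restrict_poly BX (r * p) = r * x"
    using p restrict_poly_id[OF r] by (simp add: restrict_poly_simps)
  ultimately show "r * x \<in> restrict_poly BX ` J" by (metis image_eqI)
qed

lemma lookup_u_coeff:
  assumes "u \<in> BU"
  shows "lk (u_coeff BU u g) m = (if ks m \<inter> BU = {} then lk g (m + mterm u 1) else 0)"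
proof -
  let ?S = "{m \<in> ks g. ks m \<inter> BU = {u} \<and> lk m u = 1}"
  have iff: "m' - mterm u 1 = m \<longleftrightarrow> m' = m + mterm u 1" if "m' \<in> ?S" for m'
  proof
    assume "m' - mterm u 1 = m"
    then show "m' = m + mterm u 1"
      using that by (intro poly_mapping_eqI) (auto simp: lookup_add lookup_minus lookup_single when_def)
  qed simp
  have mem: "m + mterm u 1 \<in> ?S \<longleftrightarrow> m + mterm u 1 \<in> ks g \<and> ks m \<inter> BU = {}"
    using assms by (auto simp: keys_add_nat lookup_add in_keys_iff)
  have "lk (u_coeff BU u g) m = (\<Sum>m'\<in>?S. if m' = m + mterm u 1 then lk g m' else 0)"
    unfolding u_coeff_def lookup_sum
    by (rule sum.cong) (auto simp: lookup_single when_def iff[symmetric])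
  also have "\<dots> = (if m + mterm u 1 \<in> ?S then lk g (m + mterm u 1) else 0)"
    by simp
  finally show ?thesis unfolding mem by (auto simp: in_keys_iff)
qed

lemma u_coeff_add: "u \<in> BU \<Longrightarrow> u_coeff BU u (p + q) = u_coeff BU u p + u_coeff BU u q"
  by (rule poly_mapping_eqI) (simp add: lookup_u_coeff lookup_add)

lemma u_coeff_diff: "u \<in> BU \<Longrightarrow> u_coeff BU u (p - q) = u_coeff BU u p - u_coeff BU u q"
  by (rule poly_mapping_eqI) (simp add: lookup_u_coeff lookup_minus)

lemma u_coeff_zero [simp]: "u_coeff BU u 0 = 0"
  by (simp add: u_coeff_def)

lemma u_coeff_single:
  "u_coeff BU u (mterm m c)
   = (if ks m \<inter> BU = {u} \<and> lk m u = 1 then mterm (m - mterm u 1) c else 0)"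
proof -
  have "{m' \<in> ks (mterm m c). ks m' \<inter> BU = {u} \<and> lk m' u = 1}
    = (if c \<noteq> 0 \<and> ks m \<inter> BU = {u} \<and> lk m u = 1 then {m} else {})" by auto
  then show ?thesis unfolding u_coeff_def by auto
qed

lemma u_coeff_in_polys:
  assumes "u \<in> BU" "BX \<inter> BU = {}" "p \<in> polys UNIV (BX \<union> BU)"
  shows "u_coeff BU u p \<in> polys UNIV BX"
proof -
  have "ks m \<subseteq> BX" if "m \<in> ks (u_coeff BU u p)" for m
  proof -
    have "ks m \<inter> BU = {}" "m + mterm u 1 \<in> ks p"
      using that by (auto simp: in_keys_iff lookup_u_coeff[OF assms(1)] split: if_splits)
    then have "ks m \<subseteq> BX \<union> BU" using assms(3) by (force simp: polys_iff keys_add_nat)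
    then show ?thesis using \<open>ks m \<inter> BU = {}\<close> by blast
  qed
  then show ?thesis by (simp add: polys_iff)
qed

text \<open>A polynomial is its restriction plus a combination of the \<open>u \<in> BU\<close>; the cofactors are not unique, but their
  restrictions are the coefficients \<open>g\<^sub>u\<close>. For a monomial that is divisible by some \<open>u\<close>, split off one
  such \<open>u\<close>.\<close>

lemma u_decomposition:
  fixes p :: "('y, 'k::field) mpoly"
  assumes fin: "finite BU" and dis: "BX \<inter> BU = {}" and p: "p \<in> polys UNIV (BX \<union> BU)"
  shows "\<exists>h. (\<forall>v. h v \<in> polys UNIV (BX \<union> BU)) \<and> p = restrict_poly BX p + (\<Sum>v\<in>BU. Var v * h v)
           \<and> (\<forall>v\<in>BU. restrict_poly BX (h v) = u_coeff BU v p)"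
  using subring_on_UNIV p
proof (induction rule: polys_induct)
  case zero
  then show ?case
    by (intro exI[of _ "\<lambda>v. 0"]) (simp add: restrict_poly_simps polys_zero)
next
  case (single m c)
  show ?case
  proof (cases "ks m \<inter> BU = {}")
    case True
    then have "ks m \<subseteq> BX" using single by blast
    then show ?thesis using True
      by (intro exI[of _ "\<lambda>v. 0"]) (simp add: restrict_poly_simps polys_zero restrict_poly_single u_coeff_single)
  next
    case False
    then obtain u where u: "u \<in> ks m" "u \<in> BU" by blast
    define m' where "m' = m - mterm u 1"
    have m: "m = m' + mterm u 1"
      unfolding m'_def using u
      by (intro poly_mapping_eqI) (auto simp: lookup_add lookup_minus lookup_single when_def in_keys_iff)
    have m'V: "ks m' \<subseteq> BX \<union> BU" using single(2) by (simp add: m keys_add_nat)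
    have r: "restrict_poly BX (mterm m c) = 0"
      using u dis by (auto simp: restrict_poly_single)
    have "restrict_poly BX (mterm m' c) = u_coeff BU u (mterm m c)"
    proof -
      have "ks m \<inter> BU = {u} \<and> lk m u = 1 \<longleftrightarrow> ks m' \<subseteq> BX"
      proof -
        have "lk m u = lk m' u + 1" by (simp add: m lookup_add)
        moreover have "lk m' u = 0 \<longleftrightarrow> u \<notin> ks m'" by (simp add: in_keys_iff)
        ultimately show ?thesis using m'V u dis by (auto simp: m keys_add_nat)
      qed
      then show ?thesis by (simp add: restrict_poly_single u_coeff_single m'_def)
    qed
    moreover have "u_coeff BU v (mterm m c) = 0" if "v \<in> BU" "v \<noteq> u" for v
      using u that by (auto simp: u_coeff_single)
    moreover have "mterm m c = Var u * mterm m' c"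
      by (simp add: mult_single m add.commute)
    moreover have "(\<Sum>v\<in>BU. Var v * (if v = u then mterm m' c else 0)) = Var u * mterm m' c"
      using u fin by (simp add: if_distrib[of "(*) _"] cong: if_cong)
    ultimately show ?thesis using m'V r
      by (intro exI[of _ "\<lambda>v. if v = u then mterm m' c else 0"])
        (auto simp: restrict_poly_simps polys_zero single_in_polys)
  qed
next
  case (add p q)
  then obtain h h' where h: "\<forall>v. h v \<in> polys UNIV (BX \<union> BU)" "p = restrict_poly BX p + (\<Sum>v\<in>BU. Var v * h v)"
     "\<forall>v\<in>BU. restrict_poly BX (h v) = u_coeff BU v p"
    and h': "\<forall>v. h' v \<in> polys UNIV (BX \<union> BU)" "q = restrict_poly BX q + (\<Sum>v\<in>BU. Var v * h' v)"
     "\<forall>v\<in>BU. restrict_poly BX (h' v) = u_coeff BU v q" by blast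
  have "p + q = (restrict_poly BX p + (\<Sum>v\<in>BU. Var v * h v)) + (restrict_poly BX q + (\<Sum>v\<in>BU. Var v * h' v))"
    using h(2) h'(2) by simp
  also have "\<dots> = restrict_poly BX (p + q) + (\<Sum>v\<in>BU. Var v * (h v + h' v))"
    by (simp add: restrict_poly_simps distrib_left sum.distrib)
  finally have "p + q = restrict_poly BX (p + q) + (\<Sum>v\<in>BU. Var v * (h v + h' v))" .
  moreover have "\<forall>v. h v + h' v \<in> polys UNIV (BX \<union> BU)"
    using h(1) h'(1) polys_add[OF subring_on_UNIV] by blast
  moreover have "\<forall>v\<in>BU. restrict_poly BX (h v + h' v) = u_coeff BU v (p + q)"
    using h(3) h'(3) by (auto simp: restrict_poly_simps u_coeff_add)
  ultimately show ?case by (intro exI[of _ "\<lambda>v. h v + h' v"]) blast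
qed

section \<open>Flatness and the map \<open>\<alpha>\<close>\<close>

text \<open>The homomorphism on the free abelian group with prescribed values on generators.\<close>

definition frag_eval :: "('x \<Rightarrow> 'b::comm_ring_1) \<Rightarrow> ('x \<Rightarrow>\<^sub>0 int) \<Rightarrow> 'b" where
  "frag_eval \<Phi> z = (\<Sum>k\<in>ks z. of_int (lk z k) * \<Phi> k)"

lemma frag_eval_superset:
  "finite A \<Longrightarrow> ks z \<subseteq> A \<Longrightarrow> frag_eval \<Phi> z = (\<Sum>k\<in>A. of_int (lk z k) * \<Phi> k)"
  unfolding frag_eval_def by (rule sum.mono_neutral_left) (auto simp: in_keys_iff)

lemma frag_eval_zero [simp]: "frag_eval \<Phi> 0 = 0"
  by (simp add: frag_eval_def)

lemma frag_eval_diff: "frag_eval \<Phi> (z - w) = frag_eval \<Phi> z - frag_eval \<Phi> w"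
  using keys_diff[of z w]
  by (simp add: frag_eval_superset[where A="ks z \<union> ks w"] lookup_minus left_diff_distrib sum_subtractf)

lemma frag_eval_add: "frag_eval \<Phi> (z + w) = frag_eval \<Phi> z + frag_eval \<Phi> w"
  using keys_add[of z w]
  by (simp add: frag_eval_superset[where A="ks z \<union> ks w"] lookup_add distrib_right sum.distrib)

lemma frag_eval_of [simp]: "frag_eval \<Phi> (frag_of k) = \<Phi> k"
  by (subst frag_eval_superset[of "{k}"]) auto

lemma frag_eval_sum: "frag_eval \<Phi> (sum f A) = (\<Sum>i\<in>A. frag_eval \<Phi> (f i))"
  by (induction A rule: infinite_finite_induct) (simp_all add: frag_eval_add)

lemma tensor_relations_add:
  assumes "z \<in> tensor_relations R N M" "w \<in> tensor_relations R N M"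
  shows "z + w \<in> tensor_relations R N M"
  using tensor_relations.diff[OF assms(1) tensor_relations.diff[OF tensor_relations.zero assms(2)]] by simp

lemma module_module_on:
  assumes P: "subring_on P" and K: "ideal_on P K"
  shows "Module.module (ring_on P) (module_on (*) K)"
proof (rule Module.moduleI[OF cring_ring_on[OF P]])
  show "abelian_group (module_on (*) K)"
  proof (rule abelian_groupI)
    fix x assume "x \<in> carrier (module_on (*) K)"
    then show "\<exists>y\<in>carrier (module_on (*) K). y \<oplus>\<^bsub>module_on (*) K\<^esub> x = \<zero>\<^bsub>module_on (*) K\<^esub>"
      using ideal_on_minus[OF K P] by (intro bexI[of _ "- x"]) auto
  qed (use ideal_onD[OF K] in \<open>auto simp: algebra_simps\<close>)
qed (use ideal_onD[OF K] in \<open>auto simp: algebra_simps\<close>)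

text \<open>Write \<open>g = \<Sum> u h\<^sub>u\<close> as \<open>u_decomposition\<close> allows, and let \<open>\<mm>\<close> be the ideal of \<open>\<k>[U]\<close> generated by the variables.
  The element \<open>\<Sum> u \<otimes> h\<^sub>u\<close> of \<open>\<mm> \<otimes> \<k>[Y]/J\<close> becomes \<open>1 \<otimes> g = 0\<close> in
  \<open>\<k>[U] \<otimes> \<k>[Y]/J\<close>, so by flatness it is zero. The map
  \<open>a \<otimes> p \<mapsto> a\<^sub>u \<cdot> p\<^sub>0 \<in> \<k>[X]/I\<close>, where \<open>a\<^sub>u\<close> is the coefficient of the variable \<open>u\<close> in \<open>a\<close> and \<open>p\<^sub>0\<close> the restriction of \<open>p\<close>,
  is balanced on \<open>\<mm>\<close> because elements of \<open>\<mm>\<close> have no constant term; it sends this element to the class of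
  \<open>g\<^sub>u\<close>.\<close>

lemma flat_u_coeff:
  fixes J :: "('y, 'k::field) mpoly set"
  assumes fin: "finite BU" and dis: "BX \<inter> BU = {}" and J: "ideal_on (polys UNIV (BX \<union> BU)) J"
    and flat: "flat (ring_on (polys UNIV BU)) (quot_module (module_on (*) (polys UNIV (BX \<union> BU))) J)"
    and g: "g \<in> J" "restrict_poly BX g = 0" and u: "u \<in> BU"
  shows "u_coeff BU u g \<in> restrict_poly BX ` J"
proof -
  define A :: "('y, 'k) mpoly set" where "A = polys UNIV BU"
  define P :: "('y, 'k) mpoly set" where "P = polys UNIV (BX \<union> BU)"
  define \<mm> where "\<mm> = {p \<in> A. lk p 0 = 0}"
  define M where "M = quot_module (module_on (*) P) J"
  define I where "I = restrict_poly BX ` J"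
  have SA: "subring_on A" and SP: "subring_on P" and SX: "subring_on (polys UNIV BX :: ('y, 'k) mpoly set)"
    by (simp_all add: A_def P_def subring_polys)
  note J' = J[folded P_def]
  have I: "ideal_on (polys UNIV BX) I" unfolding I_def by (rule ideal_on_restrict_image[OF J])
  have AP: "A \<subseteq> P" unfolding A_def P_def by (rule polys_mono) auto
  have \<mm>: "ideal_on A \<mm>"
    using SA by (auto simp: ideal_on_def \<mm>_def subring_on_def lookup_add lookup_mult_zero_single)
  note Jadd = ideal_on_additive[OF J' SP]
  let ?C = "coset P J"
  have Mc: "carrier M = ?C ` P" by (simp add: M_def quot_module_simps)
  have Madd: "?C p \<oplus>\<^bsub>M\<^esub> ?C q = ?C (p + q)" for p q
    unfolding M_def by (rule quot_module_add[OF Jadd])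
  have Msm: "r \<odot>\<^bsub>M\<^esub> ?C p = ?C (r * p)" if "r \<in> P" for r p
    unfolding M_def by (rule quot_module_smult[OF Jadd refl]) (use ideal_onD(4)[OF J' that] in blast)
  obtain h where h: "\<And>v. h v \<in> P" "g = restrict_poly BX g + (\<Sum>v\<in>BU. Var v * h v)"
    "\<And>v. v \<in> BU \<Longrightarrow> restrict_poly BX (h v) = u_coeff BU v g"
    using u_decomposition[OF fin dis] ideal_onD(1)[OF J g(1)] unfolding P_def by blast
  have VarA: "Var v \<in> A" if "v \<in> BU" for v using that by (simp add: A_def Var_in_polys)
  have Varm: "Var v \<in> \<mm>" if "v \<in> BU" for v
    using VarA[OF that] by (simp add: \<mm>_def lookup_single when_def single_one_iff)
  define z where "z = (\<Sum>v\<in>BU. frag_of (Var v :: ('y, 'k) mpoly, ?C (h v)))"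
  let ?TR = "tensor_relations (ring_on A) (module_on (*) A) M"
  have 1: "1 \<in> A" using subring_onD(2)[OF SA] .
  \<comment> \<open>In the tensor product with \<open>\<k>[U]\<close> itself the variables can be moved to the right factor.\<close>
  have move: "(\<Sum>v\<in>B. frag_of (Var v, ?C (h v))) - frag_of (1, ?C (\<Sum>v\<in>B. Var v * h v)) \<in> ?TR"
    if "finite B" "B \<subseteq> BU" for B
    using that
  proof (induction B rule: finite_induct)
    case empty
    have C0: "?C 0 \<in> carrier M" using subring_onD(1)[OF SP] by (simp add: Mc)
    have "frag_of (1, ?C 0 \<oplus>\<^bsub>M\<^esub> ?C 0) - frag_of (1, ?C 0) - frag_of (1, ?C 0) \<in> ?TR"
      by (rule tensor_relations.add_right) (use 1 C0 in auto)
    then show ?case by (simp add: Madd)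
  next
    case (insert v B)
    let ?s = "\<Sum>v\<in>B. Var v * h v"
    have vP: "Var v * h v \<in> P" "?s \<in> P"
      using h(1) VarA AP insert.prems by (auto intro!: subring_on_sum[OF SP] subring_onD(5)[OF SP])
    have "frag_of (Var v \<odot>\<^bsub>module_on (*) A\<^esub> 1, ?C (h v)) - frag_of (1, Var v \<odot>\<^bsub>M\<^esub> ?C (h v)) \<in> ?TR"
      by (rule tensor_relations.smult) (use 1 VarA insert.prems h(1) in \<open>auto simp: Mc\<close>)
    then have a: "frag_of (Var v, ?C (h v)) - frag_of (1, ?C (Var v * h v)) \<in> ?TR"
      using Msm[of "Var v" "h v"] VarA[of v] AP insert.prems by auto
    have b: "frag_of (1, ?C (Var v * h v) \<oplus>\<^bsub>M\<^esub> ?C ?s) - frag_of (1, ?C (Var v * h v)) - frag_of (1, ?C ?s) \<in> ?TR"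
      by (rule tensor_relations.add_right) (use 1 vP in \<open>auto simp: Mc\<close>)
    have c: "(\<Sum>v\<in>B. frag_of (Var v, ?C (h v))) - frag_of (1, ?C ?s) \<in> ?TR" using insert by blast
    from tensor_relations.diff[OF tensor_relations_add[OF a c] b] show ?case
      using insert.hyps by (simp add: Madd algebra_simps)
  qed
  have "frag_of (1, ?C g) \<in> ?TR"
  proof -
    have C0: "?C 0 \<in> carrier M" using subring_onD(1)[OF SP] by (simp add: Mc)
    have "frag_of (1, ?C 0 \<oplus>\<^bsub>M\<^esub> ?C 0) - frag_of (1, ?C 0) - frag_of (1, ?C 0) \<in> ?TR"
      by (rule tensor_relations.add_right) (use 1 C0 in auto)
    then have "- frag_of (1, ?C 0) \<in> ?TR" by (simp add: Madd)
    from tensor_relations.diff[OF tensor_relations.zero this] have "frag_of (1, ?C 0) \<in> ?TR" by simp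
    moreover have "?C g = ?C 0" using g(1) by (simp add: coset_eq_iff[OF Jadd])
    ultimately show ?thesis by simp
  qed
  moreover have "(\<Sum>v\<in>BU. Var v * h v) = g" using h(2) g(2) by simp
  ultimately have zTR: "z \<in> ?TR"
    using tensor_relations_add[OF move[OF fin order_refl], of "frag_of (1, ?C g)"] unfolding z_def by simp
  define i where "i = (\<lambda>x\<in>\<mm>. x)"
  have "z \<in> tensor_relations (ring_on A) (module_on (*) \<mm>) M"
  proof -
    have "Module.module (ring_on A) (module_on (*) A)" "Module.module (ring_on A) (module_on (*) \<mm>)"
      using module_module_on[OF SA ideal_on_UNIV[OF SA]] module_module_on[OF SA \<mm>] by auto
    moreover have "i \<in> module_homs (ring_on A) (module_on (*) \<mm>) (module_on (*) A)"
      using ideal_onD[OF \<mm>] by (auto simp: module_homs_def i_def)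
    moreover have "inj_on i (carrier (module_on (*) \<mm>))" by (simp add: i_def inj_on_def)
    moreover have "ks z \<subseteq> carrier (module_on (*) \<mm>) \<times> carrier M"
      using keys_sum[of "\<lambda>v. frag_of (Var v :: ('y, 'k) mpoly, ?C (h v))" BU] Varm h(1)
      unfolding z_def by (fastforce simp: Mc)
    moreover have "frag_extend (\<lambda>(x, y). frag_of (i x, y)) z = z"
      unfolding z_def frag_extend_sum[OF fin]
      by (rule sum.cong) (use Varm in \<open>auto simp: i_def\<close>)
    ultimately show ?thesis
      using flat zTR unfolding flat_def A_def[symmetric] P_def[symmetric] M_def[symmetric] by metis
  qed
  \<comment> \<open>Choosing a representative of each coset makes \<open>\<Phi>\<close> a function with values in \<open>\<k>[X]\<close>, bilinear
    only modulo \<open>I\<close>.\<close>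
  define \<Phi> where "\<Phi> = (\<lambda>(x :: ('y, 'k) mpoly, C).
      Const (lk x (mterm u 1)) * restrict_poly BX (SOME p. p \<in> C))"
  define rep where "rep p = restrict_poly BX (SOME q. q \<in> ?C p)" for p
  have rep: "rep p - restrict_poly BX p \<in> I" for p
  proof -
    have "(SOME q. q \<in> ?C p) \<in> ?C p" by (rule someI[of _ p]) (rule coset_self[OF Jadd])
    then obtain k where "k \<in> J" "(SOME q. q \<in> ?C p) = k + p" by (auto simp: coset_eq)
    then show ?thesis unfolding rep_def I_def by (simp add: restrict_poly_simps)
  qed
  have \<Phi>: "\<Phi> (x, ?C p) = Const (lk x (mterm u 1)) * rep p" for x p
    by (simp add: \<Phi>_def rep_def)
  have cI: "Const c * x \<in> I" if "x \<in> I" for c x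
    using ideal_onD(4)[OF I _ that] Const_in_polys[OF subring_on_UNIV] by blast
  have "frag_eval \<Phi> w \<in> I" if "w \<in> tensor_relations (ring_on A) (module_on (*) \<mm>) M" for w
    using that
  proof induction
    case zero
    then show ?case using ideal_onD(2)[OF I] by simp
  next
    case (diff z w)
    then show ?case using ideal_on_diff[OF I SX] by (simp add: frag_eval_diff)
  next
    case (add_left x x' y)
    then obtain p where "y = ?C p" by (auto simp: Mc)
    then show ?case using ideal_onD(2)[OF I]
      by (simp add: frag_eval_diff \<Phi> lookup_add single_add distrib_right)
  next
    case (add_right x y y')
    then obtain p q where pq: "y = ?C p" "y' = ?C q" by (auto simp: Mc)
    let ?r = "restrict_poly BX"
    have "(rep (p + q) - ?r (p + q)) - (rep p - ?r p) - (rep q - ?r q) \<in> I"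
      by (intro ideal_on_diff[OF I SX] rep)
    then have "rep (p + q) - rep p - rep q \<in> I" by (simp add: restrict_poly_simps algebra_simps)
    from cI[OF this, of "lk x (mterm u 1)"] show ?case
      by (simp add: frag_eval_diff \<Phi> pq Madd right_diff_distrib)
  next
    case (smult r x y)
    then obtain p where p: "y = ?C p" by (auto simp: Mc)
    have r: "r \<in> A" "x \<in> \<mm>" using smult by auto
    have "restrict_poly BX r = Const (lk r 0)"
      using subring_on_UNIV r(1)[unfolded A_def]
    proof (induction rule: polys_induct)
      case (single m c)
      then have "ks m \<subseteq> BX \<longleftrightarrow> m = 0" using dis by auto (metis disjoint_iff keys_eq_empty subset_iff ex_in_conv)
      then show ?case by (auto simp: restrict_poly_single lookup_single when_def)
    qed (simp_all add: restrict_poly_simps lookup_add single_add)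
    then have rr: "restrict_poly BX (r * p) = Const (lk r 0) * restrict_poly BX p"
      by (simp add: restrict_poly_simps)
    have "Const (lk r 0) * (rep p - restrict_poly BX p) - (rep (r * p) - restrict_poly BX (r * p)) \<in> I"
      by (intro ideal_on_diff[OF I SX] cI rep)
    then have "Const (lk r 0) * rep p - rep (r * p) \<in> I" by (simp add: rr right_diff_distrib)
    from cI[OF this, of "lk x (mterm u 1)"] show ?case
      using r AP
      by (auto simp: frag_eval_diff p \<Phi> Msm lookup_mult_zero_single \<mm>_def right_diff_distrib Const_mult mult_ac)
  qed
  from this[OF \<open>z \<in> tensor_relations (ring_on A) (module_on (*) \<mm>) M\<close>]
  have "(\<Sum>v\<in>BU. Const (lk (Var v) (mterm u 1)) * rep (h v)) \<in> I"
    by (simp add: z_def frag_eval_sum \<Phi>)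
  also have "(\<Sum>v\<in>BU. Const (lk (Var v) (mterm u 1)) * rep (h v))
      = (\<Sum>v\<in>BU. if v = u then rep (h u) else 0)"
    by (rule sum.cong) (auto simp: lookup_single when_def single_one_iff)
  finally have "rep (h u) \<in> I" using u fin by simp
  then have "rep (h u) - (rep (h u) - restrict_poly BX (h u)) \<in> I"
    by (rule ideal_on_diff[OF I SX _ rep])
  then show ?thesis using h(3)[OF u] by (simp add: I_def)
qed

text \<open>Two lifts of the same element of \<open>I\<close> differ by some \<open>g \<in> J\<close> with restriction 0, to which
  \<open>flat_u_coeff\<close> applies.\<close>

lemma alpha_apply:
  fixes J :: "('y, 'k::field) mpoly set"
  assumes fin: "finite BU" and dis: "BX \<inter> BU = {}" and J: "ideal_on (polys UNIV (BX \<union> BU)) J"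
    and flat: "flat (ring_on (polys UNIV BU)) (quot_module (module_on (*) (polys UNIV (BX \<union> BU))) J)"
    and g: "g \<in> J"
  shows "alpha BX BU J \<xi> (restrict_poly BX g)
    = coset (polys UNIV BX) (restrict_poly BX ` J) (\<Sum>u\<in>BU. Const (\<xi> u) * u_coeff BU u g)"
proof -
  let ?I = "restrict_poly BX ` J"
  have I: "ideal_on (polys UNIV BX) ?I" by (rule ideal_on_restrict_image[OF J])
  have SX: "subring_on (polys UNIV BX :: ('y, 'k) mpoly set)" by (simp add: subring_polys)
  have "coset (polys UNIV BX) ?I (\<Sum>u\<in>BU. Const (\<xi> u) * u_coeff BU u g')
      = coset (polys UNIV BX) ?I (\<Sum>u\<in>BU. Const (\<xi> u) * u_coeff BU u g)"
    if "g' \<in> J" "restrict_poly BX g' = restrict_poly BX g" for g'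
  proof -
    have "g' - g \<in> J" using ideal_on_diff[OF J subring_polys[OF subring_on_UNIV] that(1) g] .
    moreover have "restrict_poly BX (g' - g) = 0" using that by (simp add: restrict_poly_simps)
    ultimately have "u_coeff BU u (g' - g) \<in> ?I" if "u \<in> BU" for u
      using flat_u_coeff[OF fin dis J flat _ _ that] by blast
    then have "(\<Sum>u\<in>BU. Const (\<xi> u) * u_coeff BU u (g' - g)) \<in> ?I"
      by (intro ideal_on_sum[OF I] ideal_onD(4)[OF I] Const_in_polys) auto
    then show ?thesis
      by (simp add: coset_eq_iff[OF ideal_on_additive[OF I SX]] u_coeff_diff right_diff_distrib sum_subtractf)
  qed
  then have "(THE C. \<exists>g'\<in>J. restrict_poly BX g' = restrict_poly BX g \<and>
      C = coset (polys UNIV BX) ?I (\<Sum>u\<in>BU. Const (\<xi> u) * u_coeff BU u g'))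
    = coset (polys UNIV BX) ?I (\<Sum>u\<in>BU. Const (\<xi> u) * u_coeff BU u g)"
    using g by (intro the_equality) blast+
  then show ?thesis using g by (simp add: alpha_def)
qed

section \<open>Modules of homomorphisms and generators of quotients\<close>

lemma module_quot_module_on:
  assumes P: "subring_on P" and I: "ideal_on P I"
  shows "Module.module (ring_on P) (quot_module (module_on (*) P) I)"
proof -
  let ?Q = "quot_module (module_on (*) P) I" and ?C = "coset P I"
  note A = ideal_on_additive[OF I P]
  have add: "?C p \<oplus>\<^bsub>?Q\<^esub> ?C q = ?C (p + q)" for p q by (rule quot_module_add[OF A])
  have sm: "r \<odot>\<^bsub>?Q\<^esub> ?C p = ?C (r * p)" if "r \<in> P" for r p
    by (rule quot_module_smult[OF A refl]) (rule ideal_onD(4)[OF I that])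
  have carr: "x \<in> carrier ?Q \<Longrightarrow> \<exists>p\<in>P. x = ?C p" for x
    by (auto simp: quot_module_simps)
  have C: "?C p \<in> carrier ?Q" if "p \<in> P" for p using that by (simp add: quot_module_simps)
  have z: "\<zero>\<^bsub>?Q\<^esub> = ?C 0" by (simp add: quot_module_simps coset_zero)
  note Pc = subring_onD[OF P]
  show ?thesis
  proof (rule Module.moduleI[OF cring_ring_on[OF P]])
    show "abelian_group ?Q"
    proof (rule abelian_groupI)
      show "\<zero>\<^bsub>?Q\<^esub> \<in> carrier ?Q" unfolding z by (rule C[OF Pc(1)])
    next
      fix x y z assume "x \<in> carrier ?Q" "y \<in> carrier ?Q" "z \<in> carrier ?Q"
      then obtain p q r where "p \<in> P" "q \<in> P" "r \<in> P" "x = ?C p" "y = ?C q" "z = ?C r" by (metis carr)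
      then show "(x \<oplus>\<^bsub>?Q\<^esub> y) \<oplus>\<^bsub>?Q\<^esub> z = x \<oplus>\<^bsub>?Q\<^esub> (y \<oplus>\<^bsub>?Q\<^esub> z)" by (simp only: add add.assoc)
    next
      fix x y assume "x \<in> carrier ?Q" "y \<in> carrier ?Q"
      then obtain p q where pq: "p \<in> P" "q \<in> P" "x = ?C p" "y = ?C q" by (metis carr)
      then show "x \<oplus>\<^bsub>?Q\<^esub> y = y \<oplus>\<^bsub>?Q\<^esub> x" by (simp only: add add.commute)
      show "x \<oplus>\<^bsub>?Q\<^esub> y \<in> carrier ?Q" unfolding pq add by (rule C[OF Pc(4)[OF pq(1,2)]])
    next
      fix x assume "x \<in> carrier ?Q"
      then obtain p where p: "p \<in> P" "x = ?C p" by (metis carr)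
      then show "\<zero>\<^bsub>?Q\<^esub> \<oplus>\<^bsub>?Q\<^esub> x = x" by (simp add: z add)
      show "\<exists>y\<in>carrier ?Q. y \<oplus>\<^bsub>?Q\<^esub> x = \<zero>\<^bsub>?Q\<^esub>"
        by (rule bexI[of _ "?C (- p)"]) (simp_all add: p z add C Pc(3))
    qed
  next
    fix a x assume "a \<in> carrier (ring_on P)" "x \<in> carrier ?Q"
    then obtain p where p: "a \<in> P" "p \<in> P" "x = ?C p" using carr by force
    then show "a \<odot>\<^bsub>?Q\<^esub> x \<in> carrier ?Q" by (simp add: sm C Pc(5))
    fix b assume "b \<in> carrier (ring_on P)"
    then have b: "b \<in> P" by simp
    show "(a \<oplus>\<^bsub>ring_on P\<^esub> b) \<odot>\<^bsub>?Q\<^esub> x = a \<odot>\<^bsub>?Q\<^esub> x \<oplus>\<^bsub>?Q\<^esub> b \<odot>\<^bsub>?Q\<^esub> x"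
      using p b by (simp add: sm add Pc(4) distrib_right)
    show "(a \<otimes>\<^bsub>ring_on P\<^esub> b) \<odot>\<^bsub>?Q\<^esub> x = a \<odot>\<^bsub>?Q\<^esub> (b \<odot>\<^bsub>?Q\<^esub> x)"
      using p b by (simp add: sm Pc(5) mult.assoc)
  next
    fix a x y assume "a \<in> carrier (ring_on P)" "x \<in> carrier ?Q" "y \<in> carrier ?Q"
    moreover from this obtain p q where "p \<in> P" "x = ?C p" "q \<in> P" "y = ?C q" by (metis carr)
    ultimately show "a \<odot>\<^bsub>?Q\<^esub> (x \<oplus>\<^bsub>?Q\<^esub> y) = a \<odot>\<^bsub>?Q\<^esub> x \<oplus>\<^bsub>?Q\<^esub> a \<odot>\<^bsub>?Q\<^esub> y"
      by (simp add: sm add distrib_left)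
  next
    fix x assume "x \<in> carrier ?Q"
    then obtain p where "p \<in> P" "x = ?C p" using carr by force
    then show "\<one>\<^bsub>ring_on P\<^esub> \<odot>\<^bsub>?Q\<^esub> x = x" by (simp add: sm Pc(2))
  qed
qed

lemma Hom_module_simps:
  "carrier (Hom_module R M N) = module_homs R M N"
  "zero (Hom_module R M N) = (\<lambda>x\<in>carrier M. \<zero>\<^bsub>N\<^esub>)"
  "add (Hom_module R M N) \<phi> \<psi> = (\<lambda>x\<in>carrier M. \<phi> x \<oplus>\<^bsub>N\<^esub> \<psi> x)"
  "smult (Hom_module R M N) r \<phi> = (\<lambda>x\<in>carrier M. r \<odot>\<^bsub>N\<^esub> \<phi> x)"
  by (simp_all add: Hom_module_def)

lemma module_homsD:
  assumes "\<phi> \<in> module_homs R M N"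
  shows "x \<in> carrier M \<Longrightarrow> \<phi> x \<in> carrier N" "\<phi> \<in> extensional (carrier M)"
    "x \<in> carrier M \<Longrightarrow> y \<in> carrier M \<Longrightarrow> \<phi> (x \<oplus>\<^bsub>M\<^esub> y) = \<phi> x \<oplus>\<^bsub>N\<^esub> \<phi> y"
    "r \<in> carrier R \<Longrightarrow> x \<in> carrier M \<Longrightarrow> \<phi> (r \<odot>\<^bsub>M\<^esub> x) = r \<odot>\<^bsub>N\<^esub> \<phi> x"
  using assms by (auto simp: module_homs_def PiE_iff)

lemma module_Hom_module:
  assumes "Module.module R M" "Module.module R N"
  shows "Module.module R (Hom_module R M N)"
proof -
  interpret M: Module.module R M by fact
  interpret N: Module.module R N by fact
  let ?H = "module_homs R M N"
  have closed_add: "(\<lambda>x\<in>carrier M. \<phi> x \<oplus>\<^bsub>N\<^esub> \<psi> x) \<in> ?H" if "\<phi> \<in> ?H" "\<psi> \<in> ?H" for \<phi> \<psi>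
    using module_homsD[OF that(1)] module_homsD[OF that(2)]
    by (auto simp: module_homs_def N.M.a_ac N.smult_r_distr)
  have closed_smult: "(\<lambda>x\<in>carrier M. r \<odot>\<^bsub>N\<^esub> \<phi> x) \<in> ?H" if "r \<in> carrier R" "\<phi> \<in> ?H" for r \<phi>
  proof -
    have "r \<odot>\<^bsub>N\<^esub> (s \<odot>\<^bsub>N\<^esub> y) = s \<odot>\<^bsub>N\<^esub> (r \<odot>\<^bsub>N\<^esub> y)" if "s \<in> carrier R" "y \<in> carrier N" for s y
      using N.smult_assoc1[OF \<open>r \<in> carrier R\<close> that] N.smult_assoc1[OF that(1) \<open>r \<in> carrier R\<close> that(2)]
        M.R.m_comm[OF \<open>r \<in> carrier R\<close> that(1)] by simp
    then show ?thesis
      using module_homsD[OF that(2)] that(1) by (auto simp: module_homs_def N.smult_r_distr)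
  qed
  have zero: "(\<lambda>x\<in>carrier M. \<zero>\<^bsub>N\<^esub>) \<in> ?H" by (auto simp: module_homs_def)
  note D = module_homsD(1)[where R=R and M=M and N=N]
  have ext: "\<phi> = \<psi>" if "\<phi> \<in> ?H" "\<psi> \<in> ?H" "\<And>x. x \<in> carrier M \<Longrightarrow> \<phi> x = \<psi> x" for \<phi> \<psi>
    by (rule extensionalityI[OF module_homsD(2)[OF that(1)] module_homsD(2)[OF that(2)] that(3)])
  show ?thesis
  proof (rule Module.moduleI[OF M.R.is_cring])
    show "abelian_group (Hom_module R M N)"
    proof (rule abelian_groupI)
      fix \<phi> assume \<phi>: "\<phi> \<in> carrier (Hom_module R M N)"
      then have \<phi>': "\<phi> \<in> ?H" by (simp add: Hom_module_simps)
      have n: "(\<lambda>x\<in>carrier M. (\<ominus>\<^bsub>R\<^esub> \<one>\<^bsub>R\<^esub>) \<odot>\<^bsub>N\<^esub> \<phi> x) \<in> ?H" by (rule closed_smult[OF _ \<phi>']) simp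
      show "\<exists>y\<in>carrier (Hom_module R M N). y \<oplus>\<^bsub>Hom_module R M N\<^esub> \<phi> = \<zero>\<^bsub>Hom_module R M N\<^esub>"
        by (rule bexI[of _ "\<lambda>x\<in>carrier M. (\<ominus>\<^bsub>R\<^esub> \<one>\<^bsub>R\<^esub>) \<odot>\<^bsub>N\<^esub> \<phi> x"])
          (use n D[OF \<phi>'] in \<open>auto simp: Hom_module_simps N.smult_l_minus N.M.l_neg intro!: restrict_ext\<close>)
      show "\<zero>\<^bsub>Hom_module R M N\<^esub> \<oplus>\<^bsub>Hom_module R M N\<^esub> \<phi> = \<phi>"
        unfolding Hom_module_simps
        by (rule ext[OF closed_add[OF zero \<phi>'] \<phi>']) (use D[OF \<phi>'] in auto)
    qed (auto simp: Hom_module_simps closed_add zero D N.M.a_ac intro!: restrict_ext)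
  qed (auto simp: Hom_module_simps closed_smult D N.smult_l_distr N.smult_r_distr N.smult_assoc1
      intro!: restrict_ext ext[OF closed_smult])
qed

text \<open>The images of \<open>W\<close> in the quotient form a submodule containing the generators, so they are everything; as \<open>W\<close>
  contains \<open>H\<close>, it is then everything itself.\<close>

lemma quot_module_generated:
  fixes R (structure) and M (structure)
  assumes M: "Module.module R M" and H: "H \<subseteq> carrier M" "\<zero>\<^bsub>M\<^esub> \<in> H"
    "\<And>x y. x \<in> H \<Longrightarrow> y \<in> H \<Longrightarrow> x \<oplus>\<^bsub>M\<^esub> y \<in> H" "\<And>r x. r \<in> carrier R \<Longrightarrow> x \<in> H \<Longrightarrow> r \<odot>\<^bsub>M\<^esub> x \<in> H"
    and gen: "generates R (quot_module M H) ((\<lambda>x. H +>\<^bsub>M\<^esub> x) ` S)"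
    and W: "W \<subseteq> carrier M" "H \<subseteq> W" "S \<subseteq> W"
    "\<And>x y. x \<in> W \<Longrightarrow> y \<in> W \<Longrightarrow> x \<oplus>\<^bsub>M\<^esub> y \<in> W" "\<And>r x. r \<in> carrier R \<Longrightarrow> x \<in> W \<Longrightarrow> r \<odot>\<^bsub>M\<^esub> x \<in> W"
  shows "W = carrier M"
proof -
  interpret Module.module R M by (rule M)
  let ?Q = "quot_module M H"
  have neg: "\<ominus>\<^bsub>M\<^esub> x = (\<ominus>\<^bsub>R\<^esub> \<one>\<^bsub>R\<^esub>) \<odot>\<^bsub>M\<^esub> x" if "x \<in> carrier M" for x
    using smult_l_minus[of "\<one>\<^bsub>R\<^esub>" x] that by simp
  have "abelian_subgroup H M"
  proof (rule abelian_subgroup_intro[OF abelian_group_axioms H(1-3)])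
    fix x assume "x \<in> H"
    then have x: "x \<in> carrier M" using H(1) by blast
    then show "\<exists>y\<in>H. y \<oplus>\<^bsub>M\<^esub> x = \<zero>\<^bsub>M\<^esub>"
      using \<open>x \<in> H\<close> H(4)[of "\<ominus>\<^bsub>R\<^esub> \<one>\<^bsub>R\<^esub>" x] neg[OF x] M.l_neg[OF x]
      by (intro bexI[of _ "\<ominus>\<^bsub>M\<^esub> x"]) simp_all
  qed
  then interpret H: abelian_subgroup H M .
  have carr: "carrier ?Q = (\<lambda>x. H +>\<^bsub>M\<^esub> x) ` carrier M"
    by (auto simp: quot_module_def A_RCOSETS_def')
  have add: "(H +>\<^bsub>M\<^esub> x) \<oplus>\<^bsub>?Q\<^esub> (H +>\<^bsub>M\<^esub> y) = H +>\<^bsub>M\<^esub> (x \<oplus>\<^bsub>M\<^esub> y)" if "x \<in> carrier M" "y \<in> carrier M" for x y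
    using H.a_rcos_sum[OF that] by (simp add: quot_module_def)
  have zero: "\<zero>\<^bsub>?Q\<^esub> = H +>\<^bsub>M\<^esub> \<zero>\<^bsub>M\<^esub>"
    using M.a_coset_add_zero[OF H(1)] by (simp add: quot_module_def)
  have grp: "Group.group (add_monoid ?Q)"
  proof (rule groupI)
    fix a b c assume "a \<in> carrier (add_monoid ?Q)" "b \<in> carrier (add_monoid ?Q)" "c \<in> carrier (add_monoid ?Q)"
    then obtain x y z where "x \<in> carrier M" "a = H +>\<^bsub>M\<^esub> x" "y \<in> carrier M" "b = H +>\<^bsub>M\<^esub> y"
      "z \<in> carrier M" "c = H +>\<^bsub>M\<^esub> z" by (auto simp: carr)
    then show "a \<otimes>\<^bsub>add_monoid ?Q\<^esub> b \<otimes>\<^bsub>add_monoid ?Q\<^esub> c = a \<otimes>\<^bsub>add_monoid ?Q\<^esub> (b \<otimes>\<^bsub>add_monoid ?Q\<^esub> c)"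
      by (simp add: add M.a_assoc)
  next
    fix a assume "a \<in> carrier (add_monoid ?Q)"
    then obtain x where x: "x \<in> carrier M" "a = H +>\<^bsub>M\<^esub> x" by (auto simp: carr)
    then show "\<exists>b\<in>carrier (add_monoid ?Q). b \<otimes>\<^bsub>add_monoid ?Q\<^esub> a = \<one>\<^bsub>add_monoid ?Q\<^esub>"
      by (intro bexI[of _ "H +>\<^bsub>M\<^esub> (\<ominus>\<^bsub>M\<^esub> x)"]) (auto simp: add zero carr M.l_neg)
  qed (auto simp: carr add zero)
  have inv: "inv\<^bsub>add_monoid ?Q\<^esub> (H +>\<^bsub>M\<^esub> x) = H +>\<^bsub>M\<^esub> (\<ominus>\<^bsub>M\<^esub> x)" if "x \<in> carrier M" for x
    by (rule Group.group.inv_equality[OF grp]) (use that in \<open>auto simp: carr add zero M.l_neg\<close>)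
  have self: "x \<in> H +>\<^bsub>M\<^esub> x" if "x \<in> carrier M" for x
    using that H(2) M.l_zero[OF that] by (auto simp: a_r_coset_def')
  have smult: "r \<odot>\<^bsub>?Q\<^esub> (H +>\<^bsub>M\<^esub> x) = H +>\<^bsub>M\<^esub> (r \<odot>\<^bsub>M\<^esub> x)" if "r \<in> carrier R" "x \<in> carrier M" for r x
  proof -
    have "H +>\<^bsub>M\<^esub> (r \<odot>\<^bsub>M\<^esub> y) = H +>\<^bsub>M\<^esub> (r \<odot>\<^bsub>M\<^esub> x)" if y: "y \<in> H +>\<^bsub>M\<^esub> x" for y
    proof -
      obtain k where k: "k \<in> H" "y = k \<oplus>\<^bsub>M\<^esub> x" using y by (auto simp: a_r_coset_def')
      have "r \<odot>\<^bsub>M\<^esub> y = r \<odot>\<^bsub>M\<^esub> k \<oplus>\<^bsub>M\<^esub> r \<odot>\<^bsub>M\<^esub> x"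
        using k H(1) \<open>r \<in> carrier R\<close> \<open>x \<in> carrier M\<close> by (auto simp: smult_r_distr)
      then have "r \<odot>\<^bsub>M\<^esub> y \<in> H +>\<^bsub>M\<^esub> (r \<odot>\<^bsub>M\<^esub> x)"
        using H(4)[OF \<open>r \<in> carrier R\<close> k(1)] by (auto simp: a_r_coset_def')
      then show ?thesis
        using M.a_repr_independence[OF _ smult_closed[OF \<open>r \<in> carrier R\<close> \<open>x \<in> carrier M\<close>] H.a_subgroup] by metis
    qed
    moreover have "H +>\<^bsub>M\<^esub> x \<noteq> {}" using self[OF that(2)] by blast
    ultimately show ?thesis by (auto simp: quot_module_def)
  qed
  let ?N = "(\<lambda>x. H +>\<^bsub>M\<^esub> x) ` W"
  have "submodule ?N R ?Q"
  proof (rule submodule.intro)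
    show "subgroup ?N (add_monoid ?Q)"
    proof (rule Group.group.subgroupI[OF grp])
      show "?N \<subseteq> carrier (add_monoid ?Q)" using W(1) carr by auto
      show "?N \<noteq> {}" using W(2) H(2) by blast
    next
      fix a assume "a \<in> ?N"
      then obtain w where w: "w \<in> W" "a = H +>\<^bsub>M\<^esub> w" by blast
      then have "\<ominus>\<^bsub>M\<^esub> w \<in> W" using W(1,5) neg[of w] by auto
      then show "inv\<^bsub>add_monoid ?Q\<^esub> a \<in> ?N" using w W(1) inv[of w] by auto
    next
      fix a b assume "a \<in> ?N" "b \<in> ?N"
      then obtain w w' where w: "w \<in> W" "a = H +>\<^bsub>M\<^esub> w" "w' \<in> W" "b = H +>\<^bsub>M\<^esub> w'" by blast
      then have "a \<oplus>\<^bsub>?Q\<^esub> b = H +>\<^bsub>M\<^esub> (w \<oplus>\<^bsub>M\<^esub> w')" using add W(1) by blast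
      then show "a \<otimes>\<^bsub>add_monoid ?Q\<^esub> b \<in> ?N" using W(4) w by simp
    qed
    show "submodule_axioms ?N R ?Q"
    proof
      fix r a assume "r \<in> carrier R" "a \<in> ?N"
      then show "r \<odot>\<^bsub>?Q\<^esub> a \<in> ?N" using smult W(1,5) by auto
    qed
  qed
  moreover have "(\<lambda>x. H +>\<^bsub>M\<^esub> x) ` S \<subseteq> ?N" using W(3) by blast
  ultimately have N: "?N = carrier ?Q" using gen by (auto simp: generates_def)
  have "x \<in> W" if x: "x \<in> carrier M" for x
  proof -
    have "H +>\<^bsub>M\<^esub> x \<in> ?N" using N carr x by blast
    then obtain w where w: "w \<in> W" "H +>\<^bsub>M\<^esub> x = H +>\<^bsub>M\<^esub> w" by blast
    then have "x \<in> H +>\<^bsub>M\<^esub> w" using self[OF x] by simp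
    then obtain k where "k \<in> H" "x = k \<oplus>\<^bsub>M\<^esub> w" by (auto simp: a_r_coset_def')
    then show ?thesis using W(2,4) w by auto
  qed
  then show ?thesis using W(1) by blast
qed

section \<open>Homomorphisms generated by \<open>\<alpha>\<close> and derivations\<close>

text \<open>Taking the coefficient of \<open>u\<close> is the partial derivative with respect to \<open>u\<close>, followed by restriction;
  so it satisfies the Leibniz rule over the restriction map.\<close>

lemma u_coeff_mult:
  fixes p q :: "('y, 'k::field) mpoly"
  assumes dis: "BX \<inter> BU = {}" and u: "u \<in> BU"
    and p: "p \<in> polys UNIV (BX \<union> BU)" and q: "q \<in> polys UNIV (BX \<union> BU)"
  shows "u_coeff BU u (p * q) = restrict_poly BX p * u_coeff BU u q + u_coeff BU u p * restrict_poly BX q"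
  using subring_on_UNIV p
proof (induction rule: polys_induct)
  case (single m c)
  from subring_on_UNIV q show ?case
  proof (induction rule: polys_induct)
    case s: (single m' c')
    have X: "ks m \<subseteq> BX \<longleftrightarrow> ks m \<inter> BU = {}" "ks m' \<subseteq> BX \<longleftrightarrow> ks m' \<inter> BU = {}"
      using single s dis by auto
    define l where "l m \<longleftrightarrow> ks m \<inter> BU = {u} \<and> lk m u = 1" for m :: "'y \<Rightarrow>\<^sub>0 nat"
    have nn: "ks m \<inter> BU = {} \<Longrightarrow> \<not> l m" for m by (auto simp: l_def)
    have iff: "l (m + m') \<longleftrightarrow> (ks m \<inter> BU = {} \<and> l m') \<or> (l m \<and> ks m' \<inter> BU = {})"
    proof -
      have *: "A \<union> B = {u} \<and> a + b = 1 \<longleftrightarrow> (A = {} \<and> B = {u} \<and> b = 1) \<or> ((A = {u} \<and> a = 1) \<and> B = {})"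
        if "u \<notin> A \<longleftrightarrow> a = 0" "u \<notin> B \<longleftrightarrow> b = 0" for A B :: "'y set" and a b :: nat
        using that by (cases "u \<in> A"; cases "u \<in> B") (force simp: One_nat_def)+
      show ?thesis
        unfolding l_def lookup_add keys_add_nat Int_Un_distrib2
        by (rule *) (use u in \<open>auto simp: in_keys_iff\<close>)
    qed
    have e1: "m + m' - mterm u 1 = m + (m' - mterm u 1)" if "l m'"
      using that by (intro poly_mapping_eqI) (auto simp: l_def lookup_add lookup_minus lookup_single when_def)
    have e2: "m + m' - mterm u 1 = m - mterm u 1 + m'" if "l m"
      using that by (intro poly_mapping_eqI) (auto simp: l_def lookup_add lookup_minus lookup_single when_def)
    have uc: "u_coeff BU u (mterm m c) = (if l m then mterm (m - mterm u 1) c else 0)"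
      for m and c :: 'k by (simp add: u_coeff_single l_def)
    show ?case
      unfolding restrict_poly_single X mult_single uc iff
      using nn e1 e2 by (auto simp: mult_single)
  qed (simp_all add: u u_coeff_add restrict_poly_simps distrib_left)
qed (simp_all add: u u_coeff_add restrict_poly_simps distrib_right)

lemma u_coeff_restricted:
  assumes dis: "BX \<inter> BU = {}" and u: "u \<in> BU" and p: "p \<in> polys UNIV BX"
  shows "u_coeff BU u p = 0"
proof (rule poly_mapping_eqI)
  fix m
  have "m + mterm u 1 \<notin> ks p"
    using p u dis by (auto simp: polys_iff keys_add_nat dest!: bspec)
  then show "lk (u_coeff BU u p) m = lk 0 m" using u by (simp add: lookup_u_coeff in_keys_iff)
qed

lemma derivationsD:
  assumes "D \<in> derivations V"
  shows "p \<in> polys UNIV V \<Longrightarrow> D p \<in> polys UNIV V"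
    "p \<in> polys UNIV V \<Longrightarrow> q \<in> polys UNIV V \<Longrightarrow> D (p + q) = D p + D q"
    "p \<in> polys UNIV V \<Longrightarrow> q \<in> polys UNIV V \<Longrightarrow> D (p * q) = p * D q + q * D p"
    "D (Const c) = 0"
  using assms by (auto simp: derivations_def)

lemma derivations_closed:
  shows "(\<lambda>p. 0) \<in> derivations V"
    "D \<in> derivations V \<Longrightarrow> D' \<in> derivations V \<Longrightarrow> (\<lambda>p. D p + D' p) \<in> derivations V"
    "D \<in> derivations V \<Longrightarrow> r \<in> polys UNIV V \<Longrightarrow> (\<lambda>p. r * D p) \<in> derivations V"
  by (auto simp: derivations_def polys_zero polys_add polys_mult algebra_simps)

text \<open>The homomorphisms of the form \<open>\<partial> + \<Sum> p\<^sub>u \<alpha>(u\<^sup>*)\<close> form a submodule of \<open>Hom(I, \<k>[X]/I)\<close>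
  which contains the trivial deformations and all \<open>\<alpha>(\<xi>)\<close>. Lifting the elements of \<open>I\<close> to \<open>J\<close> gives explicit
  representatives.\<close>

lemma T1_generated_decomposition:
  fixes J :: "('y, 'k::field) mpoly set"
  assumes fin: "finite BU" and dis: "BX \<inter> BU = {}" and J: "ideal_on (polys UNIV (BX \<union> BU)) J"
    and flat: "flat (ring_on (polys UNIV BU)) (quot_module (module_on (*) (polys UNIV (BX \<union> BU))) J)"
    and I: "I = restrict_poly BX ` J"
    and gen: "generates (ring_on (polys UNIV BX)) (T1 BX I) ((\<lambda>\<xi>. T1_class BX I (alpha BX BU J \<xi>)) ` \<Xi>)"
    and \<psi>: "\<psi> \<in> carrier (normal_module BX I)"
  shows "\<exists>D\<in>derivations BX. \<exists>p. (\<forall>u\<in>BU. p u \<in> polys UNIV BX) \<and>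
    (\<forall>g\<in>J. \<psi> (restrict_poly BX g) =
       coset (polys UNIV BX) I (D (restrict_poly BX g) + (\<Sum>u\<in>BU. p u * u_coeff BU u g)))"
proof -
  define P :: "('y, 'k) mpoly set" where "P = polys UNIV BX"
  let ?N = "normal_module BX I" and ?C = "coset P I" and ?Q = "quot_module (module_on (*) P) I"
  let ?r = "restrict_poly BX"
  let ?TD = "trivial_deformations BX I"
  have P: "subring_on P" by (simp add: P_def subring_polys)
  have II: "ideal_on P I" unfolding I P_def by (rule ideal_on_restrict_image[OF J])
  note A = ideal_on_additive[OF II P]
  have add: "?C p \<oplus>\<^bsub>?Q\<^esub> ?C q = ?C (p + q)" for p q by (rule quot_module_add[OF A])
  have sm: "r \<odot>\<^bsub>?Q\<^esub> ?C p = ?C (r * p)" if "r \<in> P" for r p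
    by (rule quot_module_smult[OF A refl]) (rule ideal_onD(4)[OF II that])
  have N: "?N = Hom_module (ring_on P) (module_on (*) I) ?Q" by (simp add: normal_module_def P_def)
  have modN: "Module.module (ring_on P) ?N"
    unfolding N by (rule module_Hom_module[OF module_module_on[OF P II] module_quot_module_on[OF P II]])
  have rJ: "?r g \<in> I" if "g \<in> J" for g using that I by blast
  have JV: "g \<in> polys UNIV (BX \<union> BU)" if "g \<in> J" for g using ideal_onD(1)[OF J that] .
  have PV: "r \<in> polys UNIV (BX \<union> BU)" if "r \<in> P" for r
    using that polys_mono[OF order_refl Un_upper1] unfolding P_def by blast
  define form where "form D p g = D (?r g) + (\<Sum>u\<in>BU. p u * u_coeff BU u g)" for D p and g :: "('y, 'k) mpoly"
  define good where "good D p \<longleftrightarrow> D \<in> derivations BX \<and> (\<forall>u\<in>BU. p u \<in> P)"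
    for D :: "('y, 'k) mpoly \<Rightarrow> ('y, 'k) mpoly" and p
  have form_P: "form D p g \<in> P" if "good D p" "g \<in> J" for D p g
    using that JV[OF that(2)] derivationsD(1)[OF _ restrict_poly_in_polys[OF JV[OF that(2)]], of D BX]
    unfolding form_def good_def P_def
    by (auto intro!: polys_add[OF subring_on_UNIV] subring_on_sum[OF subring_polys[OF subring_on_UNIV]]
        polys_mult[OF subring_on_UNIV] u_coeff_in_polys[OF _ dis])
  \<comment> \<open>A map on J of this form is additive, and linear modulo I, hence descends to a homomorphism if
    it is well defined on I.\<close>
  have form_hom: "\<phi> \<in> carrier ?N"
    if ext: "\<phi> \<in> extensional I" and good: "good D p" and \<phi>: "\<And>g. g \<in> J \<Longrightarrow> \<phi> (?r g) = ?C (form D p g)" for \<phi> D p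
  proof -
    note D = derivationsD[of D BX, folded P_def]
    have gD: "D \<in> derivations BX" using good by (simp add: good_def)
    have rP: "?r g \<in> P" if "g \<in> J" for g using restrict_poly_in_polys[OF JV[OF that]] by (simp add: P_def)
    have a: "\<phi> (x + y) = \<phi> x \<oplus>\<^bsub>?Q\<^esub> \<phi> y" if "x \<in> I" "y \<in> I" for x y
    proof -
      from that I obtain g g' where g: "g \<in> J" "x = ?r g" "g' \<in> J" "y = ?r g'" by blast
      have "\<phi> (?r (g + g')) = ?C (form D p (g + g'))" by (rule \<phi>[OF ideal_onD(3)[OF J g(1,3)]])
      also have "form D p (g + g') = form D p g + form D p g'"
        using D(2)[OF gD rP rP, of g g'] g
        by (simp add: form_def restrict_poly_simps u_coeff_add distrib_left sum.distrib)
      finally show ?thesis using g \<phi> by (simp add: add restrict_poly_simps)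
    qed
    have b: "\<phi> (r * x) = r \<odot>\<^bsub>?Q\<^esub> \<phi> x" if "r \<in> P" "x \<in> I" for r x
    proof -
      from that(2) I obtain g where g: "g \<in> J" "x = ?r g" by blast
      have rr: "?r r = r" using restrict_poly_id that(1) by (auto simp: P_def)
      have "\<phi> (?r (r * g)) = ?C (form D p (r * g))" by (rule \<phi>[OF ideal_onD(4)[OF J PV[OF that(1)] g(1)]])
      also have "form D p (r * g) = r * form D p g + ?r g * D r"
      proof -
        have "u_coeff BU u (r * g) = r * u_coeff BU u g" if "u \<in> BU" for u
          using u_coeff_mult[OF dis that PV[OF \<open>r \<in> P\<close>] JV[OF g(1)]] u_coeff_restricted[OF dis that, of r] \<open>r \<in> P\<close> rr
          by (simp add: P_def)
        then show ?thesis
          using D(3)[OF gD that(1) rP[OF g(1)]]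
          by (simp add: form_def restrict_poly_simps rr distrib_left sum_distrib_left mult.left_commute)
      qed
      also have "?C (r * form D p g + ?r g * D r) = ?C (r * form D p g)"
      proof -
        have "D r * ?r g \<in> I" by (rule ideal_onD(4)[OF II D(1)[OF gD that(1)] rJ[OF g(1)]])
        then show ?thesis by (simp add: coset_eq_iff[OF A] mult.commute)
      qed
      finally show ?thesis using g \<phi> that(1) by (simp add: sm restrict_poly_simps rr)
    qed
    have "\<phi> x \<in> carrier ?Q" if x: "x \<in> I" for x
    proof -
      obtain g where g: "g \<in> J" "x = ?r g" using x I by blast
      then show ?thesis using form_P[OF good g(1)] \<phi> by (simp add: quot_module_simps)
    qed
    then show ?thesis
      using ext a b by (auto simp: N Hom_module_simps module_homs_def PiE_iff)
  qed
  define W where "W = {\<phi> \<in> carrier ?N. \<exists>D p. good D p \<and> (\<forall>g\<in>J. \<phi> (?r g) = ?C (form D p g))}"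
  have TDW: "\<exists>D\<in>derivations BX. \<phi> = (\<lambda>x\<in>I. ?C (D x))" if "\<phi> \<in> ?TD" for \<phi>
    using that by (auto simp: trivial_deformations_def P_def)
  have TD: "\<phi> \<in> W" if "\<phi> \<in> ?TD" for \<phi>
  proof -
    obtain D where D: "D \<in> derivations BX" "\<phi> = (\<lambda>x\<in>I. ?C (D x))" using TDW[OF \<open>\<phi> \<in> ?TD\<close>] by blast
    have 1: "good D (\<lambda>u. 0)" using D P by (simp add: good_def subring_onD(1))
    have 2: "\<phi> (?r g) = ?C (form D (\<lambda>u. 0) g)" if "g \<in> J" for g using that D rJ by (simp add: form_def)
    have "\<phi> \<in> carrier ?N" by (rule form_hom[OF _ 1 2]) (simp only: D(2) restrict_extensional)
    then show ?thesis using 1 2 unfolding W_def by blast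
  qed
  have S: "alpha BX BU J \<xi> \<in> W" for \<xi>
  proof -
    have 1: "good (\<lambda>p. 0) (\<lambda>u. Const (\<xi> u))"
      using derivations_closed(1) by (auto simp: good_def P_def Const_in_polys)
    have 2: "alpha BX BU J \<xi> (?r g) = ?C (form (\<lambda>p. 0) (\<lambda>u. Const (\<xi> u)) g)" if "g \<in> J" for g
      using alpha_apply[OF fin dis J flat that] by (simp add: form_def P_def I)
    have "alpha BX BU J \<xi> \<in> carrier ?N" by (rule form_hom[OF _ 1 2]) (simp only: alpha_def I restrict_extensional)
    then show ?thesis using 1 2 unfolding W_def by blast
  qed
  have "W = carrier ?N"
  proof (rule quot_module_generated[OF modN])
    show "?TD \<subseteq> carrier ?N" using TD unfolding W_def by blast
    show "\<zero>\<^bsub>?N\<^esub> \<in> ?TD"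
      unfolding trivial_deformations_def
      by (rule image_eqI[OF _ derivations_closed(1)])
        (simp add: N Hom_module_simps quot_module_simps coset_zero P_def)
  next
    fix x y assume "x \<in> ?TD" "y \<in> ?TD"
    then obtain D D' where D: "D \<in> derivations BX" "x = (\<lambda>x\<in>I. ?C (D x))"
      "D' \<in> derivations BX" "y = (\<lambda>x\<in>I. ?C (D' x))" using TDW by blast
    show "x \<oplus>\<^bsub>?N\<^esub> y \<in> ?TD"
      unfolding trivial_deformations_def
      by (rule image_eqI[OF _ derivations_closed(2)[OF D(1,3)]])
        (auto simp: N Hom_module_simps D(2,4) add P_def[symmetric] intro!: restrict_ext)
  next
    fix r x assume "r \<in> carrier (ring_on P)" "x \<in> ?TD"
    then obtain D where D: "r \<in> P" "D \<in> derivations BX" "x = (\<lambda>x\<in>I. ?C (D x))" using TDW by auto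
    show "r \<odot>\<^bsub>?N\<^esub> x \<in> ?TD"
      unfolding trivial_deformations_def
      by (rule image_eqI[OF _ derivations_closed(3)[OF D(2) D(1)[unfolded P_def]]])
        (use D(1) in \<open>auto simp: N Hom_module_simps D(3) sm P_def[symmetric] intro!: restrict_ext\<close>)
  next
    show "generates (ring_on P) (quot_module ?N ?TD) ((\<lambda>x. ?TD +>\<^bsub>?N\<^esub> x) ` alpha BX BU J ` \<Xi>)"
      using gen by (simp add: T1_def T1_class_def P_def image_image)
    show "W \<subseteq> carrier ?N" "?TD \<subseteq> W" "alpha BX BU J ` \<Xi> \<subseteq> W" using TD S by (auto simp: W_def)
  next
    fix x y assume xy: "x \<in> W" "y \<in> W"
    interpret N: Module.module "ring_on P" ?N by (rule modN)
    obtain D p D' p' where 1: "good D p" "\<forall>g\<in>J. x (?r g) = ?C (form D p g)"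
      "good D' p'" "\<forall>g\<in>J. y (?r g) = ?C (form D' p' g)" using xy unfolding W_def by blast
    have "x \<oplus>\<^bsub>?N\<^esub> y \<in> carrier ?N" using xy unfolding W_def by simp
    moreover have "good (\<lambda>q. D q + D' q) (\<lambda>u. p u + p' u)"
      using 1 by (auto simp: good_def derivations_closed subring_onD(4)[OF P])
    moreover have "(x \<oplus>\<^bsub>?N\<^esub> y) (?r g) = ?C (form (\<lambda>q. D q + D' q) (\<lambda>u. p u + p' u) g)" if "g \<in> J" for g
      using 1 that rJ by (simp add: N Hom_module_simps add form_def distrib_right sum.distrib algebra_simps)
    ultimately show "x \<oplus>\<^bsub>?N\<^esub> y \<in> W" unfolding W_def by blast
  next
    fix r x assume rx: "r \<in> carrier (ring_on P)" "x \<in> W"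
    interpret N: Module.module "ring_on P" ?N by (rule modN)
    obtain D p where 1: "good D p" "\<forall>g\<in>J. x (?r g) = ?C (form D p g)" using rx unfolding W_def by blast
    have r: "r \<in> P" using rx by simp
    have "r \<odot>\<^bsub>?N\<^esub> x \<in> carrier ?N" using rx unfolding W_def by auto
    moreover have "good (\<lambda>q. r * D q) (\<lambda>u. r * p u)"
      using 1 r by (auto simp: good_def P_def derivations_closed polys_mult)
    moreover have "(r \<odot>\<^bsub>?N\<^esub> x) (?r g) = ?C (form (\<lambda>q. r * D q) (\<lambda>u. r * p u) g)" if "g \<in> J" for g
      using 1 that rJ r by (simp add: N Hom_module_simps sm form_def distrib_left sum_distrib_left mult.assoc)
    ultimately show "r \<odot>\<^bsub>?N\<^esub> x \<in> W" unfolding W_def by blast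
  qed
  then have "\<psi> \<in> W" using \<psi> by simp
  then show ?thesis unfolding W_def good_def form_def P_def by blast
qed

section \<open>Polynomials over the dual numbers\<close>

lemma dual_simps [simp]:
  "std 0 = 0" "eps 0 = 0" "std 1 = 1" "eps 1 = 0" "std (x + y) = std x + std y" "eps (x + y) = eps x + eps y"
  "std (x - y) = std x - std y" "eps (x - y) = eps x - eps y"
  "std (x * y) = std x * std y" "eps (x * y) = std x * eps y + eps x * std y"
  "Dual (std x) (eps x) = x" "Dual 0 0 = 0"
  by (simp_all add: zero_dual_number_def one_dual_number_def plus_dual_number_def minus_dual_number_def
      times_dual_number_def)

lemma Dual_eq_zero_iff [simp]: "Dual a b = 0 \<longleftrightarrow> a = 0 \<and> b = 0"
  by (simp only: zero_dual_number_def dual_number.inject)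

lemma Dual_arith:
  "Dual a b + Dual a' b' = Dual (a + a') (b + b')" "Dual a b * Dual a' b' = Dual (a * a') (a * b' + b * a')"
  "Dual a b - Dual a' b' = Dual (a - a') (b - b')"
  by (simp_all add: plus_dual_number_def minus_dual_number_def times_dual_number_def)

abbreviation emb :: "'k::comm_ring_1 \<Rightarrow> 'k dual_number" where "emb \<equiv> (\<lambda>c. Dual c 0)"

lemma hom_on_std: "hom_on R std" and hom_on_emb: "hom_on R' emb"
  by (simp_all add: hom_on_def Dual_arith one_dual_number_def)

lemma dual_unit:
  assumes "std (x :: 'k::field dual_number) \<noteq> 0"
  shows "x * Dual (inverse (std x)) (- eps x * inverse (std x) * inverse (std x)) = 1"
  using assms by (cases x) (simp add: Dual_arith one_dual_number_def)

definition dual_poly :: "('v, 'k::comm_ring_1) mpoly \<Rightarrow> ('v, 'k) mpoly \<Rightarrow> ('v, 'k dual_number) mpoly" where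
  "dual_poly p q = cmap emb p + Const (Dual 0 1) * cmap emb q"

lemma lookup_Const_mult: "lk (Const c * p) m = c * lk p (m :: 'v \<Rightarrow>\<^sub>0 nat)"
  by (simp add: mult_map_scale_conv_mult[symmetric] lookup_map)

lemma lookup_dual_poly: "lk (dual_poly p q) m = Dual (lk p m) (lk q m)"
  by (simp add: dual_poly_def lookup_add lookup_Const_mult lookup_map Dual_arith)

lemma dual_poly_std_eps: "dual_poly (cmap std q) (cmap eps q) = q"
  by (rule poly_mapping_eqI) (simp add: lookup_dual_poly lookup_map)

lemma map_std_dual_poly [simp]: "cmap std (dual_poly p q) = p"
  by (rule poly_mapping_eqI) (simp add: lookup_dual_poly lookup_map)

lemma map_eps_dual_poly [simp]: "cmap eps (dual_poly p q) = q"
  by (rule poly_mapping_eqI) (simp add: lookup_dual_poly lookup_map)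

lemma dual_poly_add: "dual_poly p q + dual_poly p' q' = dual_poly (p + p') (q + q')"
  by (rule poly_mapping_eqI) (simp add: lookup_dual_poly lookup_add Dual_arith)

lemma dual_poly_diff: "dual_poly p q - dual_poly p' q' = dual_poly (p - p') (q - q')"
  by (rule poly_mapping_eqI) (simp add: lookup_dual_poly lookup_minus Dual_arith)

lemma map_emb_mult:
  fixes p q :: "('v, 'k::comm_ring_1) mpoly"
  shows "cmap emb (p * q) = cmap emb p * cmap emb q"
  by (rule hom_onD(4)[OF hom_on_map[OF subring_on_UNIV hom_on_emb, of UNIV]]) (simp_all add: polys_iff)

lemma map_emb_add:
  fixes p q :: "('v, 'k::comm_ring_1) mpoly"
  shows "cmap emb (p + q) = cmap emb p + cmap emb q"
  by (rule hom_onD(3)[OF hom_on_map[OF subring_on_UNIV hom_on_emb, of UNIV]]) (simp_all add: polys_iff)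

lemma dual_poly_mult: "dual_poly p q * dual_poly p' q' = dual_poly (p * p') (p * q' + q * p')"
proof -
  define E :: "('a, 'b dual_number) mpoly" where "E = Const (Dual 0 1)"
  have E: "E * E = 0" by (simp add: E_def Const_mult[symmetric] Dual_arith)
  have "(a + E * b) * (a' + E * b') = a * a' + E * (a * b' + b * a')" for a b a' b'
  proof -
    have "(a + E * b) * (a' + E * b') = a * a' + E * (a * b' + b * a') + (E * E) * (b * b')"
      by (simp only: algebra_simps)
    then show ?thesis by (simp add: E)
  qed
  then show ?thesis
    unfolding dual_poly_def E_def[symmetric] map_emb_mult map_emb_add .
qed

lemma dual_poly_zero [simp]: "dual_poly 0 0 = 0"
  by (rule poly_mapping_eqI) (simp add: lookup_dual_poly)

lemma dual_poly_in_polys: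
  "dual_poly p q \<in> polys UNIV V \<longleftrightarrow> p \<in> polys UNIV V \<and> q \<in> polys UNIV V"
proof -
  have "ks (dual_poly p q) = ks p \<union> ks q"
    by (auto simp: in_keys_iff lookup_dual_poly)
  then show ?thesis by (auto simp: polys_iff)
qed

lemma component_dual_poly:
  "component d a (dual_poly p q) = dual_poly (component d a p) (component d a q)"
  by (rule poly_mapping_eqI) (simp add: lookup_component lookup_dual_poly)

section \<open>Derivations along the restriction map\<close>

text \<open>The infinitesimal coordinate change with direction \<open>w\<close>, restricted to \<open>\<k>[X]\<close>.\<close>

definition shift_hom ::
  "'y set \<Rightarrow> ('y \<Rightarrow> ('y, 'k::comm_ring_1) mpoly) \<Rightarrow> ('y, 'k) mpoly \<Rightarrow> ('y, 'k dual_number) mpoly" where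
  "shift_hom BX w = subst_poly emb (\<lambda>v. dual_poly (bar BX v) (w v))"

text \<open>The \<open>\<epsilon>\<close>-coefficient of the coordinate change is the derivation over the restriction map with values \<open>w v\<close> on the variables.\<close>

definition shift_der ::
  "'y set \<Rightarrow> ('y \<Rightarrow> ('y, 'k::comm_ring_1) mpoly) \<Rightarrow> ('y, 'k) mpoly \<Rightarrow> ('y, 'k) mpoly" where
  "shift_der BX w g = cmap eps (shift_hom BX w g)"

lemma hom_on_shift_hom: "hom_on UNIV (shift_hom BX w)"
  unfolding shift_hom_def by (rule hom_on_subst_poly[OF hom_on_emb])

text \<open>Two ring homomorphisms that agree on constants and variables are equal; this determines the part
  without \<open>\<epsilon>\<close>.\<close>

lemma shift_hom_eq:
  fixes g :: "('y, 'k::comm_ring_1) mpoly"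
  shows "shift_hom BX w g = dual_poly (restrict_poly BX g) (shift_der BX w g)"
proof -
  have m: "hom_on UNIV (cmap std :: ('y, 'k dual_number) mpoly \<Rightarrow> _)"
    using hom_on_map[OF subring_on_UNIV hom_on_std, of UNIV] by (simp add: polys_def)
  have "cmap std (shift_hom BX w g) = restrict_poly BX g"
  proof (rule hom_on_polys_unique[OF subring_on_UNIV, where V=UNIV and p=g
        and F="\<lambda>x. cmap std (shift_hom BX w x)" and G="restrict_poly BX"])
    show "hom_on (polys UNIV UNIV) (\<lambda>x. cmap std (shift_hom BX w x))"
      by (rule hom_on_comp[OF hom_on_subset[OF hom_on_shift_hom] m]) auto
    show "hom_on (polys UNIV UNIV) (restrict_poly BX :: ('y, 'k) mpoly \<Rightarrow> _)"
      by (rule hom_on_subset[OF hom_on_restrict_poly]) simp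
    show "cmap std (shift_hom BX w (Const c)) = restrict_poly BX (Const c)" for c :: 'k
      by (simp add: shift_hom_def subst_poly_Const restrict_poly_single)
    show "cmap std (shift_hom BX w (Var v)) = restrict_poly BX (Var v)" for v
      by (simp add: shift_hom_def subst_poly_Var[OF hom_on_emb] restrict_poly_Var)
  qed (simp add: polys_iff)
  then show ?thesis
    using dual_poly_std_eps[of "shift_hom BX w g"] by (simp add: shift_der_def)
qed

lemma shift_der_simps:
  "shift_der BX w (g + g') = shift_der BX w g + shift_der BX w g'"
  "shift_der BX w (g * g') = restrict_poly BX g * shift_der BX w g' + shift_der BX w g * restrict_poly BX g'"
  "shift_der BX w (Const c) = 0"
  "shift_der BX w (Var v) = w v"
proof -
  have "dual_poly (restrict_poly BX (g + g')) (shift_der BX w (g + g'))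
      = dual_poly (restrict_poly BX g) (shift_der BX w g) + dual_poly (restrict_poly BX g') (shift_der BX w g')"
    unfolding shift_hom_eq[symmetric] by (rule hom_onD(3)[OF hom_on_shift_hom]) auto
  from arg_cong[OF this, of "cmap eps"]
  show "shift_der BX w (g + g') = shift_der BX w g + shift_der BX w g'" by (simp add: dual_poly_add)
  have "dual_poly (restrict_poly BX (g * g')) (shift_der BX w (g * g'))
      = dual_poly (restrict_poly BX g) (shift_der BX w g) * dual_poly (restrict_poly BX g') (shift_der BX w g')"
    unfolding shift_hom_eq[symmetric] by (rule hom_onD(4)[OF hom_on_shift_hom]) auto
  from arg_cong[OF this, of "cmap eps"]
  show "shift_der BX w (g * g') = restrict_poly BX g * shift_der BX w g' + shift_der BX w g * restrict_poly BX g'"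
    by (simp add: dual_poly_mult)
  show "shift_der BX w (Const c) = 0"
    by (simp add: shift_der_def shift_hom_def subst_poly_Const)
  show "shift_der BX w (Var v) = w v"
    by (simp add: shift_der_def shift_hom_def subst_poly_Var[OF hom_on_emb])
qed

lemma shift_der_zero [simp]: "shift_der BX w 0 = 0"
  using shift_der_simps(3)[of BX w 0] by simp

lemma shift_der_sum: "shift_der BX w (sum f A) = (\<Sum>i\<in>A. shift_der BX w (f i))"
  by (induction A rule: infinite_finite_induct) (simp_all add: shift_der_simps)

text \<open>By the Leibniz rule, the polynomials on which two derivations agree modulo an ideal form a subring.\<close>

lemma shift_der_cong_ideal:
  assumes I: "ideal_on (polys UNIV BX) I" and w: "\<And>v. v \<in> V \<Longrightarrow> w v - w' v \<in> I" and g: "g \<in> polys UNIV V"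
  shows "shift_der BX w g - shift_der BX w' g \<in> I"
  using subring_on_UNIV g
proof (induction rule: polys_ring_induct)
  case (add p q)
  then have "(shift_der BX w p - shift_der BX w' p) + (shift_der BX w q - shift_der BX w' q) \<in> I"
    using ideal_onD(3)[OF I] by blast
  then show ?case by (simp add: shift_der_simps algebra_simps)
next
  case (mult p q)
  have "restrict_poly BX p * (shift_der BX w q - shift_der BX w' q)
     + restrict_poly BX q * (shift_der BX w p - shift_der BX w' p) \<in> I"
    using mult by (intro ideal_onD(3)[OF I] ideal_onD(4)[OF I]) (auto intro: restrict_poly_in_polys)
  then show ?case by (simp add: shift_der_simps algebra_simps)
qed (use ideal_onD(2)[OF I] w in \<open>auto simp: shift_der_simps\<close>)

text \<open>Replacing the values on the variables by their components of the same degree takes the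
  degree 0 part of a derivation. By additivity it suffices to treat monomials, one variable at a time.\<close>

lemma component_shift_der:
  fixes w :: "'y \<Rightarrow> ('y, 'k::comm_ring_1) mpoly"
  assumes w': "\<And>v. v \<in> V \<Longrightarrow> w' v = component d (d v) (w v)" and g: "g \<in> polys UNIV V" "homog d a g"
  shows "component d a (shift_der BX w g) = shift_der BX w' g"
proof -
  have bar: "homog d (d v) (bar BX v :: ('y, 'k) mpoly)" for v by (simp add: bar_def)
  have mono: "component d (mdeg d m) (shift_der BX w (mterm m c)) = shift_der BX w' (mterm m c)"
    if "ks m \<subseteq> V" for m c
    using that
  proof (induction m rule: monomial_induct)
    case zero
    then show ?case by (simp add: shift_der_simps)
  next
    case (add m v)
    let ?m = "mterm m c" and ?r = "restrict_poly BX"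
    have m: "mterm (m + mterm v 1) c = ?m * Var v" by (simp add: mult_single)
    have "homog d (mdeg d m) (?r ?m)" using homog_single[of d m c] by (simp add: restrict_poly_single)
    then have "component d (mdeg d m + d v) (?r ?m * w v) = ?r ?m * w' v"
      using w'[OF add(2)] by (simp add: component_homog_mult)
    moreover have "component d (mdeg d m + d v) (bar BX v * shift_der BX w ?m) = bar BX v * shift_der BX w' ?m"
      using add(3) by (simp add: component_homog_mult[OF bar])
    ultimately show ?case
      unfolding m by (simp add: shift_der_simps restrict_poly_Var component_add mdeg_add mult.commute)
  qed
  have "component d a (shift_der BX w g) = (\<Sum>m\<in>ks g. component d a (shift_der BX w (mterm m (lk g m))))"
    by (subst polys_sum_single[of g]) (simp only: shift_der_sum component_sum)
  also have "\<dots> = (\<Sum>m\<in>ks g. shift_der BX w' (mterm m (lk g m)))"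
    by (rule sum.cong) (use g mono in \<open>auto simp: homog_def polys_iff\<close>)
  also have "\<dots> = shift_der BX w' g"
    by (subst (2) polys_sum_single[of g]) (simp only: shift_der_sum)
  finally show ?thesis .
qed

text \<open>Both sides are derivations over the restriction map, so they need to be compared on constants and
  variables only.\<close>

lemma shift_der_decomposition:
  fixes D :: "('y, 'k::field) mpoly \<Rightarrow> ('y, 'k) mpoly"
  assumes fin: "finite BU" and dis: "BX \<inter> BU = {}" and D: "D \<in> derivations BX" and g: "g \<in> polys UNIV (BX \<union> BU)"
  shows "D (restrict_poly BX g) + (\<Sum>u\<in>BU. p u * u_coeff BU u g)
    = shift_der BX (\<lambda>v. if v \<in> BX then D (Var v) else p v) g"
    (is "?F g = shift_der BX ?w g")
  using subring_on_UNIV g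
proof (induction rule: polys_ring_induct)
  case (Const c)
  have "D (restrict_poly BX (Const c)) = 0" by (simp add: restrict_poly_single derivationsD(4)[OF D])
  moreover have "(\<Sum>u\<in>BU. p u * u_coeff BU u (Const c)) = 0"
    by (rule sum.neutral) (simp add: u_coeff_single)
  ultimately show ?case by (simp add: shift_der_simps)
next
  case (Var v)
  have u: "(\<Sum>u\<in>BU. p u * u_coeff BU u (Var v)) = (\<Sum>u\<in>BU. if u = v then p v else 0)"
    by (rule sum.cong) (auto simp: u_coeff_single)
  show ?case
  proof (cases "v \<in> BX")
    case True
    then have "v \<notin> BU" using dis by blast
    then have "(\<Sum>u\<in>BU. if u = v then p v else 0) = 0" by (intro sum.neutral) auto
    then show ?thesis using True u by (simp add: shift_der_simps restrict_poly_Var bar_def)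
  next
    case False
    then have "v \<in> BU" using Var by blast
    then have "(\<Sum>u\<in>BU. if u = v then p v else 0) = p v" using fin by simp
    moreover have "D 0 = 0" using derivationsD(4)[OF D, of 0] by simp
    ultimately show ?thesis using False u by (simp add: shift_der_simps restrict_poly_Var bar_def)
  qed
next
  case (add q q')
  have r: "restrict_poly BX q \<in> polys UNIV BX" "restrict_poly BX q' \<in> polys UNIV BX"
    using add restrict_poly_in_polys by blast+
  have "?F (q + q') = ?F q + ?F q'"
    by (simp add: restrict_poly_simps derivationsD(2)[OF D r] u_coeff_add distrib_left sum.distrib)
  then show ?case using add by (simp add: shift_der_simps)
next
  case (mult q q')
  let ?r = "restrict_poly BX"
  have r: "?r q \<in> polys UNIV BX" "?r q' \<in> polys UNIV BX"
    using mult restrict_poly_in_polys by blast+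
  have "(\<Sum>u\<in>BU. p u * u_coeff BU u (q * q')) =
    ?r q * (\<Sum>u\<in>BU. p u * u_coeff BU u q') + (\<Sum>u\<in>BU. p u * u_coeff BU u q) * ?r q'"
    using mult(1,2)
    by (simp add: u_coeff_mult[OF dis] sum_distrib_left sum_distrib_right sum.distrib[symmetric] algebra_simps)
  then have "?F (q * q') = ?r q * D (?r q') + ?r q' * D (?r q) +
      (?r q * (\<Sum>u\<in>BU. p u * u_coeff BU u q') + (\<Sum>u\<in>BU. p u * u_coeff BU u q) * ?r q')"
    by (simp only: restrict_poly_simps derivationsD(3)[OF D r])
  then have "?F (q * q') = ?r q * ?F q' + ?F q * ?r q'"
    by (simp only: algebra_simps)
  then show ?case using mult by (simp add: shift_der_simps)
qed

section \<open>Tangent vectors of the Hilbert scheme\<close>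

text \<open>By homogeneity, \<open>q\<close> may be taken of some degree \<open>a\<close>. As \<open>\<k>[\<epsilon>]\<close> is local, the quotient is free in
  this degree; if \<open>\<Sum> c\<^sub>i b\<^sub>i\<close> expresses \<open>q\<close> in a basis, then \<open>\<epsilon>q \<in> K\<close> gives \<open>\<epsilon>c\<^sub>i = 0\<close>, so the
  \<open>c\<^sub>i\<close> are multiples of \<open>\<epsilon>\<close> and \<open>q\<close> is the reduction of \<open>q - \<Sum> c\<^sub>i b\<^sub>i \<in> K\<close>.\<close>

lemma hilb_dual_eps:
  fixes K :: "('v, 'k::field dual_number) mpoly set"
  assumes K: "homogeneous_ideal UNIV V d K"
    and lf: "\<And>a. locally_free_of_rank (ring_on UNIV) (graded_quot UNIV V d K a) (h a)"
    and q: "dual_poly 0 q \<in> K"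
  shows "q \<in> cmap std ` K"
proof -
  note S = subring_on_UNIV
  note KD = homogeneous_idealD[OF S K]
  let ?e = "Const (Dual 0 1) :: ('v, 'k dual_number) mpoly" and ?s = "cmap std"
  have qP: "q \<in> polys UNIV V" using ideal_onD(1)[OF KD(1) q] by (simp add: dual_poly_in_polys)
  have hs: "hom_on (polys UNIV V) (?s :: ('v, 'k dual_number) mpoly \<Rightarrow> _)" by (rule hom_on_map[OF S hom_on_std])
  note PS = subring_polys[OF S, of V]
  have Kid: "base_change UNIV V (\<lambda>x. x) K = K"
  proof -
    have "cmap (\<lambda>x. x) p = p" for p :: "('v, 'k dual_number) mpoly"
      by (rule poly_mapping_eqI) (simp add: lookup_map)
    then show ?thesis using Idl_ideal_eq[OF PS KD(1)] by (simp add: base_change_def)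
  qed
  have comp: "\<exists>k\<in>K. ?s k = component d a q" for a
  proof -
    obtain G where G: "Idl\<^bsub>ring_on UNIV\<^esub> G = UNIV"
      "\<And>g. g \<in> G \<Longrightarrow> free_on_basic_open (ring_on UNIV) (graded_quot UNIV V d K a) g (h a)"
      using lf[of a] by (auto simp: locally_free_of_rank_def)
    have "\<exists>g\<in>G. (\<lambda>x. x) g \<notin> {x. std x = 0}"
      by (rule exists_unit_generator[OF S hom_on_id _ _ _ G(1)]) (auto simp: ideal_on_def)
    then obtain g where g: "g \<in> G" "std g \<noteq> 0" by auto
    obtain b where b: "\<forall>i<h a. b i \<in> poly_piece UNIV V d a"
      "\<forall>y\<in>poly_piece UNIV V d a. \<exists>c. y - lincomb c b (h a) \<in> K"
      "\<forall>c. lincomb c b (h a) \<in> K \<longrightarrow> (\<forall>i<h a. c i = 0)"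
      using base_change_free[OF S hom_on_id K UNIV_I dual_unit[OF g(2)] G(2)[OF g(1)]] unfolding Kid by blast
    let ?y = "cmap emb (component d a q)"
    have y: "?y \<in> poly_piece UNIV V d a"
      using map_in_polys[of emb UNIV UNIV] component_in_polys[OF S qP]
      by (auto simp: poly_piece_iff homog_map homog_component)
    then obtain c where c: "?y - lincomb c b (h a) \<in> K" using b(2) by blast
    have eP: "?e \<in> polys UNIV V" by (rule Const_in_polys[OF S UNIV_I])
    have "?e * ?y = component d a (dual_poly 0 q)"
      unfolding component_dual_poly by (simp add: dual_poly_def map_zero)
    then have "?e * ?y \<in> K" using KD(2)[OF q] by simp
    from ideal_on_diff[OF KD(1) PS this ideal_onD(4)[OF KD(1) eP c]]
    have "?e * lincomb c b (h a) \<in> K" by (simp add: right_diff_distrib)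
    then have "lincomb (\<lambda>i. Dual 0 1 * c i) b (h a) \<in> K" by (simp add: lincomb_linear(1))
    then have z: "Dual 0 1 * c i = 0" if "i < h a" for i using b(3) that by blast
    have sc: "std (c i) = 0" if "i < h a" for i
      using arg_cong[OF z[OF that], of eps] by simp
    have "?s (lincomb c b (h a)) = lincomb (\<lambda>i. std (c i)) (\<lambda>i. ?s (b i)) (h a)"
      by (rule map_lincomb[OF S hom_on_std UNIV_I, of _ _ V]) (use b(1) in \<open>simp add: poly_piece_iff\<close>)
    also have "\<dots> = 0" using sc by (simp add: lincomb_def)
    finally have "?s (lincomb c b (h a)) = 0" .
    moreover have "lincomb c b (h a) \<in> polys UNIV V"
      unfolding lincomb_def using b(1)
      by (intro subring_on_sum[OF PS] polys_mult[OF S] Const_in_polys[OF S]) (auto simp: poly_piece_iff)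
    moreover have "?s ?y = component d a q"
      by (rule poly_mapping_eqI) (simp add: lookup_map)
    ultimately have "?s (?y - lincomb c b (h a)) = component d a q"
      using y by (simp add: hom_on_diff[OF hs PS] poly_piece_iff)
    then show ?thesis using c by blast
  qed
  then obtain k where k: "\<And>a. k a \<in> K" "\<And>a. ?s (k a) = component d a q" by metis
  have "?s (\<Sum>a\<in>mdeg d ` ks q. k a) = (\<Sum>a\<in>mdeg d ` ks q. component d a q)"
    using k ideal_onD(1)[OF KD(1)] by (simp add: hom_on_sum[OF hs PS])
  moreover have "(\<Sum>a\<in>mdeg d ` ks q. k a) \<in> K" by (rule ideal_on_sum[OF KD(1) k(1)])
  ultimately show ?thesis using component_sum_eq[of q d] by (metis image_eqI)
qed

text \<open>Reduction modulo \<open>\<epsilon>\<close> is surjective, so the image of an ideal is already an ideal.\<close>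

lemma base_change_std_eq:
  fixes K :: "('v, 'k::field dual_number) mpoly set"
  assumes K: "ideal_on (polys UNIV V) K"
  shows "base_change UNIV V std K = cmap std ` K"
proof -
  note S = subring_on_UNIV
  note PS = subring_polys[OF S, of V]
  have hs: "hom_on (polys UNIV V) (cmap std :: ('v, 'k dual_number) mpoly \<Rightarrow> _)"
    by (rule hom_on_map[OF S hom_on_std])
  have "ideal_on (polys UNIV V) (cmap std ` K)"
    unfolding ideal_on_def
  proof (intro conjI ballI)
    show "cmap std ` K \<subseteq> polys UNIV V"
      using map_in_polys[of std UNIV UNIV] ideal_onD(1)[OF K] by auto
    show "0 \<in> cmap std ` K"
      using ideal_onD(2)[OF K] map_zero[of std] by (metis image_eqI)
  next
    fix x y assume "x \<in> cmap std ` K" "y \<in> cmap std ` K"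
    then obtain p q where pq: "p \<in> K" "q \<in> K" "x = cmap std p" "y = cmap std q" by blast
    then have "x + y = cmap std (p + q)" using hom_onD(3)[OF hs] ideal_onD(1)[OF K] by simp
    then show "x + y \<in> cmap std ` K" using ideal_onD(3)[OF K pq(1,2)] by blast
  next
    fix r x :: "('v, 'k) mpoly" assume r: "r \<in> polys UNIV V" and "x \<in> cmap std ` K"
    then obtain p where p: "p \<in> K" "x = cmap std p" by blast
    have rP: "dual_poly r 0 \<in> polys UNIV V" using r by (simp add: dual_poly_in_polys polys_zero)
    have "r * x = cmap std (dual_poly r 0 * p)"
      using p hom_onD(4)[OF hs rP] ideal_onD(1)[OF K] by simp
    then show "r * x \<in> cmap std ` K" using ideal_onD(4)[OF K rP p(1)] by blast
  qed
  then show ?thesis unfolding base_change_def by (rule Idl_ideal_eq[OF PS])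
qed

text \<open>Two elements \<open>x + \<epsilon>q\<close> and \<open>x + \<epsilon>q'\<close> of \<open>K\<close> differ by \<open>\<epsilon>(q - q')\<close>, so \<open>q\<close> is determined
  by \<open>x\<close> modulo \<open>I\<close>.\<close>

lemma tangent_vector_normal:
  fixes K :: "('v, 'k::field dual_number) mpoly set"
  assumes K: "ideal_on (polys UNIV V) K" and I: "ideal_on (polys UNIV V) I"
    and KI: "cmap std ` K = I" and eps: "\<And>q. dual_poly 0 q \<in> K \<longleftrightarrow> q \<in> I"
  shows "\<exists>\<psi>\<in>carrier (normal_module V I). \<forall>x q. dual_poly x q \<in> K \<longrightarrow> \<psi> x = coset (polys UNIV V) I q"
proof -
  define P :: "('v, 'k) mpoly set" where "P = polys UNIV V"
  have P: "subring_on P" by (simp add: P_def subring_polys)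
  note I' = I[folded P_def]
  note A = ideal_on_additive[OF I' P]
  let ?C = "coset P I" and ?Q = "quot_module (module_on (*) P) I"
  have add: "?C p \<oplus>\<^bsub>?Q\<^esub> ?C q = ?C (p + q)" for p q by (rule quot_module_add[OF A])
  have sm: "r \<odot>\<^bsub>?Q\<^esub> ?C p = ?C (r * p)" if "r \<in> P" for r p
    by (rule quot_module_smult[OF A refl]) (rule ideal_onD(4)[OF I' that])
  have ex: "\<exists>q. dual_poly x q \<in> K" if "x \<in> I" for x
  proof -
    obtain k where "k \<in> K" "x = cmap std k" using \<open>x \<in> I\<close> KI by blast
    then show ?thesis using dual_poly_std_eps[of k] by metis
  qed
  have xI: "x \<in> I" and qP: "q \<in> P" if "dual_poly x q \<in> K" for x q
  proof -
    show "x \<in> I" using that KI map_std_dual_poly by (metis image_eqI)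
    show "q \<in> P" using ideal_onD(1)[OF K that] by (simp add: dual_poly_in_polys P_def)
  qed
  have uniq: "?C q = ?C q'" if "dual_poly x q \<in> K" "dual_poly x q' \<in> K" for x q q'
    using ideal_on_diff[OF K subring_polys[OF subring_on_UNIV] that] eps
    by (simp add: dual_poly_diff coset_eq_iff[OF A])
  define \<psi> where "\<psi> = (\<lambda>x\<in>I. ?C (SOME q. dual_poly x q \<in> K))"
  have \<psi>: "\<psi> x = ?C q" if "dual_poly x q \<in> K" for x q
  proof -
    have "dual_poly x (SOME q. dual_poly x q \<in> K) \<in> K" by (rule someI[of "\<lambda>q. dual_poly x q \<in> K", OF that])
    then show ?thesis using uniq[OF _ that] xI[OF that] by (simp add: \<psi>_def)
  qed
  have "\<psi> \<in> carrier (normal_module V I)"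
    unfolding normal_module_def P_def[symmetric] Hom_module_simps module_homs_def
  proof (intro CollectI conjI ballI)
    show "\<psi> \<in> carrier (module_on (*) I) \<rightarrow>\<^sub>E carrier ?Q"
    proof (rule PiE_I)
      fix x assume "x \<in> carrier (module_on (*) I)"
      then obtain q where "dual_poly x q \<in> K" using ex by auto
      then show "\<psi> x \<in> carrier ?Q" using \<psi> qP by (simp add: quot_module_simps)
    qed (simp add: \<psi>_def)
  next
    fix x y assume "x \<in> carrier (module_on (*) I)" "y \<in> carrier (module_on (*) I)"
    then obtain q q' where q: "dual_poly x q \<in> K" "dual_poly y q' \<in> K" using ex by force
    have "dual_poly (x + y) (q + q') \<in> K" using ideal_onD(3)[OF K q] by (simp add: dual_poly_add)
    then show "\<psi> (x \<oplus>\<^bsub>module_on (*) I\<^esub> y) = \<psi> x \<oplus>\<^bsub>?Q\<^esub> \<psi> y" using \<psi> q by (simp add: add)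
  next
    fix r x assume r: "r \<in> carrier (ring_on P)" and "x \<in> carrier (module_on (*) I)"
    then obtain q where q: "dual_poly x q \<in> K" using ex by auto
    have "dual_poly r 0 \<in> polys UNIV V" using r by (simp add: dual_poly_in_polys polys_zero P_def)
    from ideal_onD(4)[OF K this q] have "dual_poly (r * x) (r * q) \<in> K" by (simp add: dual_poly_mult)
    then show "\<psi> (r \<odot>\<^bsub>module_on (*) I\<^esub> x) = r \<odot>\<^bsub>?Q\<^esub> \<psi> x" using \<psi> q r by (simp add: sm)
  qed
  then show ?thesis using \<psi> unfolding P_def by blast
qed

section \<open>The localized coordinate ring\<close>

lemma Fract_power_add:
  fixes f :: "'r::idom" assumes "f \<noteq> 0"
  shows "Fract p (f ^ m) + Fract p' (f ^ m') = Fract (p * f ^ m' + p' * f ^ m) (f ^ (m + m'))"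
  using assms by (simp add: power_add)

lemma Fract_power_mult:
  fixes f :: "'r::idom"
  shows "Fract p (f ^ m) * Fract p' (f ^ m') = Fract (p * p') (f ^ (m + m'))"
  by (simp add: power_add)

lemma Fract_in_localized: "p \<in> polys UNIV {..<n} \<Longrightarrow> Fract p (f ^ m) \<in> localized n f"
  by (auto simp: localized_def)

lemma Fract_one_in_localized: "p \<in> polys UNIV {..<n} \<Longrightarrow> Fract p 1 \<in> localized n f"
  using Fract_in_localized[of p n f 0] by simp

lemma subring_localized:
  assumes f: "f \<in> polys UNIV {..<n}" "f \<noteq> 0"
  shows "subring_on (localized n f)"
proof -
  have Q: "subring_on (polys UNIV {..<n} :: (nat, 'a) mpoly set)" by (simp add: subring_polys)
  note Qc = subring_onD[OF Q]
  show ?thesis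
    unfolding subring_on_def
  proof (intro conjI ballI)
    show "0 \<in> localized n f" using Fract_one_in_localized[OF Qc(1), of f] by (simp add: Zero_fract_def)
    show "1 \<in> localized n f" using Fract_one_in_localized[OF Qc(2), of f] by (simp add: One_fract_def)
  next
    fix x assume "x \<in> localized n f"
    then obtain p m where "p \<in> polys UNIV {..<n}" "x = Fract p (f ^ m)" by (auto simp: localized_def)
    then show "- x \<in> localized n f" using Fract_in_localized[OF Qc(3)] by simp
  next
    fix x y assume "x \<in> localized n f" "y \<in> localized n f"
    then obtain p m p' m' where p: "p \<in> polys UNIV {..<n}" "x = Fract p (f ^ m)"
      "p' \<in> polys UNIV {..<n}" "y = Fract p' (f ^ m')" by (auto simp: localized_def)
    show "x + y \<in> localized n f"
      unfolding p(2,4) Fract_power_add[OF f(2)]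
      by (intro Fract_in_localized Qc(4,5,7) p f(1))
    show "x * y \<in> localized n f"
      unfolding p(2,4) Fract_power_mult by (intro Fract_in_localized Qc(5) p)
  qed
qed

lemma hom_on_Fract: "hom_on R (\<lambda>p::'r::idom. Fract p 1)"
  by (simp add: hom_on_def Zero_fract_def One_fract_def)

text \<open>The universal property of the localization, in the form in which the origin is
  defined: the value at \<open>p/f\<^sup>m\<close> is \<open>\<phi>(p) e\<^sup>m\<close>, where \<open>e\<close> is the inverse of \<open>\<phi>(f)\<close>.\<close>

definition localized_extension ::
  "nat \<Rightarrow> (nat, 'k::field) mpoly \<Rightarrow> ((nat, 'k) mpoly \<Rightarrow> 's::comm_ring_1) \<Rightarrow> 's \<Rightarrow> (nat, 'k) mpoly fract \<Rightarrow> 's" where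
  "localized_extension n f \<phi> e q =
     (THE c. \<exists>p m. p \<in> polys UNIV {..<n} \<and> q = Fract p (f ^ m) \<and> c = \<phi> p * e ^ m)"

lemma localized_extension:
  fixes f :: "(nat, 'k::field) mpoly" and \<phi> :: "(nat, 'k) mpoly \<Rightarrow> 's::comm_ring_1"
  assumes f: "f \<in> polys UNIV {..<n}" "f \<noteq> 0" and \<phi>: "hom_on (polys UNIV {..<n}) \<phi>" and e: "\<phi> f * e = 1"
  shows "p \<in> polys UNIV {..<n} \<Longrightarrow> localized_extension n f \<phi> e (Fract p (f ^ m)) = \<phi> p * e ^ m"
    and "p \<in> polys UNIV {..<n} \<Longrightarrow> localized_extension n f \<phi> e (Fract p 1) = \<phi> p"
    and "hom_on (localized n f) (localized_extension n f \<phi> e)"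
proof -
  let ?Q = "polys UNIV {..<n} :: (nat, 'k) mpoly set" and ?F = "localized_extension n f \<phi> e"
  have Q: "subring_on ?Q" by (simp add: subring_polys)
  note Qc = subring_onD[OF Q]
  have fe: "\<phi> (f ^ m) * e ^ m = 1" for m
    using e by (simp add: hom_on_power[OF \<phi> Q f(1)] power_mult_distrib[symmetric])
  have uniq: "\<phi> p * e ^ m = \<phi> p' * e ^ m'"
    if p: "p \<in> ?Q" "p' \<in> ?Q" "Fract p (f ^ m) = Fract p' (f ^ m')" for p p' m m'
  proof -
    have "p * f ^ m' = p' * f ^ m" using p(3) f(2) by (simp add: eq_fract)
    then have eq: "\<phi> p * \<phi> (f ^ m') = \<phi> p' * \<phi> (f ^ m)"
      using hom_onD(4)[OF \<phi>] p Qc(7)[OF f(1)] by metis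
    have "\<phi> p * e ^ m = \<phi> p * e ^ m * (\<phi> (f ^ m') * e ^ m')" by (simp add: fe)
    also have "\<dots> = (\<phi> p * \<phi> (f ^ m')) * (e ^ m * e ^ m')" by (simp only: mult_ac)
    also have "\<dots> = (\<phi> p' * \<phi> (f ^ m)) * (e ^ m * e ^ m')" by (simp only: eq)
    also have "\<dots> = \<phi> p' * e ^ m' * (\<phi> (f ^ m) * e ^ m)" by (simp only: mult_ac)
    finally show ?thesis by (simp add: fe)
  qed
  show 1: "?F (Fract p (f ^ m)) = \<phi> p * e ^ m" if "p \<in> ?Q" for p m
    unfolding localized_extension_def
  proof (rule the_equality)
    show "\<exists>p' m'. p' \<in> ?Q \<and> Fract p (f ^ m) = Fract p' (f ^ m') \<and> \<phi> p * e ^ m = \<phi> p' * e ^ m'"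
      using that by blast
    fix c assume "\<exists>p' m'. p' \<in> ?Q \<and> Fract p (f ^ m) = Fract p' (f ^ m') \<and> c = \<phi> p' * e ^ m'"
    then show "c = \<phi> p * e ^ m" using uniq[OF that] by metis
  qed
  show 2: "?F (Fract p 1) = \<phi> p" if "p \<in> ?Q" for p using 1[OF that, of 0] by simp
  show "hom_on (localized n f) ?F"
    unfolding hom_on_def
  proof (intro conjI ballI)
    show "?F 0 = 0" using 2[OF Qc(1)] hom_onD(1)[OF \<phi>] by (simp add: Zero_fract_def)
    show "?F 1 = 1" using 2[OF Qc(2)] hom_onD(2)[OF \<phi>] by (simp add: One_fract_def)
  next
    fix x y assume "x \<in> localized n f" "y \<in> localized n f"
    then obtain p m p' m' where p: "p \<in> ?Q" "x = Fract p (f ^ m)"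
      "p' \<in> ?Q" "y = Fract p' (f ^ m')" by (auto simp: localized_def)
    have fm: "f ^ m \<in> ?Q" "f ^ m' \<in> ?Q" using Qc(7)[OF f(1)] by auto
    have "?F (x + y) = \<phi> (p * f ^ m' + p' * f ^ m) * e ^ (m + m')"
      unfolding p(2,4) Fract_power_add[OF f(2)] by (rule 1) (intro Qc(4,5) p fm)
    also have "\<phi> (p * f ^ m' + p' * f ^ m) = \<phi> p * \<phi> (f ^ m') + \<phi> p' * \<phi> (f ^ m)"
      using p fm by (simp add: hom_onD(3,4)[OF \<phi>] Qc(5))
    also have "(\<phi> p * \<phi> (f ^ m') + \<phi> p' * \<phi> (f ^ m)) * e ^ (m + m')
        = \<phi> p * e ^ m * (\<phi> (f ^ m') * e ^ m') + \<phi> p' * e ^ m' * (\<phi> (f ^ m) * e ^ m)"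
      by (simp only: power_add algebra_simps)
    finally show "?F (x + y) = ?F x + ?F y" unfolding p(2,4) by (simp add: fe 1[OF p(1)] 1[OF p(3)])
    have "?F (x * y) = \<phi> (p * p') * e ^ (m + m')"
      unfolding p(2,4) Fract_power_mult by (rule 1) (intro Qc(5) p)
    also have "\<phi> (p * p') = \<phi> p * \<phi> p'" using p by (simp add: hom_onD(4)[OF \<phi>])
    finally show "?F (x * y) = ?F x * ?F y"
      unfolding p(2,4) by (simp add: 1[OF p(1)] 1[OF p(3)] power_add mult_ac)
  qed
qed

lemma hom_on_lookup_zero: "hom_on R (\<lambda>p :: ('v, 'k::comm_ring_1) mpoly. lk p 0)"
  by (simp add: hom_on_def lookup_add lookup_mult_zero_single)

lemma origin_eq: "origin n f = localized_extension n f (\<lambda>p. lk p 0) (inverse (lk f 0))"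
  by (rule ext) (simp add: origin_def localized_extension_def divide_inverse power_inverse)

section \<open>Specializing the family\<close>

lemma tau_arg_in_polys:
  fixes t :: "nat \<Rightarrow> 'y \<Rightarrow> ('y, 'k::field) mpoly"
  assumes t: "\<And>i. i < n \<Longrightarrow> t i v \<in> polys UNIV BX"
  shows "bar BX v + (\<Sum>i<n. cmap Const (t i v) * Const (Var i)) \<in> polys (polys UNIV {..<n}) BX"
proof -
  have Q: "subring_on (polys UNIV {..<n} :: (nat, 'k) mpoly set)" by (simp add: subring_polys)
  have "cmap Const (t i v) \<in> polys (polys UNIV {..<n}) BX" if "i < n" for i
    by (rule map_in_polys[OF _ _ t[OF that]]) (auto intro: Const_in_polys)
  then show ?thesis
    by (intro polys_add[OF Q] bar_in_polys[OF Q] subring_on_sum[OF subring_polys[OF Q]] polys_mult[OF Q]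
        Const_in_polys[OF Q] Var_in_polys) auto
qed

lemma hom_on_Const: "hom_on UNIV (Const :: 'k::comm_ring_1 \<Rightarrow> ('v, 'k) mpoly)"
  by (simp add: hom_on_def single_add Const_mult)

lemma tau_in_polys:
  assumes "\<And>i v. i < n \<Longrightarrow> t i v \<in> polys UNIV BX" "g \<in> polys UNIV V"
  shows "tau BX n t g \<in> polys (polys UNIV {..<n}) BX"
  unfolding tau_def
  by (rule subst_poly_in_polys[OF subring_polys[OF subring_on_UNIV] hom_on_Const _ tau_arg_in_polys assms(2)])
    (use assms(1) in \<open>auto intro: Const_in_polys\<close>)

lemma map_tau:
  fixes t :: "nat \<Rightarrow> 'y \<Rightarrow> ('y, 'k::field) mpoly"
  assumes t: "\<And>i v. i < n \<Longrightarrow> t i v \<in> polys UNIV BX" and g: "g \<in> polys UNIV V"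
    and \<chi>: "hom_on (polys UNIV {..<n}) \<chi>"
  shows "cmap \<chi> (tau BX n t g) = subst_poly (\<lambda>c. \<chi> (Const c))
    (\<lambda>v. bar BX v + (\<Sum>i<n. cmap (\<lambda>c. \<chi> (Const c)) (t i v) * Const (\<chi> (Var i)))) g"
proof -
  have Q: "subring_on (polys UNIV {..<n} :: (nat, 'k) mpoly set)" by (simp add: subring_polys)
  have QX: "subring_on (polys (polys UNIV {..<n} :: (nat, 'k) mpoly set) BX)" by (rule subring_polys[OF Q])
  note hm = hom_on_map[OF Q \<chi>, of BX]
  have 1: "cmap \<chi> (tau BX n t g) = subst_poly (\<lambda>c. \<chi> (Const c))
    (\<lambda>v. cmap \<chi> (bar BX v + (\<Sum>i<n. cmap Const (t i v) * Const (Var i)))) g"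
    unfolding tau_def
    by (rule map_subst_poly[OF Q \<chi> hom_on_Const _ tau_arg_in_polys g])
      (use t in \<open>auto intro: Const_in_polys\<close>)
  have "cmap \<chi> (bar BX v + (\<Sum>i<n. cmap Const (t i v) * Const (Var i)))
      = bar BX v + (\<Sum>i<n. cmap (\<lambda>c. \<chi> (Const c)) (t i v) * Const (\<chi> (Var i)))" for v
  proof -
    have m: "cmap Const (t i v) \<in> polys (polys UNIV {..<n}) BX" if "i < n" for i
      by (rule map_in_polys[OF _ _ t[OF that]]) (auto intro: Const_in_polys)
    have c: "Const (Var i) \<in> polys (polys UNIV {..<n} :: (nat, 'k) mpoly set) BX" if "i < n" for i
      by (rule Const_in_polys[OF Q Var_in_polys]) (use that in auto)
    have s: "cmap Const (t i v) * Const (Var i) \<in> polys (polys UNIV {..<n}) BX" if "i < n" for i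
      using m c that by (intro polys_mult[OF Q])
    have sum: "(\<Sum>i<n. cmap Const (t i v) * Const (Var i)) \<in> polys (polys UNIV {..<n}) BX"
      by (rule subring_on_sum[OF QX]) (use s in simp)
    have map_sum: "cmap \<chi> (\<Sum>i<n. cmap Const (t i v) * Const (Var i))
      = (\<Sum>i<n. cmap \<chi> (cmap Const (t i v) * Const (Var i)))"
      by (rule hom_on_sum[OF hm QX]) (use s in simp)
    have "cmap \<chi> (bar BX v + (\<Sum>i<n. cmap Const (t i v) * Const (Var i)))
      = cmap \<chi> (bar BX v) + (\<Sum>i<n. cmap \<chi> (cmap Const (t i v) * Const (Var i)))"
      by (simp only: hom_onD(3)[OF hm bar_in_polys[OF Q] sum] map_sum)
    also have "cmap \<chi> (bar BX v) = bar BX v"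
      using hom_onD(1,2)[OF \<chi>] by (simp add: bar_def map_zero)
    also have "(\<Sum>i<n. cmap \<chi> (cmap Const (t i v) * Const (Var i)))
      = (\<Sum>i<n. cmap (\<lambda>c. \<chi> (Const c)) (t i v) * Const (\<chi> (Var i)))"
      by (rule sum.cong)
        (use hom_onD(1)[OF \<chi>] m c in \<open>auto simp: hom_onD(4)[OF hm] map_map_poly\<close>)
    finally show ?thesis .
  qed
  then show ?thesis unfolding 1 by simp
qed

lemma component_tau:
  fixes t :: "nat \<Rightarrow> 'y \<Rightarrow> ('y, 'k::field) mpoly"
  assumes t: "\<And>i v. i < n \<Longrightarrow> v \<in> V \<Longrightarrow> homog d (d v) (t i v)" and g: "g \<in> polys UNIV V"
  shows "component d a (tau BX n t g) = tau BX n t (component d a g)"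
  unfolding tau_def
proof (rule component_subst_poly[OF hom_on_Const _ g])
  fix v assume v: "v \<in> V"
  have "homog d (d v + 0) (cmap Const (t i v) * Const (Var i) :: ('y, (nat, 'k) mpoly) mpoly)" if "i < n" for i
    by (rule homog_mult[OF homog_map[OF t[OF that v]] homog_Const])
  then show "homog d (d v) (bar BX v + (\<Sum>i<n. cmap Const (t i v) * Const (Var i)) :: ('y, (nat, 'k) mpoly) mpoly)"
    by (intro homog_add homog_sum) (auto simp: bar_def)
qed

text \<open>A pullback of the localized family is generated by the specialized coordinate changes of the elements
  of \<open>J\<close>, because these generate the family already over \<open>\<k>[T\<^sup>*]\<close>.\<close>

lemma base_change_J_tilde_loc:
  fixes t :: "nat \<Rightarrow> 'y \<Rightarrow> ('y, 'k::field) mpoly" and \<phi> :: "(nat, 'k) mpoly fract \<Rightarrow> 's::comm_ring_1"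
  assumes f: "f \<in> polys UNIV {..<n}" "f \<noteq> 0" and \<phi>: "hom_on (localized n f) \<phi>"
    and t: "\<And>i v. i < n \<Longrightarrow> t i v \<in> polys UNIV BX" and J: "J \<subseteq> polys UNIV V"
  shows "base_change UNIV BX \<phi> (J_tilde_loc BX n t f J)
    = Idl\<^bsub>ring_on (polys UNIV BX)\<^esub> ((\<lambda>g. cmap (\<lambda>p. \<phi> (Fract p 1)) (tau BX n t g)) ` J)"
proof -
  have Q: "subring_on (polys UNIV {..<n} :: (nat, 'k) mpoly set)" by (simp add: subring_polys)
  note L = subring_localized[OF f]
  have FL: "(\<lambda>p. Fract p 1) ` polys UNIV {..<n} \<subseteq> localized n f" using Fract_one_in_localized by blast
  have X: "tau BX n t ` J \<subseteq> polys (polys UNIV {..<n}) BX" by (auto intro!: tau_in_polys[where V=V] t subsetD[OF J])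
  note I = Idl_facts(1)[OF subring_polys[OF Q] X]
  have \<chi>: "hom_on (polys UNIV {..<n}) (\<lambda>p. \<phi> (Fract p 1))" by (rule hom_on_comp[OF hom_on_Fract \<phi> FL])
  have "base_change UNIV BX \<phi> (J_tilde_loc BX n t f J) = base_change UNIV BX (\<lambda>p. \<phi> (Fract p 1)) (J_tilde BX n t J)"
    unfolding J_tilde_loc_def
    by (rule base_change_base_change[OF Q L subring_on_UNIV hom_on_Fract FL \<phi>])
      (use ideal_onD(1)[OF I] in \<open>auto simp: J_tilde_def\<close>)
  also have "\<dots> = Idl\<^bsub>ring_on (polys UNIV BX)\<^esub> (cmap (\<lambda>p. \<phi> (Fract p 1)) ` tau BX n t ` J)"
    unfolding J_tilde_def by (rule base_change_Idl[OF Q subring_on_UNIV \<chi> _ X]) simp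
  finally show ?thesis by (simp add: image_image)
qed

lemma homogeneous_ideal_J_tilde_loc:
  fixes t :: "nat \<Rightarrow> 'y \<Rightarrow> ('y, 'k::field) mpoly"
  assumes f: "f \<in> polys UNIV {..<n}" "f \<noteq> 0"
    and t: "\<And>i v. i < n \<Longrightarrow> t i v \<in> polys UNIV BX" "\<And>i v. i < n \<Longrightarrow> v \<in> V \<Longrightarrow> homog d (d v) (t i v)"
    and J: "homogeneous_ideal UNIV V d J"
  shows "homogeneous_ideal (localized n f) BX d (J_tilde_loc BX n t f J)"
proof -
  have Q: "subring_on (polys UNIV {..<n} :: (nat, 'k) mpoly set)" by (simp add: subring_polys)
  note JD = homogeneous_idealD[OF subring_on_UNIV J]
  have "homogeneous_ideal (polys UNIV {..<n}) BX d (J_tilde BX n t J)"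
    unfolding J_tilde_def
  proof (rule homogeneous_ideal_Idl[OF Q])
    show "tau BX n t ` J \<subseteq> polys (polys UNIV {..<n}) BX" by (auto intro!: tau_in_polys[where V=V] t(1) ideal_onD(1)[OF JD(1)])
    show "component d a x \<in> tau BX n t ` J" if "x \<in> tau BX n t ` J" for x a
    proof -
      obtain g where g: "g \<in> J" "x = tau BX n t g" using \<open>x \<in> _\<close> by blast
      have "component d a x = tau BX n t (component d a g)"
        unfolding g(2) by (rule component_tau[OF t(2) ideal_onD(1)[OF JD(1) g(1)]])
      then show ?thesis using JD(2)[OF g(1)] by blast
    qed
  qed
  then show ?thesis
    unfolding J_tilde_loc_def
    by (rule homogeneous_ideal_base_change[OF Q subring_localized[OF f] hom_on_Fract, rotated])
      (use Fract_one_in_localized in blast)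
qed

section \<open>Graded linear algebra\<close>

text \<open>An element of degree \<open>a\<close> is a combination of the basis elements of degree \<open>a\<close>: grouping the terms of its
  expansion by degree gives a decomposition into homogeneous components, which is unique.\<close>

lemma graded_basis:
  fixes scale :: "'k::field \<Rightarrow> 'y::ab_group_add \<Rightarrow> 'y"
  assumes vs: "vector_space scale" and gr: "graded_space scale Yg"
    and V: "finite V" "\<not> module.dependent scale V" "module.span scale V = UNIV"
    and hom: "\<forall>b\<in>V. \<exists>a. b \<in> Yg a" and d: "d = degree_of Yg"
  shows "b \<in> V \<Longrightarrow> b \<in> Yg (d b)"
    and "y \<in> Yg a \<Longrightarrow> b \<in> V \<Longrightarrow> d b \<noteq> a \<Longrightarrow> module.representation scale V y b = 0"
proof -
  interpret vector_space scale by (rule vs)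
  have sub: "subspace (Yg a)" for a using gr by (simp add: graded_space_def)
  have uniq: "c = c'" if "finite {a. c a \<noteq> 0}" "\<forall>a. c a \<in> Yg a" "finite {a. c' a \<noteq> 0}" "\<forall>a. c' a \<in> Yg a"
    "(\<Sum>a | c a \<noteq> 0. c a) = (\<Sum>a | c' a \<noteq> 0. c' a)" for c c'
  proof -
    have "\<exists>!c''. finite {a. c'' a \<noteq> 0} \<and> (\<forall>a. c'' a \<in> Yg a) \<and> (\<Sum>a | c a \<noteq> 0. c a) = (\<Sum>a | c'' a \<noteq> 0. c'' a)"
      using gr unfolding graded_space_def by blast
    then show ?thesis using that by blast
  qed
  have sing: "finite {a'. (if a' = a then y else 0) \<noteq> 0}" "\<forall>a'. (if a' = a then y else 0) \<in> Yg a'"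
     "(\<Sum>a' | (if a' = a then y else 0) \<noteq> 0. (if a' = a then y else 0)) = y" if "y \<in> Yg a" for a y
  proof -
    have "{a'. (if a' = a then y else 0) \<noteq> 0} = (if y = 0 then {} else {a})" by auto
    then show "finite {a'. (if a' = a then y else 0) \<noteq> 0}" "\<forall>a'. (if a' = a then y else 0) \<in> Yg a'"
     "(\<Sum>a' | (if a' = a then y else 0) \<noteq> 0. (if a' = a then y else 0)) = y"
      using that subspace_0[OF sub] by auto
  qed
  have deg: "b \<in> Yg (d b)" if "b \<in> V" for b
  proof -
    have b0: "b \<noteq> 0" using that V(2) dependent_zero[of V] by auto
    from hom that obtain a where a: "b \<in> Yg a" by blast
    have "a' = a" if a': "b \<in> Yg a'" for a'
    proof -
      have "(\<lambda>a''. if a'' = a then b else 0) = (\<lambda>a''. if a'' = a' then b else 0)"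
        by (rule uniq[OF sing(1,2)[OF a] sing(1,2)[OF a']]) (simp only: sing(3)[OF a] sing(3)[OF a'])
      from fun_cong[OF this, of a'] show ?thesis using b0 by (auto split: if_splits)
    qed
    then have "d b = a" unfolding d degree_of_def using a by blast
    then show ?thesis using a by simp
  qed
  then show "b \<in> V \<Longrightarrow> b \<in> Yg (d b)" .
  assume y: "y \<in> Yg a" and b: "b \<in> V" "d b \<noteq> a"
  define r where "r = representation V y"
  define c where "c a' = (\<Sum>b | b \<in> V \<and> d b = a'. scale (r b) b)" for a'
  have c_deg: "c a' \<in> Yg a'" for a'
    unfolding c_def by (rule subspace_sum[OF sub]) (use deg in \<open>auto intro: subspace_scale[OF sub]\<close>)
  have supp: "{a. c a \<noteq> 0} \<subseteq> d ` V"
  proof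
    fix a' assume "a' \<in> {a. c a \<noteq> 0}"
    then have "{b \<in> V. d b = a'} \<noteq> {}" unfolding c_def by (auto simp del: Collect_empty_eq) 
    then show "a' \<in> d ` V" by blast
  qed
  have "(\<Sum>a' | c a' \<noteq> 0. c a') = (\<Sum>a'\<in>d ` V. c a')"
    using supp V(1) by (intro sum.mono_neutral_left) auto
  also have "\<dots> = (\<Sum>b\<in>V. scale (r b) b)"
    unfolding c_def by (rule sum.image_gen[OF V(1), symmetric])
  also have "\<dots> = y"
    unfolding r_def using sum_representation_eq[OF V(2) _ V(1) order_refl, of y] V(3) by simp
  finally have "c = (\<lambda>a'. if a' = a then y else 0)"
    using uniq[OF finite_subset[OF supp finite_imageI[OF V(1)]] _ sing(1,2)[OF y]] c_deg sing(3)[OF y] by simp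
  then have "(\<Sum>b' | b' \<in> V \<and> d b' = d b. scale (r b') b') = 0"
    using b(2) unfolding c_def by metis
  then have "r b = 0"
    by (rule independentD[OF V(2), rotated 2]) (use V(1) b in auto)
  then show "representation V y b = 0" by (simp add: r_def)
qed

section \<open>Surjectivity on tangent spaces\<close>

text \<open>The derivation \<open>D\<close> and the polynomials \<open>p\<^sub>u\<close> that describe \<open>K\<close> are the values of \<open>w\<close> on \<open>BX\<close> and \<open>BU\<close>.
  They need not be homogeneous, so they are replaced by their components of the right degrees. On homogeneous
  elements of \<open>J\<close> this changes nothing that can be seen in \<open>K\<close>.\<close>

lemma tangent_vector_as_shift:
  fixes J :: "('y, 'k::field) mpoly set" and K :: "('y, 'k dual_number) mpoly set"
  assumes fin: "finite BU" and dis: "BX \<inter> BU = {}"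
    and J: "homogeneous_ideal UNIV (BX \<union> BU) d J"
    and flat: "flat (ring_on (polys UNIV BU)) (quot_module (module_on (*) (polys UNIV (BX \<union> BU))) J)"
    and I: "I = restrict_poly BX ` J"
    and gen: "generates (ring_on (polys UNIV BX)) (T1 BX I) ((\<lambda>\<xi>. T1_class BX I (alpha BX BU J \<xi>)) ` \<Xi>)"
    and K: "homogeneous_ideal UNIV BX d K" and KI: "cmap std ` K = I"
    and eps: "\<And>q. dual_poly 0 q \<in> K \<longleftrightarrow> q \<in> I"
  shows "\<exists>w. (\<forall>v\<in>BX \<union> BU. w v \<in> poly_piece UNIV BX d (d v)) \<and> (\<forall>g\<in>J. shift_hom BX w g \<in> K)"
proof -
  note S = subring_on_UNIV
  let ?V = "BX \<union> BU" and ?r = "restrict_poly BX"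
  note JD = homogeneous_idealD[OF S J] and KD = homogeneous_idealD[OF S K]
  note SX = subring_polys[OF S, of BX]
  have II: "ideal_on (polys UNIV BX) I" unfolding I by (rule ideal_on_restrict_image[OF JD(1)])
  have JV: "g \<in> polys UNIV ?V" if "g \<in> J" for g using ideal_onD(1)[OF JD(1) that] .
  have Icomp: "component d a x \<in> I" if "x \<in> I" for a x
  proof -
    from that KI obtain k where k: "k \<in> K" "x = cmap std k" by blast
    then have "component d a x = cmap std (component d a k)" by (simp add: component_map)
    then show ?thesis using KI KD(2)[OF k(1)] by blast
  qed
  obtain \<psi> where \<psi>: "\<psi> \<in> carrier (normal_module BX I)"
    "\<And>x q. dual_poly x q \<in> K \<Longrightarrow> \<psi> x = coset (polys UNIV BX) I q"
    using tangent_vector_normal[OF KD(1) II KI eps] by blast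
  obtain D p where D: "D \<in> derivations BX" and p: "\<And>u. u \<in> BU \<Longrightarrow> p u \<in> polys UNIV BX"
    and dec: "\<And>g. g \<in> J \<Longrightarrow> \<psi> (?r g) = coset (polys UNIV BX) I (D (?r g) + (\<Sum>u\<in>BU. p u * u_coeff BU u g))"
    using T1_generated_decomposition[OF fin dis JD(1) flat I gen \<psi>(1)] by blast
  define w where "w = (\<lambda>v. if v \<in> BX then D (Var v) else p v)"
  define w0 where "w0 v = component d (d v) (w v)" for v
  have wP: "w v \<in> polys UNIV BX" if "v \<in> ?V" for v
    using that p derivationsD(1)[OF D Var_in_polys[OF S]] by (auto simp: w_def)
  have w0P: "w0 v \<in> poly_piece UNIV BX d (d v)" if "v \<in> ?V" for v
    using component_in_polys[OF S wP[OF that]] homog_component by (auto simp: w0_def poly_piece_iff)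
  have hom_case: "shift_hom BX w0 g \<in> K" if g: "g \<in> J" "homog d a g" for g a
  proof -
    from g(1) KI I obtain k where k: "k \<in> K" "?r g = cmap std k" by blast
    have "?r g = component d a (?r g)"
    proof -
      have "component d a (?r g) = ?r (component d a g)"
        unfolding restrict_poly_def
        by (rule component_subst_poly[OF hom_on_id _ JV[OF g(1)]]) (simp add: bar_def)
      then show ?thesis using component_homog[OF g(2), of a] by simp
    qed
    define q where "q = component d a (cmap eps k)"
    have "dual_poly (?r g) q = component d a k"
      using k(2) \<open>?r g = component d a (?r g)\<close>
      by (metis component_dual_poly dual_poly_std_eps q_def)
    then have q: "dual_poly (?r g) q \<in> K" using KD(2)[OF k(1)] by simp
    have "coset (polys UNIV BX) I q = coset (polys UNIV BX) I (shift_der BX w g)"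
      using \<psi>(2)[OF q] dec[OF g(1)] shift_der_decomposition[OF fin dis D JV[OF g(1)], of p]
      by (simp add: w_def)
    then have "q - shift_der BX w g \<in> I" by (simp add: coset_eq_iff[OF ideal_on_additive[OF II SX]])
    then have "component d a (q - shift_der BX w g) \<in> I" by (rule Icomp)
    moreover have "component d a q = q" unfolding q_def by (simp add: component_homog[OF homog_component])
    moreover have "component d a (shift_der BX w g) = shift_der BX w0 g"
      by (rule component_shift_der[OF _ JV[OF g(1)] g(2)]) (simp add: w0_def)
    ultimately have "q - shift_der BX w0 g \<in> I" by (simp add: component_diff)
    then have "dual_poly 0 (q - shift_der BX w0 g) \<in> K" by (simp add: eps)
    from ideal_on_diff[OF KD(1) SX q this]
    show ?thesis by (simp add: shift_hom_eq dual_poly_diff)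
  qed
  have "shift_hom BX w0 g \<in> K" if g: "g \<in> J" for g
  proof -
    have "shift_hom BX w0 g = (\<Sum>a\<in>mdeg d ` ks g. shift_hom BX w0 (component d a g))"
      by (subst component_sum_eq[of g d]) (rule hom_on_sum[OF hom_on_shift_hom S UNIV_I])
    also have "\<dots> \<in> K"
      by (rule ideal_on_sum[OF KD(1)]) (rule hom_case[OF JD(2)[OF g] homog_component])
    finally show ?thesis .
  qed
  then show ?thesis using w0P by blast
qed

lemma shift_hom_congruent:
  assumes J: "ideal_on (polys UNIV (BX \<union> BU)) J" and II: "ideal_on (polys UNIV BX) I"
    and K: "ideal_on (polys UNIV BX) K" and eps: "\<And>q. dual_poly 0 q \<in> K \<longleftrightarrow> q \<in> I"
    and w: "\<And>v. v \<in> BX \<union> BU \<Longrightarrow> w' v - w v \<in> I" and g: "g \<in> J" "shift_hom BX w g \<in> K"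
  shows "shift_hom BX w' g \<in> K"
proof -
  have "shift_der BX w' g - shift_der BX w g \<in> I"
    by (rule shift_der_cong_ideal[OF II w ideal_onD(1)[OF J g(1)]])
  then have "dual_poly 0 (shift_der BX w' g - shift_der BX w g) \<in> K" by (simp add: eps)
  from ideal_onD(3)[OF K this g(2)] show ?thesis by (simp add: shift_hom_eq dual_poly_add)
qed

text \<open>The substitution lifts every element of \<open>I\<close> to an element of the left-hand side; multiplying with \<open>\<epsilon>\<close> shows
  that it contains \<open>\<epsilon>I\<close>. Any two lifts in \<open>K\<close> of the same element differ by an element of \<open>\<epsilon>I\<close>.\<close>

lemma Idl_shift_hom_eq:
  fixes K :: "('y, 'k::field dual_number) mpoly set"
  assumes I: "I = restrict_poly BX ` J" and K: "ideal_on (polys UNIV BX) K"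
    and KI: "cmap std ` K = I" and eps: "\<And>q. dual_poly 0 q \<in> K \<longleftrightarrow> q \<in> I"
    and w: "\<And>g. g \<in> J \<Longrightarrow> shift_hom BX w g \<in> K"
  shows "Idl\<^bsub>ring_on (polys UNIV BX)\<^esub> (shift_hom BX w ` J) = K"
proof -
  note S = subring_on_UNIV
  note SX = subring_polys[OF S, of BX]
  have sub: "shift_hom BX w ` J \<subseteq> polys UNIV BX" using w ideal_onD(1)[OF K] by blast
  let ?L = "Idl\<^bsub>ring_on (polys UNIV BX)\<^esub> (shift_hom BX w ` J)"
  note L = Idl_facts[OF SX sub]
  have LK: "?L \<subseteq> K" by (rule L(3)[OF K]) (use w in blast)
  have eL: "dual_poly 0 q \<in> ?L" if q: "q \<in> I" for q
  proof -
    from q I obtain g where g: "g \<in> J" "q = restrict_poly BX g" by blast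
    have "dual_poly 0 (1 :: ('y, 'k) mpoly) \<in> polys UNIV BX"
      using subring_onD(1,2)[OF subring_polys[OF S, of BX]] by (simp add: dual_poly_in_polys)
    then have "dual_poly 0 1 * shift_hom BX w g \<in> ?L" using ideal_onD(4)[OF L(1)] L(2) g(1) by blast
    then show ?thesis by (simp add: shift_hom_eq dual_poly_mult g(2))
  qed
  have "k \<in> ?L" if k: "k \<in> K" for k
  proof -
    from k KI I obtain g where g: "g \<in> J" "cmap std k = restrict_poly BX g" by blast
    have "k - shift_hom BX w g = dual_poly 0 (cmap eps k - shift_der BX w g)"
      using g(2) dual_poly_std_eps[of k, symmetric]
      by (metis (no_types) diff_self dual_poly_diff shift_hom_eq)
    moreover have "k - shift_hom BX w g \<in> K" by (rule ideal_on_diff[OF K SX k w[OF g(1)]])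
    ultimately have "k - shift_hom BX w g \<in> ?L" using eps eL by metis
    moreover have "shift_hom BX w g \<in> ?L" using L(2) g(1) by blast
    ultimately have "(k - shift_hom BX w g) + shift_hom BX w g \<in> ?L" by (rule ideal_onD(3)[OF L(1)])
    then show ?thesis by simp
  qed
  then show ?thesis using LK by blast
qed

text \<open>Some generator of the cover is mapped outside the maximal ideal \<open>(\<epsilon>)\<close>, hence to a unit.\<close>

lemma locally_free_base_change_dual:
  fixes \<phi> :: "'r::comm_ring_1 \<Rightarrow> 'k::field dual_number"
  assumes R: "subring_on R" and h: "hom_on R \<phi>" and K: "homogeneous_ideal R V d K"
    and lf: "locally_free_of_rank (ring_on R) (graded_quot R V d K a) n"
  shows "locally_free_of_rank (ring_on UNIV) (graded_quot UNIV V d (base_change UNIV V \<phi> K) a) n"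
proof -
  obtain G where G: "G \<subseteq> R" "Idl\<^bsub>ring_on R\<^esub> G = R"
    "\<And>g. g \<in> G \<Longrightarrow> free_on_basic_open (ring_on R) (graded_quot R V d K a) g n"
    using lf by (auto simp: locally_free_of_rank_def)
  have "\<exists>g\<in>G. \<phi> g \<notin> {x. std x = 0}"
    by (rule exists_unit_generator[OF R h _ _ G(1,2)]) (auto simp: ideal_on_def)
  then obtain g where g: "g \<in> G" "std (\<phi> g) \<noteq> 0" by blast
  have gR: "g \<in> R" using g G(1) by blast
  obtain b where "\<forall>i<n. b i \<in> poly_piece UNIV V d a"
    "\<forall>y\<in>poly_piece UNIV V d a. \<exists>c. y - lincomb c b n \<in> base_change UNIV V \<phi> K"
    "\<forall>c. lincomb c b n \<in> base_change UNIV V \<phi> K \<longrightarrow> (\<forall>i<n. c i = 0)"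
    using base_change_free[OF R h K gR dual_unit[OF g(2)] G(3)[OF g(1)]] by blast
  then show ?thesis
    using homogeneous_idealD(1)[OF subring_on_UNIV homogeneous_ideal_base_change[OF R subring_on_UNIV h subset_UNIV K]]
    by (intro locally_free_of_free)
qed

text \<open>The tangent vector at the origin with coordinates \<open>c\<close>, as a map \<open>\<k>[T\<^sup>*] \<rightarrow> \<k>[\<epsilon>]\<close>.\<close>

lemma hom_on_first_order:
  "hom_on R (\<lambda>p :: (nat, 'k::comm_ring_1) mpoly. Dual (lk p 0) (\<Sum>i<n. c i * lk p (mterm i 1)))"
proof -
  have "(\<Sum>i<n. c i * lk (1 :: (nat, 'k) mpoly) (mterm i 1)) = 0"
    by (rule sum.neutral) (simp add: lookup_one when_def single_one_iff)
  then show ?thesis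
    by (simp add: hom_on_def lookup_add lookup_mult_zero_single distrib_left sum.distrib Dual_arith
        sum_distrib_left mult_ac one_dual_number_def)
qed

theorem theorem9p5:
  fixes scale :: "'k::field \<Rightarrow> 'y::ab_group_add \<Rightarrow> 'y"
    and Yg :: "'a::ab_group_add \<Rightarrow> 'y set"
    and U BX BU :: "'y set"
    and d :: "'y \<Rightarrow> 'a"
    and J I :: "('y, 'k) mpoly set"
    and h :: "'a \<Rightarrow> nat"
    and T :: "('y \<Rightarrow> ('y, 'k) mpoly) set"
    and n :: nat
    and t :: "nat \<Rightarrow> 'y \<Rightarrow> ('y, 'k) mpoly"
    and f :: "(nat, 'k) mpoly"
    and Jf :: "('y, (nat, 'k) mpoly fract) mpoly set"
  assumes "vector_space scale"
    and "graded_space scale Yg"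
    and "homogeneous_subspace scale Yg U"
    and "finite (BX \<union> BU)" "BX \<inter> BU = {}"
    and "\<not> module.dependent scale (BX \<union> BU)" "module.span scale (BX \<union> BU) = UNIV"
    and "module.span scale BU = U"
    and "\<forall>b\<in>BX \<union> BU. \<exists>a. b \<in> Yg a"
    and "d = degree_of Yg"
    and "homogeneous_ideal UNIV (BX \<union> BU) d J"
    and "flat (ring_on (polys UNIV BU)) (quot_module (module_on (*) (polys UNIV (BX \<union> BU))) J)"
    and "I = restrict_poly BX ` J"
    and admissible: "\<forall>a. free_of_rank (ring_on UNIV) (graded_quot UNIV BX d I a) (h a)"
    and "generates (ring_on (polys UNIV BX)) (T1 BX I)
           ((\<lambda>\<xi>. T1_class BX I (alpha BX BU J \<xi>)) ` dual_space scale U)"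
    and "T \<subseteq> graded_homs scale Yg (poly_module UNIV BX) (poly_piece UNIV BX d)"
    and "basis_of_maps T n t"
    and "(\<lambda>s y. coset (polys UNIV BX) I (s y)) ` T =
           graded_homs scale Yg (quot_module (poly_module UNIV BX) I)
             (\<lambda>a. carrier (graded_quot UNIV BX d I a))"
    and "f \<in> polys UNIV {..<n}" "Poly_Mapping.lookup f 0 \<noteq> 0"
    and "Jf = J_tilde_loc BX n t f J"
    and "flat (ring_on (localized n f)) (quot_module (poly_module (localized n f) BX) Jf)"
    and "\<forall>a. locally_free_of_rank (ring_on (localized n f))
               (graded_quot (localized n f) BX d Jf a) (h a)"
  shows "Jf \<in> hilb (localized n f) BX d h
       \<and> base_change UNIV BX (origin n f) Jf = I
       \<and> tangent_map BX Jf ` tangent_space_origin n f = tangent_space_hilb BX d h I"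
proof -
  note vs = assms(1) and gr = assms(2) and fin = assms(4) and dis = assms(5)
  let ?V = "BX \<union> BU" and ?P = "polys UNIV BX :: ('y, 'k) mpoly set" and ?Q = "polys UNIV {..<n} :: (nat, 'k) mpoly set"
  let ?r = "restrict_poly BX :: ('y, 'k) mpoly \<Rightarrow> _"
  note basis = graded_basis[OF vs gr fin assms(6,7,9,10)]
  note J = assms(11) and I = assms(13)
  note S = subring_on_UNIV
  note JD = homogeneous_idealD[OF S J]
  have SX: "subring_on ?P" and Q: "subring_on ?Q" by (simp_all add: subring_polys)
  have II: "ideal_on ?P I" unfolding I by (rule ideal_on_restrict_image[OF JD(1)])
  note IA = ideal_on_additive[OF II SX]
  have JV: "J \<subseteq> polys UNIV ?V" using ideal_onD(1)[OF JD(1)] by blast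
  have f: "f \<in> ?Q" "f \<noteq> 0" using assms(19,20) by auto
  note L = subring_localized[OF f]
  note Jf = assms(21)
  have TP: "s y \<in> ?P" if "s \<in> T" for s y
    using that assms(16) by (auto simp: graded_homs_def poly_module_def)
  have Th: "homog d (d v) (s v)" if "s \<in> T" "v \<in> ?V" for s v
  proof -
    have "s v \<in> poly_piece UNIV BX d (d v)"
      using that(1) assms(16) basis(1)[OF that(2)] unfolding graded_homs_def by blast
    then show ?thesis by (simp add: poly_piece_iff)
  qed
  have tT: "t i \<in> T" if "i < n" for i
  proof -
    have "t i = (\<lambda>y. \<Sum>j<n. Const (if j = i then 1 else 0) * t j y)"
    proof
      fix y
      have "(\<Sum>j<n. Const (if j = i then 1 else 0) * t j y) = (\<Sum>j<n. if j = i then t j y else 0)"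
        by (rule sum.cong) auto
      then show "t i y = (\<Sum>j<n. Const (if j = i then 1 else 0) * t j y)" using that by simp
    qed
    then have "t i \<in> range (\<lambda>c y. \<Sum>i<n. Const (c i) * t i y)" by (rule range_eqI[where x="\<lambda>j. if j = i then 1 else 0"])
    then show ?thesis using assms(17) by (simp add: basis_of_maps_def)
  qed
  have tP: "t i v \<in> ?P" if "i < n" for i v using TP[OF tT[OF that]] .
  have th: "homog d (d v) (t i v)" if "i < n" "v \<in> ?V" for i v using Th[OF tT[OF that(1)] that(2)] .
  have Jf_hom: "homogeneous_ideal (localized n f) BX d Jf"
    unfolding Jf by (rule homogeneous_ideal_J_tilde_loc[OF f tP th J])
  have part1: "Jf \<in> hilb (localized n f) BX d h"
    using Jf_hom assms(23) by (simp add: hilb_def)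
  have JfL: "Jf \<subseteq> polys (localized n f) BX"
    using ideal_onD(1)[OF homogeneous_idealD(1)[OF L Jf_hom]] by blast
  have bc: "base_change UNIV BX \<phi> Jf = Idl\<^bsub>ring_on (polys UNIV BX)\<^esub>
     ((\<lambda>g. cmap (\<lambda>p. \<phi> (Fract p 1)) (tau BX n t g)) ` J)"
    if "hom_on (localized n f) \<phi>" for \<phi> :: "(nat, 'k) mpoly fract \<Rightarrow> 's::comm_ring_1"
    unfolding Jf by (rule base_change_J_tilde_loc[OF f that tP JV])
  have \<chi>: "hom_on ?Q (\<lambda>p. \<phi> (Fract p 1))" if "hom_on (localized n f) \<phi>"
    for \<phi> :: "(nat, 'k) mpoly fract \<Rightarrow> 's::comm_ring_1"
    by (rule hom_on_comp[OF hom_on_Fract that]) (use Fract_one_in_localized in blast)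
  note orig = localized_extension[OF f hom_on_lookup_zero right_inverse[OF assms(20)], folded origin_eq]
  have part2: "base_change UNIV BX (origin n f) Jf = I"
  proof -
    have "cmap (\<lambda>p. origin n f (Fract p 1)) (tau BX n t g) = ?r g" if g: "g \<in> J" for g
    proof -
      have gV: "g \<in> polys UNIV ?V" using g JV by blast
      have c: "origin n f (Fract (Const c) 1) = c" for c
        using orig(2)[OF Const_in_polys[OF S UNIV_I]] by simp
      have v: "origin n f (Fract (Var i) 1) = 0" if "i < n" for i
        using orig(2)[OF Var_in_polys[OF S]] that by (simp add: lookup_single when_def single_one_iff)
      have "cmap (\<lambda>p. origin n f (Fract p 1)) (tau BX n t g)
        = subst_poly (\<lambda>c. c) (\<lambda>v. bar BX v + (\<Sum>i<n. cmap (\<lambda>c. c) (t i v) *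
            Const (origin n f (Fract (Var i) 1)))) g"
        using map_tau[OF tP gV \<chi>[OF orig(3)]] by (simp add: c)
      then show ?thesis by (simp add: v restrict_poly_def)
    qed
    then have "(\<lambda>g. cmap (\<lambda>p. origin n f (Fract p 1)) (tau BX n t g)) ` J = I"
      unfolding I by (rule image_cong[OF refl])
    then show ?thesis using bc[OF orig(3)] Idl_ideal_eq[OF SX II] by simp
  qed
  \<comment> \<open>Pulling back along a tangent vector and then reducing modulo \<open>\<epsilon>\<close> amounts to pulling back to
    the origin, where the fiber is \<open>I\<close>.\<close>
  have sub: "tangent_map BX Jf \<phi> \<in> tangent_space_hilb BX d h I" if \<phi>: "\<phi> \<in> tangent_space_origin n f" for \<phi>
  proof -
    have rh: "\<phi> \<in> ring_hom (ring_on (localized n f)) (ring_on UNIV)"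
      and st: "\<And>q. q \<in> localized n f \<Longrightarrow> std (\<phi> q) = origin n f q"
      using \<phi> by (auto simp: tangent_space_origin_def)
    have add: "\<phi> (x + y) = \<phi> x + \<phi> y" and mult: "\<phi> (x * y) = \<phi> x * \<phi> y"
      if "x \<in> localized n f" "y \<in> localized n f" for x y
      using ring_hom_add[OF rh, of x y] ring_hom_mult[OF rh, of x y] that by auto
    have "\<phi> 0 = 0" using add[of 0 0] subring_onD(1)[OF L] by simp
    then have hom: "hom_on (localized n f) \<phi>"
      using add mult ring_hom_one[OF rh] by (simp add: hom_on_def)
    have "base_change UNIV BX \<phi> Jf \<in> hilb UNIV BX d h"
      using homogeneous_ideal_base_change[OF L S hom subset_UNIV Jf_hom]
        locally_free_base_change_dual[OF L hom Jf_hom] assms(23)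
      by (simp add: hilb_def)
    moreover have "base_change UNIV BX std (base_change UNIV BX \<phi> Jf) = I"
    proof -
      have "base_change UNIV BX std (base_change UNIV BX \<phi> Jf) = base_change UNIV BX (\<lambda>x. std (\<phi> x)) Jf"
        by (rule base_change_base_change[OF L S S hom subset_UNIV hom_on_std subset_UNIV JfL])
      also have "\<dots> = base_change UNIV BX (origin n f) Jf"
        by (rule base_change_cong[OF st JfL])
      finally show ?thesis using part2 by simp
    qed
    ultimately show ?thesis by (simp add: tangent_map_def tangent_space_hilb_def)
  qed
  have sup: "K \<in> tangent_map BX Jf ` tangent_space_origin n f" if K: "K \<in> tangent_space_hilb BX d h I" for K
  proof -
    have Kh: "homogeneous_ideal UNIV BX d K"
      and Kl: "\<And>a. locally_free_of_rank (ring_on UNIV) (graded_quot UNIV BX d K a) (h a)"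
      and Kb: "base_change UNIV BX std K = I"
      using K by (auto simp: tangent_space_hilb_def hilb_def)
    note KD = homogeneous_idealD[OF S Kh]
    have KI: "cmap std ` K = I" using base_change_std_eq[OF KD(1)] Kb by simp
    have eps: "dual_poly 0 q \<in> K \<longleftrightarrow> q \<in> I" for q
    proof
      assume "dual_poly 0 q \<in> K"
      then show "q \<in> I" using hilb_dual_eps[OF Kh Kl] KI by blast
    next
      assume "q \<in> I"
      with KI obtain k where k: "k \<in> K" "q = cmap std k" by blast
      have "dual_poly 0 (1 :: ('y, 'k) mpoly) \<in> polys UNIV BX"
        using subring_onD(1,2)[OF SX] by (simp add: dual_poly_in_polys)
      from ideal_onD(4)[OF KD(1) this k(1)]
      have "dual_poly 0 1 * dual_poly (cmap std k) (cmap eps k) \<in> K"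
        by (simp only: dual_poly_std_eps)
      then show "dual_poly 0 q \<in> K" by (simp add: dual_poly_mult k(2))
    qed
    obtain w where w: "\<And>v. v \<in> ?V \<Longrightarrow> w v \<in> poly_piece UNIV BX d (d v)"
      "\<And>g. g \<in> J \<Longrightarrow> shift_hom BX w g \<in> K"
      using tangent_vector_as_shift[OF _ dis J assms(12) I assms(15) Kh KI eps] fin by blast
    \<comment> \<open>The linear extension of \<open>w\<close> to \<open>Y\<close> preserves degrees, so modulo \<open>I\<close> it comes from an element
      of \<open>T\<close>; the coordinates \<open>c\<close> of the latter are those of the tangent vector sought.\<close>
    interpret vector_space scale by (rule vs)
    let ?rep = "representation ?V"
    define s where "s y = (\<Sum>b\<in>?V. Const (?rep y b) * w b)" for y
    have spanV: "y \<in> span ?V" for y using assms(7) by simp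
    have s_in: "s y \<in> ?P" for y
      unfolding s_def using w(1) by (intro subring_on_sum[OF SX] polys_mult[OF S] Const_in_polys[OF S]) (auto simp: poly_piece_iff)
    have s_add: "s (y + z) = s y + s z" for y z
      by (simp add: s_def representation_add[OF assms(6) spanV spanV] single_add distrib_right sum.distrib)
    have s_scale: "s (scale c y) = Const c * s y" for c y
      by (simp add: s_def representation_scale[OF assms(6) spanV] Const_mult sum_distrib_left mult.assoc)
    have s_piece: "s y \<in> poly_piece UNIV BX d a" if y: "y \<in> Yg a" for y a
      unfolding s_def
    proof (rule poly_piece_sum[OF S])
      fix b assume b: "b \<in> ?V"
      show "Const (?rep y b) * w b \<in> poly_piece UNIV BX d a"
      proof (cases "d b = a")
        case True
        then show ?thesis using poly_piece_closed(3)[OF S UNIV_I w(1)[OF b]] by simp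
      next
        case False
        then show ?thesis using basis(2)[OF y b] poly_piece_closed(1)[OF S] by simp
      qed
    qed
    have "(\<lambda>y. coset ?P I (s y)) \<in> graded_homs scale Yg (quot_module (poly_module UNIV BX) I)
             (\<lambda>a. carrier (graded_quot UNIV BX d I a))"
    proof -
      have sm: "c \<odot>\<^bsub>quot_module (poly_module UNIV BX) I\<^esub> coset ?P I p = coset ?P I (Const c * p)" for c p
        unfolding poly_module_def
        by (rule quot_module_smult[OF IA refl]) (rule ideal_onD(4)[OF II Const_in_polys[OF S UNIV_I]])
      have ad: "coset ?P I p \<oplus>\<^bsub>quot_module (poly_module UNIV BX) I\<^esub> coset ?P I q = coset ?P I (p + q)" for p q
        unfolding poly_module_def by (rule quot_module_add[OF IA])
      have ca: "coset ?P I p \<in> carrier (quot_module (poly_module UNIV BX) I)" if "p \<in> ?P" for p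
        using that unfolding poly_module_def by (simp add: quot_module_simps)
      show ?thesis
        using s_piece
        by (auto simp: graded_homs_def s_add s_scale sm ad ca s_in graded_quot_simps(1)[OF S II])
    qed
    then obtain s' where s': "s' \<in> T" "(\<lambda>y. coset ?P I (s y)) = (\<lambda>y. coset ?P I (s' y))"
      using assms(18) by (metis (no_types, lifting) image_iff)
    then obtain c where c: "s' = (\<lambda>y. \<Sum>i<n. Const (c i) * t i y)"
      using assms(17) unfolding basis_of_maps_def by blast
    have diff: "s' v - w v \<in> I" if v: "v \<in> ?V" for v
    proof -
      have "s v = (\<Sum>b\<in>?V. if b = v then w b else 0)"
        unfolding s_def by (rule sum.cong) (auto simp: representation_basis[OF assms(6) v])
      then have "s v = w v" using fin v by simp
      moreover have "coset ?P I (s' v) = coset ?P I (s v)" using fun_cong[OF s'(2), of v] by simp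
      ultimately show ?thesis by (simp add: coset_eq_iff[OF IA])
    qed
    have s'K: "shift_hom BX s' g \<in> K" if "g \<in> J" for g
      by (rule shift_hom_congruent[OF JD(1) II KD(1) eps diff that w(2)[OF that]])
    define \<phi>0 where "\<phi>0 = (\<lambda>p :: (nat, 'k) mpoly. Dual (lk p 0) (\<Sum>i<n. c i * lk p (mterm i 1)))"
    have \<phi>0: "hom_on ?Q \<phi>0" unfolding \<phi>0_def by (rule hom_on_first_order)
    define e where "e = Dual (inverse (std (\<phi>0 f))) (- eps (\<phi>0 f) * inverse (std (\<phi>0 f)) * inverse (std (\<phi>0 f)))"
    have e: "\<phi>0 f * e = 1" unfolding e_def by (rule dual_unit) (simp add: \<phi>0_def assms(20))
    define \<phi> where "\<phi> = localized_extension n f \<phi>0 e"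
    note ext = localized_extension[OF f \<phi>0 e, folded \<phi>_def]
    have \<phi>C: "\<phi> (Fract (Const a) 1) = Dual a 0" for a
    proof -
      have "mterm i (1::nat) \<noteq> 0" for i :: nat by (rule single_one_iff)
      then have "(\<Sum>i<n. c i * lk (Const a :: (nat, 'k) mpoly) (mterm i 1)) = 0"
        by (intro sum.neutral ballI) (auto simp: lookup_single when_def)
      then show ?thesis using ext(2)[OF Const_in_polys[OF S UNIV_I]] by (simp add: \<phi>0_def)
    qed
    have \<phi>V: "\<phi> (Fract (Var j) 1) = Dual 0 (c j)" if j: "j < n" for j
    proof -
      have "(\<Sum>i<n. c i * lk (Var j :: (nat, 'k) mpoly) (mterm i 1)) = (\<Sum>i<n. if i = j then c i else 0)"
        by (rule sum.cong) (auto simp: lookup_single when_def single_one_iff)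
      then have "\<phi>0 (Var j) = Dual 0 (c j)"
        using j by (simp add: \<phi>0_def lookup_single when_def single_one_iff)
      then show ?thesis using ext(2)[OF Var_in_polys[OF S]] j by simp
    qed
    have "\<phi> \<in> tangent_space_origin n f"
    proof -
      have "std (\<phi> q) = origin n f q" if q: "q \<in> localized n f" for q
      proof -
        from q obtain p m where p: "p \<in> ?Q" "q = Fract p (f ^ m)" by (auto simp: localized_def)
        have "std (e ^ m) = inverse (lk f 0) ^ m"
          using hom_on_power[OF hom_on_std[of UNIV] S UNIV_I, of e m] by (simp add: e_def \<phi>0_def)
        then show ?thesis unfolding p(2) ext(1)[OF p(1)] orig(1)[OF p(1)] by (simp add: \<phi>0_def)
      qed
      moreover have "\<phi> \<in> ring_hom (ring_on (localized n f)) (ring_on UNIV)"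
        using hom_onD[OF ext(3)] by (intro ring_hom_memI) auto
      ultimately show ?thesis using \<phi>C by (simp add: tangent_space_origin_def)
    qed
    moreover have "tangent_map BX Jf \<phi> = K"
    proof -
      have "cmap (\<lambda>p. \<phi> (Fract p 1)) (tau BX n t g) = shift_hom BX s' g" if g: "g \<in> J" for g
      proof -
        have gV: "g \<in> polys UNIV ?V" using g JV by blast
        have arg: "bar BX v + (\<Sum>i<n. cmap emb (t i v) * Const (\<phi> (Fract (Var i) 1))) = dual_poly (bar BX v) (s' v)" for v
        proof (rule poly_mapping_eqI)
          fix m
          have b: "lk (bar BX v :: ('y, 'k dual_number) mpoly) m = Dual (lk (bar BX v) m) 0"
            unfolding bar_def by (cases "v \<in> BX"; cases "mterm v 1 = m")
              (simp_all add: lookup_single one_dual_number_def)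
          have "lk (\<Sum>i<n. cmap emb (t i v) * Const (\<phi> (Fract (Var i) 1))) m
            = (\<Sum>i<n. Dual 0 (c i * lk (t i v) m))"
            unfolding lookup_sum
            by (rule sum.cong) (auto simp: \<phi>V mult.commute[of _ "Const _"] lookup_Const_mult lookup_map Dual_arith)
          also have "\<dots> = Dual 0 (\<Sum>i<n. c i * lk (t i v) m)"
            by (induction n) (auto simp: Dual_arith)
          also have "(\<Sum>i<n. c i * lk (t i v) m) = lk (s' v) m"
            by (simp add: c lookup_sum lookup_Const_mult)
          finally show "lk (bar BX v + (\<Sum>i<n. cmap emb (t i v) * Const (\<phi> (Fract (Var i) 1)))) m
              = lk (dual_poly (bar BX v) (s' v)) m"
            by (simp add: lookup_add lookup_dual_poly b Dual_arith)
        qed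
        show ?thesis
          using map_tau[OF tP gV \<chi>[OF ext(3)]] by (simp add: \<phi>C arg shift_hom_def)
      qed
      then have "(\<lambda>g. cmap (\<lambda>p. \<phi> (Fract p 1)) (tau BX n t g)) ` J = shift_hom BX s' ` J"
        by (rule image_cong[OF refl])
      then show ?thesis
        unfolding tangent_map_def bc[OF ext(3)] using Idl_shift_hom_eq[OF I KD(1) KI eps s'K] by simp
    qed
    ultimately show ?thesis by blast
  qed
  have "tangent_map BX Jf ` tangent_space_origin n f = tangent_space_hilb BX d h I"
    using sub sup by blast
  then show ?thesis using part1 part2 by blast
qed

end
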